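(* Let $B\ge2$ be a fixed integer and $\alpha\in(0,1)$. Consider the nested sampling setting (see context) with original estimate $\hat{\hat\psi}_{n,R_0}$ and resample estimates $\psi_{n,R}^{**1},\ldots,\psi_{n,R}^{**B}$. Assume: (i) for some $\sigma^2>0$, as $n\to\infty$, $\sqrt n(\hat\psi_n-\psi)\Rightarrow N(0,\sigma^2)$, and $\sqrt n(\psi_n^*-\hat\psi_n)\Rightarrow N(0,\sigma^2)$ conditionally on the data in probability; (ii) as $n\to\infty$, $\tau^2(\hat P_n)\stackrel{p}{\to}\tau^2(P)=:\tau^2$, $\kappa_3(\hat P_n)\stackrel{p}{\to}\kappa_3(P)=:\kappa_3$, $\tau^2(P_n^* )\stackrel{p}{\to}\tau^2$ and $\kappa_3(P_n^* )\stackrel{p}{\to}\kappa_3$, where $0<\tau^2<\infty$ and $\kappa_3<\infty$; (iii) $n,R_0,R\to\infty$ with $R_0/n\to p_0$ and $R/n\to p$ for some constants $0<p_0,p<1$. Let $\rho=\sqrt{p_0/p}$, and let $$S_M^2=\frac1{B-1}\sum_{b=1}^B\left(\psi_{n,R}^{**b}-\overline{\psi_{n,R}^{**}}\right)^2,\ S_M\ge0,\qquad \overline{\psi_{n,R}^{**}}=\frac1B\sum_{b=1}^B\psi_{n,R}^{**b},\qquad q_{M,1-\alpha/2}=\max\{\rho^{-1},1\}\,t_{B-1,1-\alpha/2}.$$ Then the interval $$\mathcal I_M=\left[\hat{\hat\psi}_{n,R_0}-q_{M,1-\alpha/2}S_M,\ \hat{\hat\psi}_{n,R_0}+q_{M,1-\alpha/2}S_M\right]$$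 satisfies $\liminf_{n\to\infty}\mathbb P_n(\psi\in\mathcal I_M)\ge1-\alpha$, where $\mathbb P_n$ denotes the probability with respect to the data $X_1,\ldots,X_n$ and all randomness from the resampling and computation. Moreover, if $\rho=1$ (same computation sizes for each resample estimate and the original estimate), then $\lim_{n\to\infty}\mathbb P_n(\psi\in\mathcal I_M)=1-\alpha$.
   Context: Data $X_1,X_2,\ldots$ are i.i.d. from $P$; $\psi(\cdot)$ is a real-valued functional on distributions, $\psi=\psi(P)$; $\hat P_n$ is the empirical distribution of $X_1,\ldots,X_n$. For $b=1,\ldots,B$, independently across $b$ given the data, $P_n^{*b}$ is the empirical distribution of $n$ points drawn independently and uniformly with replacement from $\{X_1,\ldots,X_n\}$; $P_n^*$ denotes a generic one. The (hypothetical, noise-free) estimates are $\hat\psi_n=\psi(\hat P_n)$, $\psi_n^{*b}=\psi(P_n^{*b})$, with generic $\psi_n^*=\psi(P_n^* )$. Noisy computation: for a given distribution $Q$ one can only generate i.i.d. noisy runs $\hat\psi_r(Q)$, $r=1,2,\ldots$, with $E\hat\psi_r(Q)=\psi(Q)$ (unbiased). Set $\tau^2(Q)=\mathrm{Var}(\hat\psi_r(Q))$ and $\kappa_3(Q)=E|\hat\psi_r(Q)-\psi(Q)|^3$ (moments over the computation randomness for fixed $Q$). Define $$\hat{\hat\psi}_{n,R_0}=\frac1{R_0}\sum_{r=1}^{R_0}\hat\psi_r(\hat P_n),\qquad \psi_{n,R}^{**b}=\frac1R\sum_{r=1}^R\hat\psi_r(P_n^{*b}),\quad b=1,\ldots,B,$$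 where the runs are conditionally independent given the driving distribution, and the computation randomness used for the original estimate and for the different resample estimates is independent (given $\hat P_n,P_n^{*1},\ldots,P_n^{*B}$, all runs are independent, each depending only on its own driving distribution). "$\Rightarrow$" is convergence in distribution; "$\sqrt n(\psi_n^*-\hat\psi_n)\Rightarrow N(0,\sigma^2)$ conditionally on the data in probability" means $P(\sqrt n(\psi_n^*-\hat\psi_n)\le x\mid\hat P_n)\stackrel{p}{\to}P(N(0,\sigma^2)\le x)$ for every $x\in\mathbb R$. $t_{k,q}$ is the $q$-quantile of Student's $t$-distribution with $k$ degrees of freedom. *)

theory Defs
  imports "HOL-Probability.Probability"
begin

text \<open>
  Convergence in probability to a constant, phrased with open neighbourhoods so that it also applies
  to extended-nonnegative-real valued variables; in a metric space this is
  \<open>\<P>(dist (V n) c > \<epsilon>) \<longrightarrow> 0\<close> for every \<open>\<epsilon> > 0\<close>.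
\<close>

definition conv_in_prob :: "'w measure \<Rightarrow> (nat \<Rightarrow> 'w \<Rightarrow> 'b::topological_space) \<Rightarrow> 'b \<Rightarrow> bool" where
  "conv_in_prob M V c \<longleftrightarrow>
     (\<forall>U. open U \<longrightarrow> c \<in> U \<longrightarrow> (\<lambda>n. measure M {\<omega> \<in> space M. V n \<omega> \<notin> U}) \<longlonglongrightarrow> 0)"

definition cond_prob_given :: "'w measure \<Rightarrow> 'w measure \<Rightarrow> ('w \<Rightarrow> bool) \<Rightarrow> 'w \<Rightarrow> real" where
  "cond_prob_given M F A = real_cond_exp M F (indicator {\<omega> \<in> space M. A \<omega>})"

text \<open>
  Conditionally on the sub-sigma-algebra \<open>F\<close>, the finite family \<open>(V i)\<^sub>i\<close> of \<open>S\<close>-valued random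
  variables is independent, \<open>V i\<close> having the (random) law \<open>L i\<close>.
\<close>

definition cond_indep_with_laws ::
  "'w measure \<Rightarrow> 'w measure \<Rightarrow> 'i set \<Rightarrow> 'b measure \<Rightarrow> ('i \<Rightarrow> 'w \<Rightarrow> 'b) \<Rightarrow> ('i \<Rightarrow> 'w \<Rightarrow> 'b measure) \<Rightarrow> bool"
where
  "cond_indep_with_laws M F I S V L \<longleftrightarrow>
     (\<forall>i\<in>I. V i \<in> measurable M S) \<and>
     (\<forall>C. (\<forall>i\<in>I. C i \<in> sets S) \<longrightarrow>
        (AE \<omega> in M. cond_prob_given M F (\<lambda>\<omega>. \<forall>i\<in>I. V i \<omega> \<in> C i) \<omega> = (\<Prod>i\<in>I. measure (L i \<omega>) (C i))))"

definition centered_normal :: "real \<Rightarrow> real measure" where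
  "centered_normal \<sigma> = density lborel (\<lambda>x. ennreal (normal_density 0 \<sigma> x))"

text \<open>
  Student's distribution with \<open>k\<close> degrees of freedom: the law of \<open>Z / sqrt (V / k)\<close> with \<open>Z\<close> standard
  normal and \<open>V\<close> an independent chi-square variable with \<open>k\<close> degrees of freedom, that is, a sum of \<open>k\<close>
  squares of independent standard normals.
\<close>

definition student_t :: "nat \<Rightarrow> real measure" where
  "student_t k = distr (PiM {0..k} (\<lambda>_. centered_normal 1)) borel
     (\<lambda>z. z 0 / sqrt ((\<Sum>i=1..k. (z i)\<^sup>2) / real k))"

definition quantile :: "real measure \<Rightarrow> real \<Rightarrow> real" where
  "quantile D q = Inf {x. q \<le> cdf D x}"

definition empirical :: "'a measure \<Rightarrow> nat \<Rightarrow> (nat \<Rightarrow> 'w \<Rightarrow> 'a) \<Rightarrow> 'w \<Rightarrow> 'a measure" where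
  "empirical P n V \<omega> = distr (uniform_count_measure {..<n}) P (\<lambda>i. V i \<omega>)"

text \<open>
  A noisy computation is a Markov kernel \<open>N\<close>: \<open>N Q\<close> is the law of one run at the distribution \<open>Q\<close>.
  The moments are taken in \<open>ennreal\<close>, so that they are \<open>\<infinity>\<close> (and not \<open>0\<close>) when they diverge.
\<close>

definition run_var :: "('a measure \<Rightarrow> real measure) \<Rightarrow> 'a measure \<Rightarrow> ennreal" where
  "run_var N Q = (\<integral>\<^sup>+ y. ennreal ((y - (\<integral>z. z \<partial>N Q))\<^sup>2) \<partial>N Q)"

definition run_third_moment ::
  "('a measure \<Rightarrow> real) \<Rightarrow> ('a measure \<Rightarrow> real measure) \<Rightarrow> 'a measure \<Rightarrow> ennreal" where
  "run_third_moment \<psi> N Q = (\<integral>\<^sup>+ y. ennreal (\<bar>y - \<psi> Q\<bar> ^ 3) \<partial>N Q)"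

text \<open>
  \<open>X i\<close> are the data. For sample size \<open>n\<close>, \<open>Xs n b j\<close> (\<open>1 \<le> b \<le> B\<close>, \<open>j < n\<close>) are the points of the
  \<open>b\<close>-th resample. The driving distribution with index \<open>0\<close> is the empirical distribution of the data,
  the one with index \<open>b \<ge> 1\<close> that of the \<open>b\<close>-th resample; \<open>Y n k r\<close> is the \<open>r\<close>-th noisy run at the
  driving distribution with index \<open>k\<close>, of which there are \<open>R0 n\<close> for \<open>k = 0\<close> and \<open>R n\<close> for \<open>k \<ge> 1\<close>.
\<close>

definition driving ::
  "'a measure \<Rightarrow> (nat \<Rightarrow> 'w \<Rightarrow> 'a) \<Rightarrow> (nat \<Rightarrow> nat \<Rightarrow> nat \<Rightarrow> 'w \<Rightarrow> 'a) \<Rightarrow> nat \<Rightarrow> nat \<Rightarrow> 'w \<Rightarrow> 'a measure"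
where
  "driving P X Xs n k = (if k = 0 then empirical P n X else empirical P n (Xs n k))"

text \<open>
  Drawing uniformly with replacement from the data points (counted with multiplicity) is drawing
  independently from their empirical distribution.
\<close>

locale nested_sampling = prob_space M
  for M :: "'w measure" +
  fixes P :: "'a measure"
    and \<psi> :: "'a measure \<Rightarrow> real"
    and N :: "'a measure \<Rightarrow> real measure"
    and X :: "nat \<Rightarrow> 'w \<Rightarrow> 'a"
    and Xs :: "nat \<Rightarrow> nat \<Rightarrow> nat \<Rightarrow> 'w \<Rightarrow> 'a"
    and Y :: "nat \<Rightarrow> nat \<Rightarrow> nat \<Rightarrow> 'w \<Rightarrow> real"
    and B :: nat
    and R0 R :: "nat \<Rightarrow> nat"
  assumes prob_space_P: "prob_space P"
    and measurable_functional: "\<psi> \<in> borel_measurable (prob_algebra P)"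
    and noise_kernel: "N \<in> measurable (prob_algebra P) (prob_algebra borel)"
    and unbiased: "\<And>Q. Q \<in> space (prob_algebra P) \<Longrightarrow>
          integrable (N Q) (\<lambda>y. y) \<and> (\<integral>y. y \<partial>N Q) = \<psi> Q"
    and data_indep: "indep_vars (\<lambda>_. P) X UNIV"
    and data_law: "\<And>i. distr M P (X i) = P"
    and resampling: "\<And>n. n > 0 \<Longrightarrow>
          cond_indep_with_laws M
            (vimage_algebra (space M) (\<lambda>\<omega>. \<lambda>i\<in>{..<n}. X i \<omega>) (PiM {..<n} (\<lambda>_. P)))
            ({1..B} \<times> {..<n}) P
            (\<lambda>(b, j). Xs n b j)
            (\<lambda>_. empirical P n X)"
    and runs: "\<And>n. n > 0 \<Longrightarrow>
          cond_indep_with_laws M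
            (vimage_algebra (space M) (\<lambda>\<omega>. \<lambda>k\<in>{0..B}. driving P X Xs n k \<omega>)
               (PiM {0..B} (\<lambda>_. prob_algebra P)))
            (SIGMA k:{0..B}. {..<(if k = 0 then R0 n else R n)}) borel
            (\<lambda>(k, r). Y n k r)
            (\<lambda>(k, r) \<omega>. N (driving P X Xs n k \<omega>))"

definition run_mean :: "nat \<Rightarrow> (nat \<Rightarrow> 'w \<Rightarrow> real) \<Rightarrow> 'w \<Rightarrow> real" where
  "run_mean m V \<omega> = (\<Sum>r<m. V r \<omega>) / real m"

definition orig_estimate ::
  "(nat \<Rightarrow> nat) \<Rightarrow> (nat \<Rightarrow> nat \<Rightarrow> nat \<Rightarrow> 'w \<Rightarrow> real) \<Rightarrow> nat \<Rightarrow> 'w \<Rightarrow> real" where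
  "orig_estimate R0 Y n = run_mean (R0 n) (Y n 0)"

definition resample_estimate ::
  "(nat \<Rightarrow> nat) \<Rightarrow> (nat \<Rightarrow> nat \<Rightarrow> nat \<Rightarrow> 'w \<Rightarrow> real) \<Rightarrow> nat \<Rightarrow> nat \<Rightarrow> 'w \<Rightarrow> real" where
  "resample_estimate R Y n b = run_mean (R n) (Y n b)"

definition S_M :: "nat \<Rightarrow> (nat \<Rightarrow> nat) \<Rightarrow> (nat \<Rightarrow> nat \<Rightarrow> nat \<Rightarrow> 'w \<Rightarrow> real) \<Rightarrow> nat \<Rightarrow> 'w \<Rightarrow> real" where
  "S_M B R Y n \<omega> =
     (let m = (\<Sum>b=1..B. resample_estimate R Y n b \<omega>) / real B
      in sqrt ((\<Sum>b=1..B. (resample_estimate R Y n b \<omega> - m)\<^sup>2) / (real B - 1)))"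

definition q_M :: "nat \<Rightarrow> real \<Rightarrow> real \<Rightarrow> real" where
  "q_M B \<rho> q = max (inverse \<rho>) 1 * quantile (student_t (B - 1)) q"

definition I_M ::
  "nat \<Rightarrow> (nat \<Rightarrow> nat) \<Rightarrow> (nat \<Rightarrow> nat) \<Rightarrow> (nat \<Rightarrow> nat \<Rightarrow> nat \<Rightarrow> 'w \<Rightarrow> real) \<Rightarrow> real \<Rightarrow> real \<Rightarrow> nat \<Rightarrow> 'w \<Rightarrow> real set"
where
  "I_M B R0 R Y \<rho> \<alpha> n \<omega> =
     {orig_estimate R0 Y n \<omega> - q_M B \<rho> (1 - \<alpha> / 2) * S_M B R Y n \<omega> ..
      orig_estimate R0 Y n \<omega> + q_M B \<rho> (1 - \<alpha> / 2) * S_M B R Y n \<omega>}"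

end

theory Submission
  imports Defs
begin

text \<open>
  With \<open>A 0 = sqrt n (orig - \<psi> P)\<close> and \<open>A b = sqrt n (resample b - \<psi> (empirical))\<close> the event \<open>\<psi> P \<in> I_M\<close>
  says \<open>\<bar>A 0\<bar> \<le> q * s\<close>, where \<open>s\<close> is the sample standard deviation of \<open>A 1, ..., A B\<close>. The variables \<open>A 0, ..., A B\<close>
  are asymptotically independent centered normals, of variance \<open>\<sigma>\<^sup>2 + \<tau>\<^sup>2/p0\<close> for \<open>A 0\<close> and \<open>\<sigma>\<^sup>2 + \<tau>\<^sup>2/p\<close> for the
  others, so that \<open>A 0 / s\<close> is in the limit a multiple of a Student variable, the multiple being at most
  \<open>max (1/\<rho>) 1\<close>, with equality for \<open>\<rho> = 1\<close>.

  Joint convergence is proved by characteristic functions. Given the driving distributions, the runs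
  contribute a product of powers of characteristic functions of \<open>N\<close>, which converges in probability to a
  constant by a third-order Taylor bound. Given the data, the resample errors contribute a product of
  characteristic functions of the bootstrap law, which also converges in probability to a constant.
  What remains is the characteristic function of the error of \<open>\<psi> (empirical)\<close>.
\<close>

section \<open>Conditionally independent families\<close>

text \<open>The original estimate and the resample estimates come from the same data and are
  dependent. Independence arises in the limit because a sample variance ignores a common shift: the
  resample estimates may be centred at the random, noise-free value of \<psi> at the empirical
  distribution, and the bootstrap law around that centre tends in probability to one fixed normal
  law. Two levels of conditioning have to be undone, and their order matters. The driving
  distributions determine all noise-free values, so the runs are integrated out first; what remains
  is a function of data and resamples, and the resamples are integrated out given the data.
  Conditional independence is assumed only as almost sure identities, one for each rectangle, and is
  therefore first upgraded to an identity of joint laws. The bootstrap hypothesis concerns cdfs, at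
  one point at a time and in probability, conditionally on the empirical distribution, while
  resampling is specified conditionally on the data points. \<open>cond_prob_resample\<close>
  reconciles the two conditionings, and \<open>char_close_of_cdf_close\<close> passes from cdfs to
  characteristic functions.\<close>

lemma PiM_emeasure_PiE:
  assumes "finite I" "\<And>i. i \<in> I \<Longrightarrow> prob_space (K i)" "\<And>i. i \<in> I \<Longrightarrow> C i \<in> sets (K i)"
  shows "emeasure (PiM I K) (Pi\<^sub>E I C) = (\<Prod>i\<in>I. emeasure (K i) (C i))"
proof -
  have "prod_emb I K I (Pi\<^sub>E I C) = Pi\<^sub>E I C"
    using assms(3)[THEN sets.sets_into_space] by (auto simp: prod_emb_def PiE_iff)
  then show ?thesis
    using emeasure_PiM_emb[of I K I C] assms by simp
qed

text \<open>Rectangles form an intersection-stable generator, and the mass of a rectangle is a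
  finite product of measurable functions of the parameter.\<close>

lemma measurable_PiM_prob_algebra:
  assumes I: "finite I" and L: "\<And>i. i \<in> I \<Longrightarrow> L i \<in> F \<rightarrow>\<^sub>M prob_algebra (S i)"
  shows "(\<lambda>\<omega>. PiM I (\<lambda>i. L i \<omega>)) \<in> F \<rightarrow>\<^sub>M prob_algebra (PiM I S)"
proof (rule measurable_prob_algebra_generated)
  let ?G = "{Pi\<^sub>E I C | C. \<forall>i\<in>I. C i \<in> sets (S i)}"
  have eq: "?G = prod_algebra I S"
    using prod_algebra_eq_finite[OF I, of S] by (auto simp: Pi_iff)
  show "sets (PiM I S) = sigma_sets (\<Pi>\<^sub>E i\<in>I. space (S i)) ?G"
    unfolding eq by (rule sets_PiM)
  show "Int_stable ?G" "?G \<subseteq> Pow (\<Pi>\<^sub>E i\<in>I. space (S i))"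
    unfolding eq by (rule Int_stable_prod_algebra, rule prod_algebra_sets_into_space)
next
  have L': "prob_space (L i a)" "sets (L i a) = sets (S i)" if "a \<in> space F" "i \<in> I" for a i
    using measurable_space[OF L[OF that(2)] that(1)] by (auto simp: space_prob_algebra)
  show "prob_space (PiM I (\<lambda>i. L i a))" if "a \<in> space F" for a
    using L'[OF that] by (intro prob_space_PiM)
  show "sets (PiM I (\<lambda>i. L i a)) = sets (PiM I S)" if "a \<in> space F" for a
    using L'[OF that] by (intro sets_PiM_cong) auto
  fix A assume "A \<in> {Pi\<^sub>E I C | C. \<forall>i\<in>I. C i \<in> sets (S i)}"
  then obtain C where A: "A = Pi\<^sub>E I C" and C: "\<And>i. i \<in> I \<Longrightarrow> C i \<in> sets (S i)" by auto
  have "(\<lambda>a. \<Prod>i\<in>I. emeasure (L i a) (C i)) \<in> borel_measurable F"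
    using C L[THEN measurable_prob_algebraD]
    by (intro borel_measurable_prod_ennreal measurable_compose[OF _ measurable_emeasure_subprob_algebra])
  then show "(\<lambda>a. emeasure (PiM I (\<lambda>i. L i a)) A) \<in> borel_measurable F"
    using I C L' unfolding A
    by (subst measurable_cong[where g="\<lambda>a. \<Prod>i\<in>I. emeasure (L i a) (C i)"])
       (auto intro!: PiM_emeasure_PiE)
qed

lemma (in prob_space) bounded_complex_integral:
  fixes f :: "'a \<Rightarrow> complex"
  assumes f: "f \<in> borel_measurable M" and C: "\<And>x. x \<in> space M \<Longrightarrow> norm (f x) \<le> C"
  shows "integrable M f" "norm (integral\<^sup>L M f) \<le> C"
proof -
  show i: "integrable M f"
    using f C by (intro integrable_const_bound[where B=C]) auto
  have "norm (integral\<^sup>L M f) \<le> (\<integral>y. norm (f y) \<partial>M)"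
    by (rule integral_norm_bound)
  also have "\<dots> \<le> (\<integral>y. C \<partial>M)"
    using C i by (intro integral_mono) auto
  finally show "norm (integral\<^sup>L M f) \<le> C" by (simp add: prob_space)
qed

text \<open>Real and imaginary parts are integrated over the mixture separately. The bound
  \<open>C\<close> supplies the integrability needed to put them together again.\<close>

lemma complex_integral_bind:
  fixes f :: "'b \<Rightarrow> complex"
  assumes M: "prob_space M" and K: "K \<in> M \<rightarrow>\<^sub>M prob_algebra S"
    and f [measurable]: "f \<in> borel_measurable S" and C: "\<And>x. x \<in> space S \<Longrightarrow> norm (f x) \<le> C"
  shows "integral\<^sup>L (bind M K) f = (\<integral>x. integral\<^sup>L (K x) f \<partial>M)"
proof -
  interpret M: prob_space M by fact
  note K' = measurable_prob_algebraD[OF K]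
  have Kp: "prob_space (K x)" "sets (K x) = sets S" "space (K x) = space S" if "x \<in> space M" for x
    using measurable_space[OF K that] by (auto simp: space_prob_algebra dest: sets_eq_imp_space_eq)
  have b: "AE x in M. emeasure (K x) (space (K x)) \<le> ennreal 1"
    using Kp(1)[THEN prob_space.emeasure_space_1] by auto
  have ReC: "\<bar>Re (f x)\<bar> \<le> C" "\<bar>Im (f x)\<bar> \<le> C" if "x \<in> space S" for x
    using C[OF that] abs_Re_le_cmod[of "f x"] abs_Im_le_cmod[of "f x"] by auto
  have fm: "f \<in> borel_measurable (K x)" "\<And>y. y \<in> space (K x) \<Longrightarrow> norm (f y) \<le> C" if "x \<in> space M" for x
    using C Kp[OF that] by (auto simp: measurable_cong_sets[OF Kp(2)[OF that]])
  note K_int = prob_space.bounded_complex_integral[OF Kp(1) fm]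
  have R: "integral\<^sup>L (bind M K) (\<lambda>x. Re (f x)) = (\<integral>x. integral\<^sup>L (K x) (\<lambda>x. Re (f x)) \<partial>M)"
    by (rule integral_bind[OF _ _ K' M.finite_measure_axioms b]) (use ReC in auto)
  have I: "integral\<^sup>L (bind M K) (\<lambda>x. Im (f x)) = (\<integral>x. integral\<^sup>L (K x) (\<lambda>x. Im (f x)) \<partial>M)"
    by (rule integral_bind[OF _ _ K' M.finite_measure_axioms b]) (use ReC in auto)
  have ib: "integrable (bind M K) f"
  proof -
    interpret B: prob_space "bind M K"
      by (rule prob_space_bind'[OF _ K]) (use M in \<open>auto simp: space_prob_algebra\<close>)
    have sB: "sets (bind M K) = sets S"
      by (rule sets_bind'[OF _ K]) (use M in \<open>auto simp: space_prob_algebra\<close>)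
    show ?thesis using C sets_eq_imp_space_eq[OF sB] 
      by (intro B.integrable_const_bound[where B=C]) (auto simp: measurable_cong_sets[OF sB])
  qed
  have iM: "integrable M (\<lambda>x. integral\<^sup>L (K x) f)"
    by (rule M.bounded_complex_integral(1)[OF _ K_int(2)])
       (rule measurable_compose[OF K' integral_measurable_subprob_algebra[OF f]])
  show ?thesis
    using R I ib iM K_int(1) by (intro complex_eqI) (simp_all cong: Bochner_Integration.integral_cong)
qed

text \<open>Disintegration: given \<open>F\<close>, the family may be integrated out against the
  product of its random laws, while everything measurable with respect to \<open>F\<close> is kept
  fixed. The definition provides this only for indicators of rectangles, each with its own
  exceptional null set.\<close>

lemma cond_indep_with_laws_integral:
  fixes f :: "'w \<times> ('i \<Rightarrow> 'b) \<Rightarrow> complex"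
  assumes M: "prob_space M" and F: "subalgebra M F" and I: "finite I"
    and V: "cond_indep_with_laws M F I S V L"
    and L: "\<And>i. i \<in> I \<Longrightarrow> L i \<in> F \<rightarrow>\<^sub>M prob_algebra S"
    and f: "f \<in> borel_measurable (F \<Otimes>\<^sub>M PiM I (\<lambda>_. S))"
    and C: "\<And>x. norm (f x) \<le> C"
  shows "(\<integral>\<omega>. f (\<omega>, \<lambda>i\<in>I. V i \<omega>) \<partial>M) = (\<integral>\<omega>. (\<integral>v. f (\<omega>, v) \<partial>PiM I (\<lambda>i. L i \<omega>)) \<partial>M)"
proof -
  interpret M: prob_space M by fact
  interpret finite_measure_subalgebra M F by unfold_locales fact
  have spF: "space F = space M" and sF: "sets F \<subseteq> sets M" using F by (auto simp: subalgebra_def)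
  let ?P = "PiM I (\<lambda>_. S)"
  let ?K = "\<lambda>\<omega>. PiM I (\<lambda>i. L i \<omega>)"
  let ?T = "F \<Otimes>\<^sub>M ?P"
  have V': "V i \<in> M \<rightarrow>\<^sub>M S" if "i \<in> I" for i using V that by (auto simp: cond_indep_with_laws_def)
  have K: "?K \<in> F \<rightarrow>\<^sub>M prob_algebra ?P" by (rule measurable_PiM_prob_algebra[OF I L])
  have Kp: "prob_space (?K x)" "sets (?K x) = sets ?P" "space (?K x) = space ?P" if "x \<in> space M" for x
    using measurable_space[OF K] that spF by (auto simp: space_prob_algebra dest: sets_eq_imp_space_eq)
  have Vm: "(\<lambda>\<omega>. \<lambda>i\<in>I. V i \<omega>) \<in> M \<rightarrow>\<^sub>M ?P"
    using V' by (intro measurable_restrict) auto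
  have idm: "(\<lambda>\<omega>. \<omega>) \<in> M \<rightarrow>\<^sub>M F"
    by (rule measurable_from_subalg[OF F]) simp
  have pm: "(\<lambda>\<omega>. (\<omega>, \<lambda>i\<in>I. V i \<omega>)) \<in> M \<rightarrow>\<^sub>M ?T"
    using idm Vm by (rule measurable_Pair)
  let ?K2 = "\<lambda>\<omega>. distr (?K \<omega>) ?T (\<lambda>v. (\<omega>, v))"
  have K2F: "?K2 \<in> F \<rightarrow>\<^sub>M prob_algebra ?T"
    by (rule measurable_distr_prob_space2[OF K]) simp
  have K2: "?K2 \<in> M \<rightarrow>\<^sub>M prob_algebra ?T"
    by (rule measurable_from_subalg[OF F K2F])
  have Mp: "M \<in> space (prob_algebra M)" using M by (simp add: space_prob_algebra)
  \<comment> \<open>The point \<omega> itself, seen through \<open>F\<close>, is kept as first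
    coordinate, so that the equality of laws also covers integrands that depend on the condition.
    Both sides are compared on products of an \<open>F\<close>-set with a rectangle.\<close>
  have "distr M ?T (\<lambda>\<omega>. (\<omega>, \<lambda>i\<in>I. V i \<omega>)) = bind M ?K2" (is "?A = ?B")
  proof (rule measure_eqI_generator_eq)
    let ?G = "{H \<times> D | H D. H \<in> sets F \<and> D \<in> prod_algebra I (\<lambda>_. S)}"
    show "Int_stable ?G"
      using Int_stable_prod_algebra[of I "\<lambda>_. S"] unfolding Int_stable_def
      by safe (metis Times_Int_Times sets.Int)
    show "?G \<subseteq> Pow (space F \<times> space ?P)"
      using prod_algebra_sets_into_space[of I "\<lambda>_. S"] sets.sets_into_space[of _ F]
      by (fastforce simp: space_PiM)
    have spP: "space ?P \<in> prod_algebra I (\<lambda>_. S)"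
      using prod_algebraI_finite[OF I, of "\<lambda>_. space S" "\<lambda>_. S"] by (simp add: space_PiM)
    have "sets ?T = sets (sigma (space F \<times> space ?P) ?G)"
    proof (rule sets_pair_eq[where Ca="{space F}" and Cb="{space ?P}"])
      show "sets F \<subseteq> Pow (space F)" by (rule sets.space_closed)
      show "sets F = sigma_sets (space F) (sets F)" by (simp add: sets.sigma_sets_eq)
      show "prod_algebra I (\<lambda>_. S) \<subseteq> Pow (space ?P)"
        using prod_algebra_sets_into_space[of I "\<lambda>_. S"] by (simp add: space_PiM)
      show "sets ?P = sigma_sets (space ?P) (prod_algebra I (\<lambda>_. S))"
        by (simp add: sets_PiM space_PiM)
    qed (use spP in auto)
    moreover have "?G \<subseteq> Pow (space F \<times> space ?P)" by fact
    ultimately show "sets ?A = sigma_sets (space F \<times> space ?P) ?G"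
      by simp
    moreover have "sets ?B = sets ?T"
      by (rule sets_bind'[OF Mp K2])
    ultimately show "sets ?B = sigma_sets (space F \<times> space ?P) ?G" by simp
    show "range (\<lambda>_::nat. space F \<times> space ?P) \<subseteq> ?G"
      using spP by auto
    show "(\<Union>i::nat. space F \<times> space ?P) = space F \<times> space ?P" by simp
    have "prob_space ?A" by (rule M.prob_space_distr[OF pm])
    then show "emeasure ?A (space F \<times> space ?P) \<noteq> \<infinity>" for i :: nat
      using finite_measure.emeasure_finite[OF prob_space.finite_measure[of ?A]] by simp
    fix X assume "X \<in> ?G"
    then obtain H D where X: "X = H \<times> D" and H: "H \<in> sets F" and "D \<in> prod_algebra I (\<lambda>_. S)" by auto
    then obtain E where D: "D = Pi\<^sub>E I E" and "E \<in> I \<rightarrow> sets S"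
      using prod_algebra_eq_finite[OF I, of "\<lambda>_. S"] by auto
    then have E: "\<And>i. i \<in> I \<Longrightarrow> E i \<in> sets S" by auto
    have DP: "D \<in> sets ?P" unfolding D using I E by (intro sets_PiM_I_finite) auto
    have HM: "H \<in> sets M" using H sF by auto
    have XT: "X \<in> sets ?T" using X H DP by auto
    let ?E = "{\<omega> \<in> space M. \<forall>i\<in>I. V i \<omega> \<in> E i}"
    have EM: "?E \<in> sets M"
      using I V' E by measurable
    have ae: "AE \<omega> in M. real_cond_exp M F (indicator ?E) \<omega> = (\<Prod>i\<in>I. measure (L i \<omega>) (E i))"
      using V E by (auto simp: cond_indep_with_laws_def cond_prob_given_def)
    have "emeasure ?A X = emeasure M (H \<inter> ?E)"
      using sets.sets_into_space[OF HM]
      by (subst emeasure_distr[OF pm XT], intro arg_cong2[where f=emeasure]) (auto simp: PiE_iff X D)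
    also have "\<dots> = ennreal (\<integral>\<omega>. indicator H \<omega> * indicator ?E \<omega> \<partial>M)"
      using HM EM by (simp add: M.emeasure_eq_measure flip: indicator_inter_arith)
    \<comment> \<open>Since \<open>H\<close> lies in \<open>F\<close>, the indicator of the event
      for the family may be replaced by its conditional expectation under the integral, and this is
      the assumed product.\<close>
    also have "(\<integral>\<omega>. indicator H \<omega> * indicator ?E \<omega> \<partial>M) =
        (\<integral>\<omega>. indicator H \<omega> * real_cond_exp M F (indicator ?E) \<omega> \<partial>M)"
      using H HM EM by (intro real_cond_exp_intg(2)[symmetric] M.integrable_const_bound[where B=1]) (auto simp: indicator_def)
    also have "\<dots> = (\<integral>\<omega>. indicator H \<omega> * (\<Prod>i\<in>I. measure (L i \<omega>) (E i)) \<partial>M)"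
    proof (rule integral_cong_AE)
      have "(\<lambda>\<omega>. measure (L i \<omega>) (E i)) \<in> borel_measurable M" if "i \<in> I" for i
        by (rule measurable_compose[OF measurable_from_subalg[OF F L[OF that]] measurable_measure_prob_algebra[OF E[OF that]]])
      then show "(\<lambda>\<omega>. indicator H \<omega> * (\<Prod>i\<in>I. measure (L i \<omega>) (E i))) \<in> borel_measurable M"
        using HM by measurable
    qed (use ae HM in auto)
    also have "ennreal \<dots> = (\<integral>\<^sup>+\<omega>. ennreal (indicator H \<omega> * (\<Prod>i\<in>I. measure (L i \<omega>) (E i))) \<partial>M)"
    proof (rule nn_integral_eq_integral[symmetric])
      have m: "(\<lambda>\<omega>. measure (L i \<omega>) (E i)) \<in> borel_measurable M" if "i \<in> I" for i
        by (rule measurable_compose[OF measurable_from_subalg[OF F L[OF that]] measurable_measure_prob_algebra[OF E[OF that]]])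
      have le: "(\<Prod>i\<in>I. measure (L i \<omega>) (E i)) \<le> 1" if "\<omega> \<in> space M" for \<omega>
        using measurable_space[OF L] that spF
        by (intro prod_le_1) (auto simp: space_prob_algebra intro!: prob_space.prob_le_1)
      show "integrable M (\<lambda>\<omega>. indicator H \<omega> * (\<Prod>i\<in>I. measure (L i \<omega>) (E i)))"
        using m HM le
        by (intro M.integrable_const_bound[where B=1])
           (auto simp: indicator_def abs_prod)
    qed (auto intro!: AE_I2 prod_nonneg mult_nonneg_nonneg)
    also have "\<dots> = (\<integral>\<^sup>+\<omega>. emeasure (?K2 \<omega>) X \<partial>M)"
    proof (rule nn_integral_cong)
      fix \<omega> assume w: "\<omega> \<in> space M"
      have Lp: "prob_space (L i \<omega>)" "sets (L i \<omega>) = sets S" if "i \<in> I" for i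
        using measurable_space[OF L[OF that]] w spF by (auto simp: space_prob_algebra)
      have pw: "(\<lambda>v. (\<omega>, v)) \<in> ?K \<omega> \<rightarrow>\<^sub>M ?T"
        using w spF by (subst measurable_cong_sets[OF Kp(2)[OF w] refl]) simp
      have "emeasure (?K2 \<omega>) X = emeasure (?K \<omega>) ((\<lambda>v. (\<omega>, v)) -` X \<inter> space (?K \<omega>))"
        by (rule emeasure_distr[OF pw XT])
      also have "(\<lambda>v. (\<omega>, v)) -` X \<inter> space (?K \<omega>) = (if \<omega> \<in> H then D else {})"
        using sets.sets_into_space[OF DP] Kp(3)[OF w] by (auto simp: X)
      also have "emeasure (?K \<omega>) (if \<omega> \<in> H then D else {}) = indicator H \<omega> * emeasure (?K \<omega>) D"
        by (auto simp: indicator_def)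
      also have "emeasure (?K \<omega>) D = (\<Prod>i\<in>I. emeasure (L i \<omega>) (E i))"
        unfolding D using I Lp E by (intro PiM_emeasure_PiE) auto
      also have "\<dots> = ennreal (\<Prod>i\<in>I. measure (L i \<omega>) (E i))"
        using Lp(1)[THEN prob_space.finite_measure, THEN finite_measure.emeasure_eq_measure]
        by (subst prod_ennreal[symmetric]) (auto intro!: prod.cong)
      finally show "ennreal (indicator H \<omega> * (\<Prod>i\<in>I. measure (L i \<omega>) (E i))) = emeasure (?K2 \<omega>) X"
        by (auto simp: indicator_def)
    qed
    also have "\<dots> = emeasure ?B X"
      by (rule emeasure_bind_prob_algebra[OF Mp K2 XT, symmetric])
    finally show "emeasure ?A X = emeasure ?B X" .
  qed
  then have "integral\<^sup>L ?A f = integral\<^sup>L ?B f" by simp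
  moreover have "integral\<^sup>L ?A f = (\<integral>\<omega>. f (\<omega>, \<lambda>i\<in>I. V i \<omega>) \<partial>M)"
    by (rule integral_distr[OF pm f])
  moreover have "integral\<^sup>L ?B f = (\<integral>\<omega>. integral\<^sup>L (?K2 \<omega>) f \<partial>M)"
    by (rule complex_integral_bind[OF M K2 f C])
  moreover have "\<dots> = (\<integral>\<omega>. (\<integral>v. f (\<omega>, v) \<partial>?K \<omega>) \<partial>M)"
  proof (rule Bochner_Integration.integral_cong[OF refl])
    fix \<omega> assume w: "\<omega> \<in> space M"
    have pw: "(\<lambda>v. (\<omega>, v)) \<in> ?K \<omega> \<rightarrow>\<^sub>M ?T"
      using w spF by (subst measurable_cong_sets[OF Kp(2)[OF w] refl]) simp
    show "integral\<^sup>L (?K2 \<omega>) f = (\<integral>v. f (\<omega>, v) \<partial>?K \<omega>)"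
      by (rule integral_distr[OF pw f])
  qed
  ultimately show ?thesis by simp
qed

section \<open>Levy's continuity theorem for vectors with independent limits\<close>

text \<open>
  To replace in a joint characteristic function one exponential after the other by the indicator of an
  interval, the remaining factors are regarded as a weight. The weight has to be positive, so that
  normalising it yields a probability measure to which the one-dimensional theorem applies; a complex
  weight \<open>g\<close> is therefore split into the weights \<open>2 + Re g\<close>, \<open>2 + Re (- \<i> * g)\<close> and \<open>2\<close>.
\<close>

lemma weighted_levy_continuity:
  fixes A :: "nat \<Rightarrow> 'w \<Rightarrow> real"
  assumes M: "prob_space M" and A [measurable]: "\<And>n. A n \<in> borel_measurable M"
    and w [measurable]: "\<And>n. w n \<in> borel_measurable M" and w1: "\<And>n \<omega>. 1 \<le> w n \<omega>" and wC: "\<And>n \<omega>. w n \<omega> \<le> C"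
    and \<nu>: "real_distribution \<nu>" and atoms: "\<And>x. measure \<nu> {x} = 0"
    and lim: "\<And>s. (\<lambda>n. \<integral>\<omega>. complex_of_real (w n \<omega>) * iexp (s * A n \<omega>) \<partial>M) \<longlonglongrightarrow> complex_of_real c * char \<nu> s"
    and ab: "a < b"
  shows "(\<lambda>n. \<integral>\<omega>. w n \<omega> * indicator {a<..b} (A n \<omega>) \<partial>M) \<longlonglongrightarrow> c * measure \<nu> {a<..b}"
proof -
  interpret M: prob_space M by fact
  interpret \<nu>: real_distribution \<nu> by fact
  define c' where "c' n = (\<integral>\<omega>. w n \<omega> \<partial>M)" for n
  have w0: "0 \<le> w n \<omega>" for n \<omega> using w1[of n \<omega>] by linarith
  have iw: "integrable M (w n)" for n
    using w0 wC by (intro M.integrable_const_bound[where B=C]) auto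
  have c1: "1 \<le> c' n" for n
  proof -
    have "(\<integral>\<omega>. 1 \<partial>M) \<le> c' n" unfolding c'_def by (intro integral_mono iw w1) simp
    then show ?thesis by (simp add: M.prob_space)
  qed
  \<comment> \<open>At \<open>s = 0\<close> the hypothesis says that the total masses
    \<open>c' n\<close> tend to \<open>c\<close>. They are at least 1, hence so is \<open>c\<close>,
    and normalising by them is harmless in the limit.\<close>
  have "(\<lambda>n. complex_of_real (c' n)) \<longlonglongrightarrow> complex_of_real c"
    using lim[of 0] by (simp add: c'_def \<nu>.char_zero)
  then have c'c: "c' \<longlonglongrightarrow> c" by (simp add: tendsto_of_real_iff)
  have cpos: "c \<ge> 1"
    by (rule LIMSEQ_le_const[OF c'c]) (use c1 in auto)
  define \<mu> where "\<mu> n = distr (density M (\<lambda>\<omega>. ennreal (w n \<omega> / c' n))) borel (A n)" for n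
  have dens: "prob_space (density M (\<lambda>\<omega>. ennreal (w n \<omega> / c' n)))" for n
  proof
    have "(\<integral>\<^sup>+\<omega>. ennreal (w n \<omega> / c' n) \<partial>M) = ennreal (\<integral>\<omega>. w n \<omega> / c' n \<partial>M)"
      using iw w0 c1[of n] by (intro nn_integral_eq_integral) auto
    also have "(\<integral>\<omega>. w n \<omega> / c' n \<partial>M) = 1"
      using c1[of n] by (simp add: c'_def[symmetric])
    finally show "emeasure (density M (\<lambda>\<omega>. ennreal (w n \<omega> / c' n))) (space (density M (\<lambda>\<omega>. ennreal (w n \<omega> / c' n)))) = 1"
      by (simp add: emeasure_density cong: nn_integral_cong)
  qed
  have \<mu>: "real_distribution (\<mu> n)" for n
    unfolding \<mu>_def by (rule prob_space.real_distribution_distr[OF dens]) simp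
  have ch: "char (\<mu> n) s = (\<integral>\<omega>. complex_of_real (w n \<omega>) * iexp (s * A n \<omega>) \<partial>M) / c' n" for n s
  proof -
    have "char (\<mu> n) s = (\<integral>\<omega>. (w n \<omega> / c' n) *\<^sub>R iexp (s * A n \<omega>) \<partial>M)"
      unfolding char_def \<mu>_def using w0 c1[of n]
      by (subst integral_distr) (auto intro!: integral_density)
    also have "\<dots> = (\<integral>\<omega>. complex_of_real (w n \<omega>) * iexp (s * A n \<omega>) / complex_of_real (c' n) \<partial>M)"
      by (simp add: scaleR_conv_of_real)
    finally show ?thesis by simp
  qed
  have "weak_conv_m \<mu> \<nu>"
  proof (rule levy_continuity[OF \<mu> \<nu>])
    fix s
    have "(\<lambda>n. (\<integral>\<omega>. complex_of_real (w n \<omega>) * iexp (s * A n \<omega>) \<partial>M) / c' n) \<longlonglongrightarrow> (complex_of_real c * char \<nu> s) / complex_of_real c"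
      using cpos by (intro tendsto_divide lim tendsto_of_real c'c) auto
    then show "(\<lambda>n. char (\<mu> n) s) \<longlonglongrightarrow> char \<nu> s"
      using cpos by (simp add: ch)
  qed
  \<comment> \<open>Without atoms every point is a continuity point of the limiting cdf.\<close>
  then have "(\<lambda>n. cdf (\<mu> n) x) \<longlonglongrightarrow> cdf \<nu> x" for x
    using atoms by (simp add: weak_conv_m_def weak_conv_def \<nu>.isCont_cdf)
  from tendsto_diff[OF this[of b] this[of a]]
  have *: "(\<lambda>n. measure (\<mu> n) {a<..b}) \<longlonglongrightarrow> measure \<nu> {a<..b}"
    using ab \<mu> by (simp add: \<nu>.cdf_diff_eq finite_borel_measure.cdf_diff_eq real_distribution.finite_borel_measure_M)
  have m: "measure (\<mu> n) {a<..b} = (\<integral>\<omega>. w n \<omega> * indicator {a<..b} (A n \<omega>) \<partial>M) / c' n" for n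
  proof -
    have "measure (\<mu> n) {a<..b} = (\<integral>x. indicator {a<..b} x \<partial>\<mu> n)"
      by (simp add: \<mu>_def)
    also have "\<dots> = (\<integral>\<omega>. (w n \<omega> / c' n) *\<^sub>R indicator {a<..b} (A n \<omega>) \<partial>M)"
      unfolding \<mu>_def using w0 c1[of n]
      by (subst integral_distr, simp, simp, subst integral_density) auto
    also have "\<dots> = (\<integral>\<omega>. w n \<omega> * indicator {a<..b} (A n \<omega>) / c' n \<partial>M)"
      by simp
    finally show ?thesis by simp
  qed
  have "(\<lambda>n. c' n * measure (\<mu> n) {a<..b}) \<longlonglongrightarrow> c * measure \<nu> {a<..b}"
    by (intro tendsto_mult c'c *)
  moreover have "c' n * measure (\<mu> n) {a<..b} = (\<integral>\<omega>. w n \<omega> * indicator {a<..b} (A n \<omega>) \<partial>M)" for n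
    using c1[of n] by (simp add: m)
  ultimately show ?thesis by simp
qed

lemma cnj_char: "cnj (char \<nu> (- s)) = char \<nu> s"
  proof -
  have "char \<nu> s = (\<integral>x. cnj (iexp (- s * x)) \<partial>\<nu>)"
    by (simp add: char_def exp_cnj)
  then show ?thesis by (simp only: Bochner_Integration.integral_cnj char_def)
qed

lemma complex_weighted_levy_continuity:
  fixes A :: "nat \<Rightarrow> 'w \<Rightarrow> real" and g :: "nat \<Rightarrow> 'w \<Rightarrow> complex"
  assumes M: "prob_space M" and A [measurable]: "\<And>n. A n \<in> borel_measurable M"
    and g [measurable]: "\<And>n. g n \<in> borel_measurable M" and g1: "\<And>n \<omega>. norm (g n \<omega>) \<le> 1"
    and \<nu>: "real_distribution \<nu>" and atoms: "\<And>x. measure \<nu> {x} = 0"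
    and lim1: "\<And>s. (\<lambda>n. \<integral>\<omega>. iexp (s * A n \<omega>) \<partial>M) \<longlonglongrightarrow> char \<nu> s"
    and lim: "\<And>s. (\<lambda>n. \<integral>\<omega>. g n \<omega> * iexp (s * A n \<omega>) \<partial>M) \<longlonglongrightarrow> G * char \<nu> s"
    and ab: "a < b"
  shows "(\<lambda>n. \<integral>\<omega>. g n \<omega> * complex_of_real (indicator {a<..b} (A n \<omega>)) \<partial>M) \<longlonglongrightarrow> G * complex_of_real (measure \<nu> {a<..b})"
proof -
  interpret M: prob_space M by fact
  have *: "(\<lambda>n. \<integral>\<omega>. Re (g n \<omega>) * indicator {a<..b} (A n \<omega>) \<partial>M) \<longlonglongrightarrow> Re G * measure \<nu> {a<..b}"
    if g [measurable]: "\<And>n. g n \<in> borel_measurable M" and g1: "\<And>n \<omega>. norm (g n \<omega>) \<le> 1"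
      and lim: "\<And>s. (\<lambda>n. \<integral>\<omega>. g n \<omega> * iexp (s * A n \<omega>) \<partial>M) \<longlonglongrightarrow> G * char \<nu> s" for G and g :: "nat \<Rightarrow> 'w \<Rightarrow> complex"
  proof -
    have R: "\<bar>Re (g n \<omega>)\<bar> \<le> 1" for n \<omega> using g1[of n \<omega>] abs_Re_le_cmod[of "g n \<omega>"] by linarith
    have i1: "integrable M (\<lambda>\<omega>. iexp (s * A n \<omega>))" for n s
      by (intro M.integrable_const_bound[where B=1]) auto
    have ig: "integrable M (\<lambda>\<omega>. g n \<omega> * iexp (s * A n \<omega>))" for n s
      using g1 by (intro M.integrable_const_bound[where B=1]) (auto simp: norm_mult)
    have l2: "(\<lambda>n. \<integral>\<omega>. complex_of_real (2 + Re (g n \<omega>)) * iexp (s * A n \<omega>) \<partial>M) \<longlonglongrightarrow> complex_of_real (2 + Re G) * char \<nu> s" for s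
    proof -
      have e: "(\<integral>\<omega>. complex_of_real (2 + Re (g n \<omega>)) * iexp (s * A n \<omega>) \<partial>M) =
         2 * (\<integral>\<omega>. iexp (s * A n \<omega>) \<partial>M) + ((\<integral>\<omega>. g n \<omega> * iexp (s * A n \<omega>) \<partial>M) + cnj (\<integral>\<omega>. g n \<omega> * iexp ((-s) * A n \<omega>) \<partial>M)) / 2" for n
      proof -
        \<comment> \<open>Twice \<open>Re z * iexp x\<close> is \<open>z * iexp x\<close> plus the
          conjugate of \<open>z * iexp (- x)\<close>. The hypothesis on \<open>g\<close> at
          \<open>s\<close> and at \<open>- s\<close> therefore controls the integrals with weight
          \<open>2 + Re g\<close>.\<close>
        have E: "complex_of_real (2 + Re z) * iexp x = 2 * iexp x + (z * iexp x + cnj (z * iexp (- x))) / 2" for z x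
        proof -
          have "complex_of_real (Re z) = (z + cnj z) / 2" by (simp add: complex_eq_iff)
          then have "complex_of_real (2 + Re z) = 2 + (z + cnj z) / 2" by simp
          moreover have "cnj (z * iexp (- x)) = cnj z * iexp x" by (simp add: exp_cnj)
          ultimately show ?thesis by (simp only: distrib_right add_divide_distrib times_divide_eq_left)
        qed
        have "(\<integral>\<omega>. complex_of_real (2 + Re (g n \<omega>)) * iexp (s * A n \<omega>) \<partial>M) =
           (\<integral>\<omega>. 2 * iexp (s * A n \<omega>) + (g n \<omega> * iexp (s * A n \<omega>) + cnj (g n \<omega> * iexp ((-s) * A n \<omega>))) / 2 \<partial>M)"
          by (simp only: E mult_minus_left)
        also have "\<dots> = 2 * (\<integral>\<omega>. iexp (s * A n \<omega>) \<partial>M) + ((\<integral>\<omega>. g n \<omega> * iexp (s * A n \<omega>) \<partial>M) + (\<integral>\<omega>. cnj (g n \<omega> * iexp ((-s) * A n \<omega>)) \<partial>M)) / 2"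
          using i1[of s n] ig[of n s] integrable_cnj[of M "\<lambda>\<omega>. g n \<omega> * iexp ((-s) * A n \<omega>)"] ig[of n "-s"]
          by (subst Bochner_Integration.integral_add) (auto simp del: complex_cnj_mult)
        also have "(\<integral>\<omega>. cnj (g n \<omega> * iexp ((-s) * A n \<omega>)) \<partial>M) = cnj (\<integral>\<omega>. g n \<omega> * iexp ((-s) * A n \<omega>) \<partial>M)"
          by (rule Bochner_Integration.integral_cnj)
        finally show ?thesis .
      qed
      have "(\<lambda>n. 2 * (\<integral>\<omega>. iexp (s * A n \<omega>) \<partial>M) + ((\<integral>\<omega>. g n \<omega> * iexp (s * A n \<omega>) \<partial>M) + cnj (\<integral>\<omega>. g n \<omega> * iexp ((-s) * A n \<omega>) \<partial>M)) / 2)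
        \<longlonglongrightarrow> 2 * char \<nu> s + (G * char \<nu> s + cnj (G * char \<nu> (-s))) / 2"
        by (intro tendsto_intros lim lim1) auto
      moreover have "2 * char \<nu> s + (G * char \<nu> s + cnj (G * char \<nu> (-s))) / 2 = complex_of_real (2 + Re G) * char \<nu> s"
      proof -
        have "complex_of_real (Re G) = (G + cnj G) / 2" by (simp add: complex_eq_iff)
        then show ?thesis by (simp add: cnj_char field_simps)
      qed
      ultimately show ?thesis unfolding e by simp
    qed
    have A2: "(\<lambda>n. \<integral>\<omega>. (2 + Re (g n \<omega>)) * indicator {a<..b} (A n \<omega>) \<partial>M) \<longlonglongrightarrow> (2 + Re G) * measure \<nu> {a<..b}"
    proof (rule weighted_levy_continuity[OF M A _ _ _ \<nu> atoms l2 ab])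
      show "1 \<le> 2 + Re (g n \<omega>)" "2 + Re (g n \<omega>) \<le> 3" for n \<omega> using R[of n \<omega>] by auto
    qed simp
    have A1: "(\<lambda>n. \<integral>\<omega>. 2 * indicator {a<..b} (A n \<omega>) \<partial>M) \<longlonglongrightarrow> 2 * measure \<nu> {a<..b}"
    proof (rule weighted_levy_continuity[OF M A _ _ _ \<nu> atoms _ ab])
      show "(\<lambda>n. \<integral>\<omega>. complex_of_real 2 * iexp (s * A n \<omega>) \<partial>M) \<longlonglongrightarrow> complex_of_real 2 * char \<nu> s" for s
        using tendsto_mult[OF tendsto_const[of 2] lim1[of s]] by simp
    qed auto
    have e: "(\<integral>\<omega>. (2 + Re (g n \<omega>)) * indicator {a<..b} (A n \<omega>) \<partial>M) - (\<integral>\<omega>. 2 * indicator {a<..b} (A n \<omega>) \<partial>M) =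
       (\<integral>\<omega>. Re (g n \<omega>) * indicator {a<..b} (A n \<omega>) \<partial>M)" for n
    proof -
      have "integrable M (\<lambda>\<omega>. (2 + Re (g n \<omega>)) * indicator {a<..b} (A n \<omega>))"
      proof (rule M.integrable_const_bound[where B=3])
        have "norm ((2 + Re (g n \<omega>)) * indicator {a<..b} (A n \<omega>)) \<le> 3" for \<omega>
          using R[of n \<omega>] by (auto simp: indicator_def)
        then show "AE \<omega> in M. norm ((2 + Re (g n \<omega>)) * indicator {a<..b} (A n \<omega>)) \<le> 3" by simp
      qed simp
      moreover have "integrable M (\<lambda>\<omega>. 2 * indicator {a<..b} (A n \<omega>) :: real)"
        by (intro M.integrable_const_bound[where B=2]) (auto simp: indicator_def)
      ultimately show ?thesis
        by (subst Bochner_Integration.integral_diff[symmetric]) (auto simp: algebra_simps)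
    qed
    show ?thesis
      using tendsto_diff[OF A2 A1] unfolding e by (simp add: algebra_simps)
  qed
  have re: "(\<lambda>n. \<integral>\<omega>. Re (g n \<omega>) * indicator {a<..b} (A n \<omega>) \<partial>M) \<longlonglongrightarrow> Re G * measure \<nu> {a<..b}"
    by (rule *[OF g g1 lim])
  have "(\<lambda>n. \<integral>\<omega>. Re (- \<i> * g n \<omega>) * indicator {a<..b} (A n \<omega>) \<partial>M) \<longlonglongrightarrow> Re (- \<i> * G) * measure \<nu> {a<..b}"
  proof (rule *)
    show "norm (- \<i> * g n \<omega>) \<le> 1" for n \<omega> using g1 by (simp add: norm_mult)
    show "(\<lambda>n. \<integral>\<omega>. (- \<i> * g n \<omega>) * iexp (s * A n \<omega>) \<partial>M) \<longlonglongrightarrow> (- \<i> * G) * char \<nu> s" for s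
      using tendsto_mult[OF tendsto_const[of "- \<i>"] lim[of s]] by (simp add: mult.assoc)
  qed simp
  then have im: "(\<lambda>n. \<integral>\<omega>. Im (g n \<omega>) * indicator {a<..b} (A n \<omega>) \<partial>M) \<longlonglongrightarrow> Im G * measure \<nu> {a<..b}"
    by simp
  have ig: "integrable M (\<lambda>\<omega>. g n \<omega> * complex_of_real (indicator {a<..b} (A n \<omega>)))" for n
    using g1 by (intro M.integrable_const_bound[where B=1]) (auto simp: norm_mult indicator_def)
  show ?thesis
    using re im ig by (subst tendsto_complex_iff) (simp flip: integral_Re integral_Im)
qed

lemma levy_continuity_product:
  fixes A :: "nat \<Rightarrow> 'k \<Rightarrow> 'w \<Rightarrow> real"
  assumes M: "prob_space M" and I: "finite I"
    and A: "\<And>n k. k \<in> I \<Longrightarrow> A n k \<in> borel_measurable M"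
    and \<nu>: "\<And>k. k \<in> I \<Longrightarrow> real_distribution (\<nu> k)" and atoms: "\<And>k x. k \<in> I \<Longrightarrow> measure (\<nu> k) {x} = 0"
    and lim: "\<And>t. (\<lambda>n. \<integral>\<omega>. iexp (\<Sum>k\<in>I. t k * A n k \<omega>) \<partial>M) \<longlonglongrightarrow> (\<Prod>k\<in>I. char (\<nu> k) (t k))"
    and ab: "\<And>k. k \<in> I \<Longrightarrow> a k < b k"
  shows "(\<lambda>n. measure M {\<omega>\<in>space M. \<forall>k\<in>I. A n k \<omega> \<in> {a k<..b k}}) \<longlonglongrightarrow> (\<Prod>k\<in>I. measure (\<nu> k) {a k<..b k})"
proof -
  interpret M: prob_space M by fact
  let ?ind = "\<lambda>n J \<omega>. \<Prod>k\<in>J. complex_of_real (indicator {a k<..b k} (A n k \<omega>))"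
  \<comment> \<open>The vector whose only nonzero entry is \<open>s\<close> at \<open>k\<close>
    isolates one coordinate, because characteristic functions are 1 at 0.\<close>
  have lim1: "(\<lambda>n. \<integral>\<omega>. iexp (s * A n k \<omega>) \<partial>M) \<longlonglongrightarrow> char (\<nu> k) s" if k: "k \<in> I" for k s
  proof -
    have 1: "(\<Sum>j\<in>I. (if j = k then s else 0) * A n j \<omega>) = s * A n k \<omega>" for n \<omega>
    proof -
      have "(\<Sum>j\<in>I. (if j = k then s else 0) * A n j \<omega>) = (\<Sum>j\<in>I. if j = k then s * A n j \<omega> else 0)"
        by (intro sum.cong) auto
      then show ?thesis using I k by simp
    qed
    have 2: "(\<Prod>j\<in>I. char (\<nu> j) (if j = k then s else 0)) = char (\<nu> k) s"
    proof -
      have "(\<Prod>j\<in>I. char (\<nu> j) (if j = k then s else 0)) = (\<Prod>j\<in>I. if j = k then char (\<nu> j) s else 1)"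
        using \<nu> by (intro prod.cong) (auto simp: real_distribution.char_zero)
      then show ?thesis using I k by simp
    qed
    show ?thesis using lim[of "\<lambda>j. if j = k then s else 0"] unfolding 1 2 .
  qed
  have "(\<lambda>n. \<integral>\<omega>. ?ind n J \<omega> * iexp (\<Sum>k\<in>I - J. t k * A n k \<omega>) \<partial>M)
      \<longlonglongrightarrow> (\<Prod>k\<in>J. complex_of_real (measure (\<nu> k) {a k<..b k})) * (\<Prod>k\<in>I - J. char (\<nu> k) (t k))"
    if "J \<subseteq> I" for J t
    using finite_subset[OF that I] that
  \<comment> \<open>\<open>J\<close> is the set of coordinates already turned into indicators. The
    vector \<open>t\<close> has to stay arbitrary: to treat \<open>j\<close>, the induction
    hypothesis is used at \<open>t(j := s)\<close> for every \<open>s\<close>.\<close>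
  proof (induction J arbitrary: t rule: finite_induct)
    case empty
    show ?case using lim by simp
  next
    case (insert j J)
    have j: "j \<in> I" "J \<subseteq> I" using insert.prems by auto
    define K where "K = I - insert j J"
    have IJ: "I - J = insert j K" and jK: "j \<notin> K" and fK: "finite K" and KI: "K \<subseteq> I"
      using insert.hyps insert.prems I by (auto simp: K_def)
    define g where "g n \<omega> = ?ind n J \<omega> * iexp (\<Sum>k\<in>K. t k * A n k \<omega>)" for n \<omega>
    let ?G = "(\<Prod>k\<in>J. complex_of_real (measure (\<nu> k) {a k<..b k})) * (\<Prod>k\<in>K. char (\<nu> k) (t k))"
    have gm: "g n \<in> borel_measurable M" for n
    proof -
      have "(\<lambda>\<omega>. complex_of_real (indicator {a k<..b k} (A n k \<omega>))) \<in> borel_measurable M" if "k \<in> J" for k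
        
      proof -
        have [measurable]: "A n k \<in> borel_measurable M" using A that j by auto
        show ?thesis by measurable
      qed
      moreover have "(\<lambda>\<omega>. \<Sum>k\<in>K. t k * A n k \<omega>) \<in> borel_measurable M"
        using A KI by (intro borel_measurable_sum borel_measurable_times) auto
      ultimately show ?thesis unfolding g_def by measurable
    qed
    have g1: "norm (g n \<omega>) \<le> 1" for n \<omega>
      unfolding g_def by (auto simp: norm_mult prod_norm[symmetric] indicator_def intro!: prod_le_1)
    have "(\<lambda>n. \<integral>\<omega>. g n \<omega> * complex_of_real (indicator {a j<..b j} (A n j \<omega>)) \<partial>M) \<longlonglongrightarrow> ?G * complex_of_real (measure (\<nu> j) {a j<..b j})"
    proof (rule complex_weighted_levy_continuity[OF M A[OF j(1)] gm g1 \<nu>[OF j(1)] atoms[OF j(1)] lim1[OF j(1)] _ ab[OF j(1)]])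
      fix s
      have "(\<Sum>k\<in>I - J. (t(j := s)) k * A n k \<omega>) = s * A n j \<omega> + (\<Sum>k\<in>K. t k * A n k \<omega>)" for n \<omega>
      proof -
        have "(\<Sum>k\<in>K. (t(j := s)) k * A n k \<omega>) = (\<Sum>k\<in>K. t k * A n k \<omega>)"
          using jK by (intro sum.cong) auto
        then show ?thesis unfolding IJ using jK fK by simp
      qed
      then have 1: "?ind n J \<omega> * iexp (\<Sum>k\<in>I - J. (t(j := s)) k * A n k \<omega>) = g n \<omega> * iexp (s * A n j \<omega>)" for n \<omega>
        unfolding g_def by (simp add: exp_add ring_distribs)
      have 2: "(\<Prod>k\<in>J. complex_of_real (measure (\<nu> k) {a k<..b k})) * (\<Prod>k\<in>I - J. char (\<nu> k) ((t(j := s)) k)) = ?G * char (\<nu> j) s"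
      proof -
        have "(\<Prod>k\<in>K. char (\<nu> k) ((t(j := s)) k)) = (\<Prod>k\<in>K. char (\<nu> k) (t k))"
          using jK by (intro prod.cong) auto
        then show ?thesis unfolding IJ using jK fK by simp
      qed
      show "(\<lambda>n. \<integral>\<omega>. g n \<omega> * iexp (s * A n j \<omega>) \<partial>M) \<longlonglongrightarrow> ?G * char (\<nu> j) s"
        using insert.IH[OF j(2), of "t(j := s)"] unfolding 1 2 .
    qed
    moreover have "g n \<omega> * complex_of_real (indicator {a j<..b j} (A n j \<omega>)) = ?ind n (insert j J) \<omega> * iexp (\<Sum>k\<in>I - insert j J. t k * A n k \<omega>)" for n \<omega>
      using insert.hyps unfolding g_def K_def by simp
    moreover have "?G * complex_of_real (measure (\<nu> j) {a j<..b j}) =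
       (\<Prod>k\<in>insert j J. complex_of_real (measure (\<nu> k) {a k<..b k})) * (\<Prod>k\<in>I - insert j J. char (\<nu> k) (t k))"
      using insert.hyps unfolding K_def by simp
    ultimately show ?case by simp
  qed
  from this[OF order_refl]
  have L: "(\<lambda>n. \<integral>\<omega>. ?ind n I \<omega> \<partial>M) \<longlonglongrightarrow> complex_of_real (\<Prod>k\<in>I. measure (\<nu> k) {a k<..b k})"
    by simp
  have "(\<integral>\<omega>. ?ind n I \<omega> \<partial>M) = complex_of_real (measure M {\<omega>\<in>space M. \<forall>k\<in>I. A n k \<omega> \<in> {a k<..b k}})" for n
  proof -
    let ?E = "{\<omega>\<in>space M. \<forall>k\<in>I. A n k \<omega> \<in> {a k<..b k}}"
    have E: "?E \<in> sets M"
      using A I by (intro sets.sets_Collect_finite_All measurable_sets_Collect[where M=M]) auto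
    have "(\<integral>\<omega>. ?ind n I \<omega> \<partial>M) = (\<integral>\<omega>. complex_of_real (indicator ?E \<omega>) \<partial>M)"
    proof (intro Bochner_Integration.integral_cong refl)
      fix \<omega> assume "\<omega> \<in> space M"
      then show "?ind n I \<omega> = complex_of_real (indicator ?E \<omega>)"
        using I by (cases "\<omega> \<in> ?E") (auto simp: indicator_def intro!: prod_zero)
    qed
    also have "\<dots> = complex_of_real (\<integral>\<omega>. indicator ?E \<omega> \<partial>M)"
      by (rule integral_complex_of_real)
    finally show ?thesis using E by simp
  qed
  then show ?thesis using L by (simp add: tendsto_of_real_iff del: of_real_prod)
qed

section \<open>A portmanteau theorem for boxes\<close>

text \<open>Inclusion and exclusion, one set at a time. The overlaps with the last set form again a
  family in \<open>C\<close>, so the induction has to range over all families.\<close>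

lemma measure_UN_Int_stable_tendsto:
  assumes Q: "\<And>n. finite_measure (Q n)" and \<mu>: "finite_measure \<mu>"
    and C: "Int_stable C" "\<And>n. C \<subseteq> sets (Q n)" "C \<subseteq> sets \<mu>"
    and lim: "\<And>A. A \<in> C \<Longrightarrow> (\<lambda>n. measure (Q n) A) \<longlonglongrightarrow> measure \<mu> A"
    and f: "\<And>i. f i \<in> C"
  shows "(\<lambda>n. measure (Q n) (\<Union>i<m. f i)) \<longlonglongrightarrow> measure \<mu> (\<Union>i<m::nat. f i)"
  using f
proof (induction m arbitrary: f)
  case 0
  show ?case by simp
next
  case (Suc m)
  have split: "measure N (\<Union>i<Suc m. f i) =
      measure N (\<Union>i<m. f i) + measure N (f m) - measure N (\<Union>i<m. f i \<inter> f m)"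
    if N: "finite_measure N" "C \<subseteq> sets N" for N
  proof -
    have s: "f i \<in> sets N" for i using N Suc.prems by auto
    have "measure N (f m \<union> (\<Union>i<m. f i)) = measure N (f m) + measure N (\<Union>i<m. f i) - measure N (f m \<inter> (\<Union>i<m. f i))"
      using s by (intro measure_Un3) (auto simp: fmeasurable_def finite_measure.emeasure_finite[OF N(1)] less_top[symmetric])
    moreover have "f m \<inter> (\<Union>i<m. f i) = (\<Union>i<m. f i \<inter> f m)" by auto
    ultimately show ?thesis by (simp add: lessThan_Suc)
  qed
  have "f i \<inter> f m \<in> C" for i
    using C(1) Suc.prems by (auto simp: Int_stable_def)
  then show ?case
    unfolding split[OF Q C(2)] split[OF \<mu> C(3)]
    by (intro tendsto_diff tendsto_add Suc.IH Suc.prems lim)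
qed

text \<open>Finitely many of the sets already carry the limit mass of the union up to \<epsilon>.
  The masses of this finite union converge, and the remaining sets can only add mass.\<close>

lemma eventually_measure_UN_ge:
  assumes Q: "\<And>n. finite_measure (Q n)" and \<mu>: "finite_measure \<mu>"
    and C: "Int_stable C" "\<And>n. C \<subseteq> sets (Q n)" "C \<subseteq> sets \<mu>"
    and lim: "\<And>A. A \<in> C \<Longrightarrow> (\<lambda>n. measure (Q n) A) \<longlonglongrightarrow> measure \<mu> A"
    and f: "\<And>i::nat. f i \<in> C" and \<epsilon>: "\<epsilon> > 0"
  shows "\<forall>\<^sub>F n in sequentially. measure (Q n) (\<Union>i. f i) > measure \<mu> (\<Union>i. f i) - \<epsilon>"
proof -
  interpret \<mu>: finite_measure \<mu> by fact
  have "(\<lambda>m. measure \<mu> (\<Union>i<m. f i)) \<longlonglongrightarrow> measure \<mu> (\<Union>m. \<Union>i<m. f i)"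
  proof (intro \<mu>.finite_Lim_measure_incseq)
    have fs: "f i \<in> sets \<mu>" for i using f C(3) by auto
    then show "range (\<lambda>m. \<Union>i<m. f i) \<subseteq> sets \<mu>" by auto
    show "incseq (\<lambda>m. \<Union>i<m. f i)" by (intro monoI UN_mono) auto
  qed
  moreover have "(\<Union>m. \<Union>i<m. f i) = (\<Union>i. f i)" by auto
  ultimately have "\<forall>\<^sub>F m in sequentially. measure \<mu> (\<Union>i<m. f i) > measure \<mu> (\<Union>i. f i) - \<epsilon>"
    using \<epsilon> by (intro order_tendstoD(1)[where y="measure \<mu> (\<Union>i. f i)"]) auto
  then obtain m where m: "measure \<mu> (\<Union>i<m. f i) > measure \<mu> (\<Union>i. f i) - \<epsilon>"
    by (auto simp: eventually_sequentially)
  have "\<forall>\<^sub>F n in sequentially. measure (Q n) (\<Union>i<m. f i) > measure \<mu> (\<Union>i. f i) - \<epsilon>"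
    by (rule order_tendstoD(1)[OF measure_UN_Int_stable_tendsto[OF Q \<mu> C lim f] m])
  then show ?thesis
  proof eventually_elim
    case (elim n)
    interpret Qn: finite_measure "Q n" by fact
    have "measure (Q n) (\<Union>i<m. f i) \<le> measure (Q n) (\<Union>i. f i)"
    proof (intro Qn.finite_measure_mono)
      have fs: "f i \<in> sets (Q n)" for i using f C(2)[of n] by auto
      then show "(\<Union>i. f i) \<in> sets (Q n)" by auto
    qed auto
    then show ?case using elim by linarith
  qed
qed

section \<open>Half-open boxes and open sets as their countable unions\<close>

definition half_open_box :: "'k set \<Rightarrow> ('k \<Rightarrow> real) \<Rightarrow> ('k \<Rightarrow> real) \<Rightarrow> ('k \<Rightarrow> real) set" where
  "half_open_box I a b = Pi\<^sub>E I (\<lambda>k. {a k<..b k})"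

text \<open>All sides are nondegenerate, as the convergence statement for intervals requires; the
  empty set is added so that disjoint boxes do not spoil stability under intersection.\<close>

definition half_open_boxes :: "'k set \<Rightarrow> ('k \<Rightarrow> real) set set" where
  "half_open_boxes I = insert {} {half_open_box I a b | a b. \<forall>k\<in>I. a k < b k}"

lemma half_open_boxesE:
  assumes "A \<in> half_open_boxes I" "A \<noteq> {}"
  obtains a b where "A = half_open_box I a b" "\<forall>k\<in>I. a k < b k"
  using assms by (auto simp: half_open_boxes_def)

lemma Int_stable_half_open_boxes:
  fixes I :: "'k set"
  shows "Int_stable (half_open_boxes I)"
proof -
  have *: "half_open_box I a b \<inter> half_open_box I c d \<in> half_open_boxes I" for a b c d :: "'k \<Rightarrow> real"
  proof -
    have eq: "half_open_box I a b \<inter> half_open_box I c d = half_open_box I (\<lambda>k. max (a k) (c k)) (\<lambda>k. min (b k) (d k))"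
      by (auto simp: half_open_box_def PiE_iff)
    show ?thesis
    proof (cases "\<forall>k\<in>I. max (a k) (c k) < min (b k) (d k)")
      case True
      then show ?thesis unfolding eq half_open_boxes_def by blast
    next
      case False
      then obtain k where "k \<in> I" "{max (a k) (c k)<..min (b k) (d k)} = {}" by force
      then have "half_open_box I (\<lambda>k. max (a k) (c k)) (\<lambda>k. min (b k) (d k)) = {}"
        unfolding half_open_box_def by (metis PiE_eq_empty_iff)
      then show ?thesis unfolding eq half_open_boxes_def by simp
    qed
  qed
  show ?thesis
    unfolding Int_stable_def
  proof (intro ballI)
    fix A B assume AB: "A \<in> half_open_boxes I" "B \<in> half_open_boxes I"
    show "A \<inter> B \<in> half_open_boxes I"
    proof (cases "A = {} \<or> B = {}")
      case True
      then show ?thesis by (auto simp: half_open_boxes_def)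
    next
      case False
      then obtain a b c d where "A = half_open_box I a b" "B = half_open_box I c d"
        using AB half_open_boxesE[of A I] half_open_boxesE[of B I] by metis
      then show ?thesis using * by simp
    qed
  qed
qed

lemma sets_half_open_boxes: "finite I \<Longrightarrow> half_open_boxes I \<subseteq> sets (PiM I (\<lambda>_. borel))"
  by (auto simp: half_open_boxes_def half_open_box_def intro!: sets_PiM_I_finite)

text \<open>Every point of \<open>U\<close> lies in a box inside \<open>U\<close> with rational
  endpoints, chosen on either side of each coordinate within \<delta>. As endpoints are restricted
  to the finite set \<open>I\<close>, there are only countably many such boxes.\<close>

lemma open_UN_half_open_boxes:
  fixes U :: "('k \<Rightarrow> real) set"
  assumes I: "finite I" and U: "U \<subseteq> extensional I"
    and op: "\<And>x. x \<in> U \<Longrightarrow> \<exists>\<delta>>0. \<forall>y\<in>extensional I. (\<forall>k\<in>I. \<bar>y k - x k\<bar> < \<delta>) \<longrightarrow> y \<in> U"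
  obtains f :: "nat \<Rightarrow> ('k \<Rightarrow> real) set" where "range f \<subseteq> half_open_boxes I" "U = (\<Union>i. f i)"
proof -
  define R where "R = {(a, b) \<in> (I \<rightarrow>\<^sub>E \<rat>) \<times> (I \<rightarrow>\<^sub>E \<rat>). (\<forall>k\<in>I. a k < b k) \<and> half_open_box I a b \<subseteq> U}"
  \<comment> \<open>The empty set makes \<open>E\<close> nonempty, so that
    \<open>from_nat_into\<close> enumerates exactly \<open>E\<close>.\<close>
  define E where "E = insert {} ((\<lambda>(a, b). half_open_box I a b) ` R)"
  have "countable ((I \<rightarrow>\<^sub>E \<rat>) \<times> (I \<rightarrow>\<^sub>E (\<rat> :: real set)))"
    using I by (intro countable_SIGMA countable_PiE) (auto simp: countable_rat)
  then have "countable R"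
    unfolding R_def by (rule countable_subset[rotated]) auto
  then have "countable E" unfolding E_def by simp
  have ne: "E \<noteq> {}" by (simp add: E_def)
  have "E \<subseteq> half_open_boxes I" by (auto simp: E_def R_def half_open_boxes_def)
  have "U \<subseteq> \<Union>E"
  proof
    fix x assume x: "x \<in> U"
    from op[OF x] obtain \<delta> where \<delta>: "\<delta> > 0" "\<And>y. y \<in> extensional I \<Longrightarrow> (\<forall>k\<in>I. \<bar>y k - x k\<bar> < \<delta>) \<Longrightarrow> y \<in> U" by blast
    have "\<exists>r\<in>\<rat>. x k - \<delta> < r \<and> r < x k" for k using Rats_dense_in_real[of "x k - \<delta>" "x k"] \<delta>(1) by auto
    then obtain a where a: "\<And>k. a k \<in> \<rat>" "\<And>k. x k - \<delta> < a k" "\<And>k. a k < x k" by metis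
    have "\<exists>r\<in>\<rat>. x k < r \<and> r < x k + \<delta>" for k using Rats_dense_in_real[of "x k" "x k + \<delta>"] \<delta>(1) by auto
    then obtain b where b: "\<And>k. b k \<in> \<rat>" "\<And>k. b k < x k + \<delta>" "\<And>k. x k < b k" by metis
    let ?B = "half_open_box I (restrict a I) (restrict b I)"
    have B: "y \<in> ?B \<longleftrightarrow> y \<in> extensional I \<and> (\<forall>k\<in>I. a k < y k \<and> y k \<le> b k)" for y
      by (auto simp: half_open_box_def PiE_iff)
    have "?B \<subseteq> U"
    proof
      fix y assume y: "y \<in> ?B"
      have "\<bar>y k - x k\<bar> < \<delta>" if "k \<in> I" for k
      proof -
        have "a k < y k" "y k \<le> b k" using y that unfolding B by auto
        then show ?thesis using a(2)[of k] b(2)[of k] by linarith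
      qed
      then show "y \<in> U" using y unfolding B by (intro \<delta>(2)) auto
    qed
    moreover have "a k < b k" for k using a(3)[of k] b(3)[of k] by linarith
    ultimately have "(restrict a I, restrict b I) \<in> R"
      using a(1) b(1) by (auto simp: R_def)
    then have "?B \<in> E" unfolding E_def by (intro insertI2 image_eqI[where x="(restrict a I, restrict b I)"]) auto
    moreover have "x \<in> ?B"
      using x U a(3) b(3) unfolding B by (auto simp: less_imp_le)
    ultimately show "x \<in> \<Union>E" by blast
  qed
  moreover have "\<Union>E \<subseteq> U" by (auto simp: E_def R_def)
  ultimately have "U = \<Union>E" by auto
  moreover have "range (from_nat_into E) = E"
    using ne \<open>countable E\<close> by (rule range_from_nat_into)
  ultimately have "U = (\<Union>i. from_nat_into E i)" by simp
  moreover have "range (from_nat_into E) \<subseteq> half_open_boxes I"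
    using \<open>range (from_nat_into E) = E\<close> \<open>E \<subseteq> half_open_boxes I\<close> by simp
  ultimately show ?thesis using that by blast
qed

text \<open>
  The liminf bound for open sets, applied to \<open>U\<close> and to \<open>W\<close>, bounds the probability of \<open>E\<close> from both
  sides, since \<open>U\<close> and \<open>W\<close> exhaust the limit law.
\<close>

lemma box_convergence_imp_measure_tendsto:
  fixes U W E :: "('k \<Rightarrow> real) set"
  assumes I: "finite I" and Q: "\<And>n. prob_space (Q n)" "\<And>n. sets (Q n) = sets (PiM I (\<lambda>_. borel))"
    and \<mu>: "prob_space \<mu>" "sets \<mu> = sets (PiM I (\<lambda>_. borel))"
    and lim: "\<And>a b. (\<And>k. k \<in> I \<Longrightarrow> a k < b k) \<Longrightarrow>
       (\<lambda>n. measure (Q n) (half_open_box I a b)) \<longlonglongrightarrow> measure \<mu> (half_open_box I a b)"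
    and U: "U \<subseteq> extensional I" "\<And>x. x \<in> U \<Longrightarrow> \<exists>\<delta>>0. \<forall>y\<in>extensional I. (\<forall>k\<in>I. \<bar>y k - x k\<bar> < \<delta>) \<longrightarrow> y \<in> U"
    and W: "W \<subseteq> extensional I" "\<And>x. x \<in> W \<Longrightarrow> \<exists>\<delta>>0. \<forall>y\<in>extensional I. (\<forall>k\<in>I. \<bar>y k - x k\<bar> < \<delta>) \<longrightarrow> y \<in> W"
    and full: "measure \<mu> U + measure \<mu> W = 1"
    and E: "E \<in> sets (PiM I (\<lambda>_. borel))" "U \<subseteq> E" "E \<inter> W = {}"
  shows "(\<lambda>n. measure (Q n) E) \<longlonglongrightarrow> measure \<mu> U"
proof -
  have fin: "finite_measure (Q n)" "finite_measure \<mu>" for n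
    using Q(1) \<mu>(1) by (auto intro: prob_space.finite_measure)
  have sb: "half_open_boxes I \<subseteq> sets (Q n)" "half_open_boxes I \<subseteq> sets \<mu>" for n
    using sets_half_open_boxes[OF I] Q(2) \<mu>(2) by auto
  have limb: "(\<lambda>n. measure (Q n) A) \<longlonglongrightarrow> measure \<mu> A" if A: "A \<in> half_open_boxes I" for A
  proof (cases "A = {}")
    case False
    obtain a b where ab: "A = half_open_box I a b" "\<forall>k\<in>I. a k < b k"
      by (rule half_open_boxesE[OF A False])
    show ?thesis unfolding ab(1) by (rule lim[OF bspec[OF ab(2)]])
  qed simp
  have ge: "\<forall>\<^sub>F n in sequentially. measure (Q n) V > measure \<mu> V - \<epsilon>" "V \<in> sets (PiM I (\<lambda>_. borel))"
    if V: "V \<subseteq> extensional I" "\<And>x. x \<in> V \<Longrightarrow> \<exists>\<delta>>0. \<forall>y\<in>extensional I. (\<forall>k\<in>I. \<bar>y k - x k\<bar> < \<delta>) \<longrightarrow> y \<in> V"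
      and e: "\<epsilon> > 0" for V \<epsilon>
  proof -
    obtain f :: "nat \<Rightarrow> ('k \<Rightarrow> real) set" where "range f \<subseteq> half_open_boxes I" "V = (\<Union>i. f i)"
      by (rule open_UN_half_open_boxes[OF I V])
    then have f: "\<And>i. f i \<in> half_open_boxes I" "V = (\<Union>i. f i)" by auto
    show "\<forall>\<^sub>F n in sequentially. measure (Q n) V > measure \<mu> V - \<epsilon>"
      unfolding f(2) by (rule eventually_measure_UN_ge[OF fin Int_stable_half_open_boxes sb limb f(1) e])
    show "V \<in> sets (PiM I (\<lambda>_. borel))" unfolding f(2) using f(1) sets_half_open_boxes[OF I] by auto
  qed
  show ?thesis
  proof (rule tendstoI)
    fix e :: real assume e: "e > 0"
    have "\<forall>\<^sub>F n in sequentially. measure (Q n) U > measure \<mu> U - e" by (rule ge(1)[OF U e])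
    moreover have "\<forall>\<^sub>F n in sequentially. measure (Q n) W > measure \<mu> W - e" by (rule ge(1)[OF W e])
    ultimately show "\<forall>\<^sub>F n in sequentially. dist (measure (Q n) E) (measure \<mu> U) < e"
    proof eventually_elim
      case (elim n)
      interpret Qn: prob_space "Q n" by (rule Q)
      have "measure (Q n) U \<le> measure (Q n) E"
        using E Q(2) by (intro Qn.finite_measure_mono) auto
      moreover have "measure (Q n) E + measure (Q n) W \<le> 1"
        using E ge(2)[OF W e] Q(2) by (subst Qn.finite_measure_Union[symmetric]) auto
      ultimately show ?case using elim full by (simp add: dist_real_def)
    qed
  qed
qed

section \<open>The sample variance of standard normals\<close>

lemma real_distribution_centered_normal: "\<sigma> > 0 \<Longrightarrow> real_distribution (centered_normal \<sigma>)"
  using prob_space_normal_density[of \<sigma> 0]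
  by (auto simp: centered_normal_def real_distribution_def real_distribution_axioms_def)

lemma sets_centered_normal [simp, measurable_cong]: "sets (centered_normal \<sigma>) = sets borel"
  by (simp add: centered_normal_def)

lemma space_centered_normal [simp]: "space (centered_normal \<sigma>) = UNIV"
  by (simp add: centered_normal_def)

lemma emeasure_centered_normal_singleton [simp]: "emeasure (centered_normal \<sigma>) {x} = 0"
proof -
  have "(\<integral>\<^sup>+y. ennreal (normal_density 0 \<sigma> y) * indicator {x} y \<partial>lborel) = 0"
    by (subst nn_integral_0_iff_AE) (auto intro!: AE_I'[of "{x}"] simp: indicator_def split: if_splits)
  then show ?thesis by (simp add: centered_normal_def emeasure_density)
qed

lemma measure_centered_normal_singleton [simp]: "measure (centered_normal \<sigma>) {x} = 0"
  by (simp add: measure_def)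

lemma char_centered_normal:
  assumes "\<sigma> > 0"
  shows "char (centered_normal \<sigma>) t = complex_of_real (exp (- (\<sigma> * t)\<^sup>2 / 2))"
proof -
  interpret N: prob_space "centered_normal 1"
    using real_distribution_centered_normal[of 1] by (simp add: real_distribution_def)
  have "distributed (centered_normal 1) lborel (\<lambda>x. x) std_normal_density"
    unfolding distributed_def by (auto simp: centered_normal_def distr_id2[symmetric] intro!: distr_id2)
  then have "distributed (centered_normal 1) lborel (\<lambda>x. 0 + \<sigma> * x) (normal_density (0 + \<sigma> * 0) (\<bar>\<sigma>\<bar> * 1))"
    using assms by (intro N.normal_density_affine) auto
  then have "distr (centered_normal 1) lborel (\<lambda>x. \<sigma> * x) = centered_normal \<sigma>"
    using assms by (simp add: distributed_def centered_normal_def)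
  then have "char (centered_normal \<sigma>) t = char (distr (centered_normal 1) lborel (\<lambda>x. \<sigma> * x)) t" by simp
  also have "\<dots> = char (centered_normal 1) (\<sigma> * t)"
    unfolding char_def by (subst integral_distr) (auto simp: mult_ac)
  also have "\<dots> = complex_of_real (exp (- (\<sigma> * t)\<^sup>2 / 2))"
    unfolding centered_normal_def char_std_normal_distribution ..
  finally show ?thesis .
qed

lemma nn_integral_centered_normal:
  "f \<in> borel_measurable borel \<Longrightarrow> (\<integral>\<^sup>+x. f x \<partial>centered_normal \<sigma>) = (\<integral>\<^sup>+x. ennreal (normal_density 0 \<sigma> x) * f x \<partial>lborel)"
  by (simp add: centered_normal_def nn_integral_density)

text \<open>The rotation is written as two one-dimensional affine substitutions.\<close>

lemma std_normal_rotation_invariant: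
  fixes f :: "real \<times> real \<Rightarrow> ennreal"
  assumes [measurable]: "f \<in> borel_measurable (borel \<Otimes>\<^sub>M borel)" and ab: "a\<^sup>2 + b\<^sup>2 = 1" and a: "a \<noteq> 0"
  shows "(\<integral>\<^sup>+y. \<integral>\<^sup>+x. f (a * x + b * y, b * x - a * y) \<partial>centered_normal 1 \<partial>centered_normal 1) =
    (\<integral>\<^sup>+v. \<integral>\<^sup>+u. f (u, v) \<partial>centered_normal 1 \<partial>centered_normal 1)"
proof -
  have a1: "1 / a \<noteq> 0" and a2: "- a \<noteq> 0" using a by auto
  let ?\<phi> = "\<lambda>x. ennreal (std_normal_density x)"
  have f': "(\<lambda>(x, y). f (g x y, h x y)) \<in> borel_measurable (borel \<Otimes>\<^sub>M borel)"
    if [measurable]: "case_prod g \<in> borel_measurable (borel \<Otimes>\<^sub>M borel)" "case_prod h \<in> borel_measurable (borel \<Otimes>\<^sub>M borel)"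
    for g h :: "real \<Rightarrow> real \<Rightarrow> real"
    by measurable
  \<comment> \<open>First substitution, with \<open>y\<close> fixed:
    \<open>u = a * x + b * y\<close> replaces \<open>x\<close>.\<close>
  have inner: "(\<integral>\<^sup>+x. f (a * x + b * y, b * x - a * y) \<partial>centered_normal 1) =
      ennreal \<bar>1/a\<bar> * (\<integral>\<^sup>+u. ?\<phi> (- b * y / a + 1/a * u) * f (u, (b * u - y) / a) \<partial>lborel)" for y
  proof -
    have "(\<integral>\<^sup>+x. f (a * x + b * y, b * x - a * y) \<partial>centered_normal 1) = (\<integral>\<^sup>+x. ?\<phi> x * f (a * x + b * y, b * x - a * y) \<partial>lborel)"
      by (rule nn_integral_centered_normal) measurable
    also have "\<dots> = ennreal \<bar>1/a\<bar> * (\<integral>\<^sup>+u. ?\<phi> (- b * y / a + 1/a * u) * f (a * (- b * y / a + 1/a * u) + b * y, b * (- b * y / a + 1/a * u) - a * y) \<partial>lborel)"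
      by (rule nn_integral_real_affine[OF _ a1]) measurable
    also have "a * (- b * y / a + 1/a * u) + b * y = u" for u
      using a by (simp add: field_simps)
    moreover have "b * (- b * y / a + 1/a * u) - a * y = (b * u - y) / a" for u
    proof -
      have "b * (- b * y / a + 1/a * u) - a * y = (b * u - (a\<^sup>2 + b\<^sup>2) * y) / a"
        using a by (simp add: field_simps power2_eq_square)
      then show ?thesis by (simp add: ab)
    qed
    ultimately show ?thesis by simp
  qed
  have "(\<integral>\<^sup>+y. \<integral>\<^sup>+x. f (a * x + b * y, b * x - a * y) \<partial>centered_normal 1 \<partial>centered_normal 1) =
     (\<integral>\<^sup>+y. ?\<phi> y * (ennreal \<bar>1/a\<bar> * (\<integral>\<^sup>+u. ?\<phi> (- b * y / a + 1/a * u) * f (u, (b * u - y) / a) \<partial>lborel)) \<partial>lborel)"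
    unfolding inner by (rule nn_integral_centered_normal) measurable
  also have "\<dots> = (\<integral>\<^sup>+y. \<integral>\<^sup>+u. ennreal \<bar>1/a\<bar> * (?\<phi> y * ?\<phi> (- b * y / a + 1/a * u) * f (u, (b * u - y) / a)) \<partial>lborel \<partial>lborel)"
    by (intro nn_integral_cong) (simp add: nn_integral_cmult[symmetric] mult_ac)
  also have "\<dots> = (\<integral>\<^sup>+u. \<integral>\<^sup>+y. ennreal \<bar>1/a\<bar> * (?\<phi> y * ?\<phi> (- b * y / a + 1/a * u) * f (u, (b * u - y) / a)) \<partial>lborel \<partial>lborel)"
    by (rule lborel_pair.Fubini') measurable
  also have "\<dots> = (\<integral>\<^sup>+u. \<integral>\<^sup>+v. ?\<phi> u * (?\<phi> v * f (u, v)) \<partial>lborel \<partial>lborel)"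
  proof (rule nn_integral_cong)
    fix u
    \<comment> \<open>Second substitution, with \<open>u\<close> fixed:
      \<open>y = b * u - a * v\<close>. The linear map is its own inverse, so \<open>x\<close>
      becomes \<open>a * u + b * v\<close>. The two scaling factors cancel, and the product of the
      densities is unchanged because the map preserves the Euclidean norm.\<close>
    have "(\<integral>\<^sup>+y. ennreal \<bar>1/a\<bar> * (?\<phi> y * ?\<phi> (- b * y / a + 1/a * u) * f (u, (b * u - y) / a)) \<partial>lborel) =
      ennreal \<bar>-a\<bar> * (\<integral>\<^sup>+v. ennreal \<bar>1/a\<bar> * (?\<phi> (b * u + -a * v) * ?\<phi> (- b * (b * u + -a * v) / a + 1/a * u) * f (u, (b * u - (b * u + -a * v)) / a)) \<partial>lborel)"
      by (rule nn_integral_real_affine[OF _ a2]) measurable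
    also have "\<dots> = (\<integral>\<^sup>+v. ennreal \<bar>-a\<bar> * (ennreal \<bar>1/a\<bar> * (?\<phi> (b * u + -a * v) * ?\<phi> (- b * (b * u + -a * v) / a + 1/a * u) * f (u, (b * u - (b * u + -a * v)) / a))) \<partial>lborel)"
      by (rule nn_integral_cmult[symmetric]) measurable
    also have "\<dots> = (\<integral>\<^sup>+v. ?\<phi> u * (?\<phi> v * f (u, v)) \<partial>lborel)"
    proof (rule nn_integral_cong)
      fix v
      have 1: "(b * u - (b * u + -a * v)) / a = v" using a by simp
      have 2: "- b * (b * u + -a * v) / a + 1/a * u = a * u + b * v"
      proof -
        have "- b * (b * u + -a * v) / a + 1/a * u = ((1 - b\<^sup>2) * u + a * b * v) / a"
          using a by (simp add: field_simps power2_eq_square)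
        also have "1 - b\<^sup>2 = a\<^sup>2" using ab by simp
        finally show ?thesis using a by (simp add: field_simps power2_eq_square)
      qed
      have 3: "ennreal \<bar>-a\<bar> * ennreal \<bar>1/a\<bar> = 1"
        using a by (simp add: ennreal_mult[symmetric])
      have "(b * u + -a * v)\<^sup>2 + (a * u + b * v)\<^sup>2 = (a\<^sup>2 + b\<^sup>2) * (u\<^sup>2 + v\<^sup>2)"
        by (simp add: power2_eq_square algebra_simps)
      then have "std_normal_density (b * u + -a * v) * std_normal_density (a * u + b * v) = std_normal_density u * std_normal_density v"
        unfolding ab std_normal_density_def
        by (simp add: mult_ac exp_add[symmetric] add_divide_distrib[symmetric] flip: minus_add_distrib)
      then have 4: "?\<phi> (b * u + -a * v) * ?\<phi> (a * u + b * v) = ?\<phi> u * ?\<phi> v"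
        by (simp add: ennreal_mult[symmetric])
      show "ennreal \<bar>-a\<bar> * (ennreal \<bar>1/a\<bar> * (?\<phi> (b * u + -a * v) * ?\<phi> (- b * (b * u + -a * v) / a + 1/a * u) * f (u, (b * u - (b * u + -a * v)) / a))) = ?\<phi> u * (?\<phi> v * f (u, v))"
        unfolding 1 2 4 mult.assoc[symmetric] 3 by simp
    qed
    finally show "(\<integral>\<^sup>+y. ennreal \<bar>1/a\<bar> * (?\<phi> y * ?\<phi> (- b * y / a + 1/a * u) * f (u, (b * u - y) / a)) \<partial>lborel) = (\<integral>\<^sup>+v. ?\<phi> u * (?\<phi> v * f (u, v)) \<partial>lborel)" .
  qed
  also have "\<dots> = (\<integral>\<^sup>+v. \<integral>\<^sup>+u. ?\<phi> u * (?\<phi> v * f (u, v)) \<partial>lborel \<partial>lborel)"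
    by (rule lborel_pair.Fubini') measurable
  also have "\<dots> = (\<integral>\<^sup>+v. ?\<phi> v * (\<integral>\<^sup>+u. ?\<phi> u * f (u, v) \<partial>lborel) \<partial>lborel)"
    by (intro nn_integral_cong) (simp add: nn_integral_cmult[symmetric] mult_ac)
  also have "\<dots> = (\<integral>\<^sup>+v. \<integral>\<^sup>+u. f (u, v) \<partial>centered_normal 1 \<partial>centered_normal 1)"
    by (subst (1 2) nn_integral_centered_normal) measurable
  finally show ?thesis .
qed

section \<open>Sums of squared deviations and their law\<close>

definition sum_sq_dev :: "nat \<Rightarrow> (nat \<Rightarrow> real) \<Rightarrow> real" where
  "sum_sq_dev n z = (\<Sum>i=1..n. (z i - (\<Sum>j=1..n. z j) / real n)\<^sup>2)"

lemma sum_sq_dev_eq: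
  "n > 0 \<Longrightarrow> sum_sq_dev n z = (\<Sum>i=1..n. (z i)\<^sup>2) - (\<Sum>j=1..n. z j)\<^sup>2 / real n"
proof -
  assume n: "n > 0"
  define m where "m = (\<Sum>j=1..n. z j) / real n"
  have "sum_sq_dev n z = (\<Sum>i=1..n. (z i)\<^sup>2 - 2 * m * z i + m\<^sup>2)"
    unfolding sum_sq_dev_def m_def[symmetric] by (intro sum.cong) (simp_all add: power2_diff)
  also have "\<dots> = (\<Sum>i=1..n. (z i)\<^sup>2) - 2 * m * (\<Sum>j=1..n. z j) + real n * m\<^sup>2"
    by (simp add: sum.distrib sum_subtractf sum_distrib_left)
  also have "(\<Sum>j=1..n. z j) = real n * m" using n by (simp add: m_def)
  finally have "sum_sq_dev n z = (\<Sum>i=1..n. (z i)\<^sup>2) - real n * m\<^sup>2"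
    by (simp add: power2_eq_square)
  then show ?thesis using n by (simp add: m_def power2_eq_square)
qed

text \<open>The increment is the square of the Helmert contrast between the new point and the old
  ones. For standard normals both the normalised sum of the old points and the new point are
  standard normal, and the contrast is one coordinate of an orthogonal image of this pair.\<close>

lemma sum_sq_dev_Suc:
  assumes "n > 0"
  shows "sum_sq_dev (Suc n) z = sum_sq_dev n z +
    (((\<Sum>i=1..n. z i) / sqrt (real n) - sqrt (real n) * z (Suc n)) / sqrt (real (Suc n)))\<^sup>2"
proof -
  define S where "S = (\<Sum>i=1..n. z i)"
  have "((S / sqrt (real n) - sqrt (real n) * z (Suc n)) / sqrt (real (Suc n)))\<^sup>2 =
     (S / sqrt (real n) - sqrt (real n) * z (Suc n))\<^sup>2 / real (Suc n)"
    by (simp add: power_divide)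
  also have "(S / sqrt (real n) - sqrt (real n) * z (Suc n))\<^sup>2 = S\<^sup>2 / real n - 2 * S * z (Suc n) + real n * (z (Suc n))\<^sup>2"
    using assms by (simp add: power2_diff power_divide power_mult_distrib)
  also have "(S\<^sup>2 / real n - 2 * S * z (Suc n) + real n * (z (Suc n))\<^sup>2) / real (Suc n) =
     S\<^sup>2 / real n + (z (Suc n))\<^sup>2 - (S + z (Suc n))\<^sup>2 / real (Suc n)"
    using assms by (simp add: divide_simps) (simp add: algebra_simps power2_eq_square)
  finally show ?thesis
    using assms by (simp add: sum_sq_dev_eq S_def)
qed

lemma sum_component_measurable:
  "J \<subseteq> I \<Longrightarrow> (\<lambda>z. \<Sum>i\<in>J. z i :: real) \<in> borel_measurable (PiM I (\<lambda>_. borel))"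
  by (intro borel_measurable_sum measurable_component_singleton) auto

lemma sum_sq_dev_measurable:
  assumes "{1..n} \<subseteq> I"
  shows "sum_sq_dev n \<in> borel_measurable (PiM I (\<lambda>_. borel))"
proof -
  note [measurable] = sum_component_measurable[OF assms]
  have [measurable]: "(\<lambda>z. z i :: real) \<in> borel_measurable (PiM I (\<lambda>_. borel))" if "i \<in> {1..n}" for i
    using assms that by (intro measurable_component_singleton) auto
  show ?thesis unfolding sum_sq_dev_def by measurable
qed

abbreviation std_normals :: "nat set \<Rightarrow> (nat \<Rightarrow> real) measure" where
  "std_normals I \<equiv> PiM I (\<lambda>_. centered_normal 1)"

lemma product_sigma_finite_std_normal: "product_sigma_finite (\<lambda>_::nat. centered_normal 1)"
  using real_distribution_centered_normal[of 1]
  by (auto simp: real_distribution_def product_sigma_finite_def intro!: prob_space_imp_sigma_finite)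

lemma sets_std_normals [measurable_cong]: "sets (std_normals I) = sets (PiM I (\<lambda>_. borel))"
  by (intro sets_PiM_cong) auto

text \<open>Helmert's transformation, performed by one planar rotation for each added coordinate.\<close>

lemma nn_integral_std_normals_mean_sum_sq_dev:
  fixes f :: "real \<times> real \<Rightarrow> ennreal"
  assumes "n > 0" and f: "f \<in> borel_measurable (borel \<Otimes>\<^sub>M borel)"
  shows "(\<integral>\<^sup>+z. f ((\<Sum>i=1..n. z i) / sqrt (real n), sum_sq_dev n z) \<partial>std_normals {1..n}) =
    (\<integral>\<^sup>+w. \<integral>\<^sup>+y. f (y, \<Sum>i=1..n-1. (w i)\<^sup>2) \<partial>centered_normal 1 \<partial>std_normals {1..n-1})"
proof -
  interpret std_normals: product_sigma_finite "\<lambda>_::nat. centered_normal 1"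
    by (rule product_sigma_finite_std_normal)
  show ?thesis
    using assms
  proof (induction n arbitrary: f rule: nat_induct_non_zero)
    case 1
    note [measurable] = 1
    have "(\<integral>\<^sup>+z. f (z 1, 0) \<partial>std_normals {1}) = (\<integral>\<^sup>+y. f (y, 0) \<partial>centered_normal 1)"
      by (rule std_normals.product_nn_integral_singleton) measurable
    then show ?case
      by (simp add: sum_sq_dev_def nn_integral_empty PiM_empty nn_integral_count_space_finite)
  next
    case (Suc n)
    note [measurable] = Suc.prems
    let ?N = "centered_normal 1"
    define a b where "a = sqrt (real n / real (Suc n))" and "b = 1 / sqrt (real (Suc n))"
    have n: "real n > 0" using Suc.hyps by simp
    have ab: "a\<^sup>2 + b\<^sup>2 = 1" "a \<noteq> 0"
      using n by (auto simp: a_def b_def power_divide field_simps)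
    note [measurable] = sum_component_measurable[OF order_refl] sum_sq_dev_measurable[OF order_refl]
    have ins: "{1..Suc n} = insert (Suc n) {1..n}" by auto
    \<comment> \<open>Here \<open>y\<close> stands for the normalised sum of the first
      \<open>n\<close> points, \<open>s\<close> for their squared deviations and \<open>x\<close>
      for the new point: \<open>a * y + b * x\<close> is the new normalised sum and
      \<open>b * y - a * x\<close> the contrast.\<close>
    let ?g = "\<lambda>x (y, s). f (a * y + b * x, s + (b * y - a * x)\<^sup>2)"
    have a': "a = sqrt (real n) / sqrt (real (Suc n))" by (simp add: a_def real_sqrt_divide)
    have eq: "f ((\<Sum>i=1..Suc n. (z(Suc n := x)) i) / sqrt (real (Suc n)), sum_sq_dev (Suc n) (z(Suc n := x))) =
        ?g x ((\<Sum>i=1..n. z i) / sqrt (real n), sum_sq_dev n z)" for z x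
    proof -
      have s: "(\<Sum>i=1..n. (z(Suc n := x)) i) = (\<Sum>i=1..n. z i)" by (intro sum.cong) auto
      have ss: "sum_sq_dev n (z(Suc n := x)) = sum_sq_dev n z"
        unfolding sum_sq_dev_def s by (intro sum.cong) auto
      have "((\<Sum>i=1..n. z i) + x) / sqrt (real (Suc n)) = a * ((\<Sum>i=1..n. z i) / sqrt (real n)) + b * x"
        unfolding a' b_def using n by (simp add: add_divide_distrib)
      moreover have "((\<Sum>i=1..n. z i) / sqrt (real n) - sqrt (real n) * x) / sqrt (real (Suc n)) =
          b * ((\<Sum>i=1..n. z i) / sqrt (real n)) - a * x"
        unfolding a' b_def using n by (simp add: diff_divide_distrib)
      ultimately show ?thesis
        using n by (simp add: sum_sq_dev_Suc s ss)
    qed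
    have "(\<integral>\<^sup>+z. f ((\<Sum>i=1..Suc n. z i) / sqrt (real (Suc n)), sum_sq_dev (Suc n) z) \<partial>std_normals {1..Suc n}) =
      (\<integral>\<^sup>+x. \<integral>\<^sup>+z. f ((\<Sum>i=1..Suc n. (z(Suc n := x)) i) / sqrt (real (Suc n)), sum_sq_dev (Suc n) (z(Suc n := x))) \<partial>std_normals {1..n} \<partial>?N)"
      unfolding ins
    proof (rule std_normals.product_nn_integral_insert_rev)
      show "(\<lambda>z. f ((\<Sum>i\<in>insert (Suc n) {1..n}. z i) / sqrt (real (Suc n)), sum_sq_dev (Suc n) z)) \<in> borel_measurable (std_normals (insert (Suc n) {1..n}))"
        unfolding ins[symmetric] by measurable
    qed auto
    also have "\<dots> = (\<integral>\<^sup>+x. \<integral>\<^sup>+z. ?g x ((\<Sum>i=1..n. z i) / sqrt (real n), sum_sq_dev n z) \<partial>std_normals {1..n} \<partial>?N)"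
      unfolding eq ..
    also have "\<dots> = (\<integral>\<^sup>+x. \<integral>\<^sup>+w. \<integral>\<^sup>+y. ?g x (y, \<Sum>i=1..n-1. (w i)\<^sup>2) \<partial>?N \<partial>std_normals {1..n-1} \<partial>?N)"
      by (intro nn_integral_cong Suc.IH) measurable
    \<comment> \<open>The integral over the new point is moved inside the one over \<open>w\<close>,
      so that the planar map acts on \<open>y\<close> and \<open>x\<close> for fixed
      \<open>w\<close>.\<close>
    also have "\<dots> = (\<integral>\<^sup>+w. \<integral>\<^sup>+x. \<integral>\<^sup>+y. ?g x (y, \<Sum>i=1..n-1. (w i)\<^sup>2) \<partial>?N \<partial>?N \<partial>std_normals {1..n-1})"
    proof -
      have S: "sigma_finite_measure (std_normals {1..n-1})" "sigma_finite_measure ?N"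
        by (auto intro: std_normals.sigma_finite std_normals.sigma_finite_measures)
      interpret P: pair_sigma_finite "std_normals {1..n-1}" ?N
        using S by (simp add: pair_sigma_finite_def)
      show ?thesis
        by (rule P.Fubini') measurable
    qed
    also have "\<dots> = (\<integral>\<^sup>+w. \<integral>\<^sup>+x. \<integral>\<^sup>+y. f (y, (\<Sum>i=1..n-1. (w i)\<^sup>2) + x\<^sup>2) \<partial>?N \<partial>?N \<partial>std_normals {1..n-1})"
    proof (rule nn_integral_cong)
      fix w
      have "(\<lambda>(y, x). f (y, (\<Sum>i=1..n-1. (w i)\<^sup>2) + x\<^sup>2)) \<in> borel_measurable (borel \<Otimes>\<^sub>M borel)" by measurable
      from std_normal_rotation_invariant[OF this ab]
      show "(\<integral>\<^sup>+x. \<integral>\<^sup>+y. ?g x (y, \<Sum>i=1..n-1. (w i)\<^sup>2) \<partial>?N \<partial>?N) = (\<integral>\<^sup>+x. \<integral>\<^sup>+y. f (y, (\<Sum>i=1..n-1. (w i)\<^sup>2) + x\<^sup>2) \<partial>?N \<partial>?N)"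
        by simp
    qed
    \<comment> \<open>The transformed contrast is again standard normal and becomes coordinate
      \<open>n\<close> of \<open>w\<close>, the additional square.\<close>
    also have "\<dots> = (\<integral>\<^sup>+w. \<integral>\<^sup>+x. \<integral>\<^sup>+y. f (y, \<Sum>i=1..n. ((w(n := x)) i)\<^sup>2) \<partial>?N \<partial>?N \<partial>std_normals {1..n-1})"
    proof -
      have "(\<Sum>i=1..n. ((w(n := x)) i)\<^sup>2) = (\<Sum>i=1..n-1. (w i)\<^sup>2) + x\<^sup>2" for w :: "nat \<Rightarrow> real" and x
      proof -
        have "{1..n} = insert n {1..n-1}" using Suc.hyps by auto
        moreover have "(\<Sum>i=1..n-1. ((w(n := x)) i)\<^sup>2) = (\<Sum>i=1..n-1. (w i)\<^sup>2)"
          using Suc.hyps by (intro sum.cong) auto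
        ultimately show ?thesis using Suc.hyps by simp
      qed
      then show ?thesis by simp
    qed
    also have "\<dots> = (\<integral>\<^sup>+w. \<integral>\<^sup>+y. f (y, \<Sum>i=1..n. (w i)\<^sup>2) \<partial>?N \<partial>std_normals (insert n {1..n-1}))"
      using Suc.hyps by (intro std_normals.product_nn_integral_insert[symmetric]) (auto, measurable, auto)
    also have "insert n {1..n-1} = {1..n}" using Suc.hyps by auto
    finally show ?case by simp
  qed
qed

section \<open>Student's distribution\<close>

lemma prob_space_std_normals: "prob_space (std_normals I)"
  using real_distribution_centered_normal[of 1]
  by (intro prob_space_PiM) (auto simp: real_distribution_def)

lemma space_std_normals: "space (std_normals I) = extensional I"
  by (simp add: space_PiM PiE_def)

text \<open>By Fubini with coordinate \<open>j\<close> innermost: once the other coordinates are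
  fixed, \<open>h\<close> is constant and the event confines \<open>z j\<close> to a single point,
  which is a null set for the normal law.\<close>

lemma emeasure_std_normals_graph:
  assumes I: "finite I" "j \<in> I" and h: "h \<in> borel_measurable (PiM I (\<lambda>_. borel))"
    and indep: "\<And>z y. h (z(j := y)) = h z"
  shows "emeasure (std_normals I) {z\<in>space (std_normals I). z j = h z} = 0"
proof -
  interpret product_sigma_finite "\<lambda>_::nat. centered_normal 1"
    by (rule product_sigma_finite_std_normal)
  have ins: "insert j (I - {j}) = I" using I by auto
  have zj: "(\<lambda>z. z j :: real) \<in> borel_measurable (PiM I (\<lambda>_. borel))"
    using I by (intro measurable_component_singleton)
  let ?A = "{z\<in>space (std_normals I). z j = h z}"
  have A: "?A \<in> sets (std_normals I)"
    using zj h by (intro measurable_equality_set) (simp_all add: measurable_cong_sets[OF sets_std_normals refl])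
  have "emeasure (std_normals I) ?A = (\<integral>\<^sup>+z. indicator ?A z \<partial>std_normals (insert j (I - {j})))"
    unfolding ins using A by simp
  also have "\<dots> = (\<integral>\<^sup>+x. \<integral>\<^sup>+y. indicator ?A (x(j := y)) \<partial>centered_normal 1 \<partial>std_normals (I - {j}))"
  proof (rule product_nn_integral_insert)
    show "indicator ?A \<in> borel_measurable (std_normals (insert j (I - {j})))"
      unfolding ins using A by simp
  qed (use I in auto)
  also have "\<dots> \<le> (\<integral>\<^sup>+x. \<integral>\<^sup>+y. indicator {h x} y \<partial>centered_normal 1 \<partial>std_normals (I - {j}))"
    by (intro nn_integral_mono) (auto simp: indicator_def indep)
  also have "\<dots> = 0" by simp
  finally show ?thesis by simp
qed

lemma nn_integral_centered_normal_uminus: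
  assumes [measurable]: "f \<in> borel_measurable borel"
  shows "(\<integral>\<^sup>+x. f (- x) \<partial>centered_normal \<sigma>) = (\<integral>\<^sup>+x. f x \<partial>centered_normal \<sigma>)"
proof -
  have "(\<integral>\<^sup>+x. f x \<partial>centered_normal \<sigma>) = (\<integral>\<^sup>+x. ennreal (normal_density 0 \<sigma> x) * f x \<partial>lborel)"
    by (rule nn_integral_centered_normal) simp
  also have "\<dots> = ennreal \<bar>-1\<bar> * (\<integral>\<^sup>+x. ennreal (normal_density 0 \<sigma> (0 + (-1) * x)) * f (0 + (-1) * x) \<partial>lborel)"
    by (rule nn_integral_real_affine) auto
  also have "\<dots> = (\<integral>\<^sup>+x. ennreal (normal_density 0 \<sigma> x) * f (- x) \<partial>lborel)"
    by (simp add: normal_density_def)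
  also have "\<dots> = (\<integral>\<^sup>+x. f (- x) \<partial>centered_normal \<sigma>)"
    by (rule nn_integral_centered_normal[symmetric]) simp
  finally show ?thesis ..
qed

lemma nn_integral_std_normals_sum_sq_dev:
  fixes f :: "real \<times> real \<Rightarrow> ennreal"
  assumes n: "n > 0" and f [measurable]: "f \<in> borel_measurable (borel \<Otimes>\<^sub>M borel)"
  shows "(\<integral>\<^sup>+z. f (z 0, sum_sq_dev n z) \<partial>std_normals {0..n}) = (\<integral>\<^sup>+z. f (z 0, \<Sum>i=1..n-1. (z i)\<^sup>2) \<partial>std_normals {0..n-1})"
proof -
  interpret product_sigma_finite "\<lambda>_::nat. centered_normal 1"
    by (rule product_sigma_finite_std_normal)
  have ins: "insert 0 {1..m} = {0..m}" for m :: nat by auto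
  have z0: "(\<lambda>z. z 0 :: real) \<in> borel_measurable (PiM {0..m} (\<lambda>_. borel))" for m :: nat
    by (intro measurable_component_singleton) auto
  have ss: "sum_sq_dev n \<in> borel_measurable (PiM {0..n} (\<lambda>_. borel))"
    by (rule sum_sq_dev_measurable) auto
  have sq: "(\<lambda>z. \<Sum>i=1..m. (z i :: real)\<^sup>2) \<in> borel_measurable (PiM {0..m} (\<lambda>_. borel))" for m :: nat
    by (intro borel_measurable_sum borel_measurable_power measurable_component_singleton) auto
  have "(\<integral>\<^sup>+z. f (z 0, sum_sq_dev n z) \<partial>std_normals (insert 0 {1..n})) =
    (\<integral>\<^sup>+x. \<integral>\<^sup>+z. f ((z(0 := x)) 0, sum_sq_dev n (z(0 := x))) \<partial>std_normals {1..n} \<partial>centered_normal 1)"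
  proof (rule product_nn_integral_insert_rev)
    note [measurable] = z0[of n] ss
    show "(\<lambda>z. f (z 0, sum_sq_dev n z)) \<in> borel_measurable (std_normals (insert 0 {1..n}))"
      unfolding ins by measurable
  qed auto
  also have "\<dots> = (\<integral>\<^sup>+x. \<integral>\<^sup>+z. f (x, sum_sq_dev n z) \<partial>std_normals {1..n} \<partial>centered_normal 1)"
  proof -
    have "sum_sq_dev n (z(0 := x)) = sum_sq_dev n z" for z x
    proof -
      have "(\<Sum>i=1..n. (z(0 := x)) i) = (\<Sum>i=1..n. z i)" by (intro sum.cong) auto
      then show ?thesis unfolding sum_sq_dev_def by (intro sum.cong) auto
    qed
    then show ?thesis by simp
  qed
  also have "\<dots> = (\<integral>\<^sup>+x. \<integral>\<^sup>+z. f (x, \<Sum>i=1..n-1. (z i)\<^sup>2) \<partial>std_normals {1..n-1} \<partial>centered_normal 1)"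
  proof (rule nn_integral_cong)
    fix x
    interpret N: prob_space "centered_normal 1"
      using real_distribution_centered_normal[of 1] by (simp add: real_distribution_def)
    \<comment> \<open>The integrand ignores the normalised sum, so in Helmert's identity that
      coordinate integrates to 1.\<close>
    have "(\<lambda>p. f (x, snd p)) \<in> borel_measurable (borel \<Otimes>\<^sub>M borel)" by measurable
    from nn_integral_std_normals_mean_sum_sq_dev[OF n this]
    show "(\<integral>\<^sup>+z. f (x, sum_sq_dev n z) \<partial>std_normals {1..n}) = (\<integral>\<^sup>+z. f (x, \<Sum>i=1..n-1. (z i)\<^sup>2) \<partial>std_normals {1..n-1})"
      by (simp add: N.emeasure_space_1[simplified])
  qed
  also have "\<dots> = (\<integral>\<^sup>+x. \<integral>\<^sup>+z. f ((z(0 := x)) 0, \<Sum>i=1..n-1. ((z(0 := x)) i)\<^sup>2) \<partial>std_normals {1..n-1} \<partial>centered_normal 1)"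
    by (intro nn_integral_cong arg_cong[where f=f]) auto
  also have "\<dots> = (\<integral>\<^sup>+z. f (z 0, \<Sum>i=1..n-1. (z i)\<^sup>2) \<partial>std_normals (insert 0 {1..n-1}))"
  proof (rule product_nn_integral_insert_rev[symmetric])
    note [measurable] = z0[of "n-1"] sq[of "n-1"]
    show "(\<lambda>z. f (z 0, \<Sum>i=1..n-1. (z i)\<^sup>2)) \<in> borel_measurable (std_normals (insert 0 {1..n-1}))"
      unfolding ins by measurable
  qed auto
  finally show ?thesis unfolding ins .
qed

section \<open>The law of the Student ratio: atoms, symmetry and quantiles\<close>

definition t_ratio :: "nat \<Rightarrow> (nat \<Rightarrow> real) \<Rightarrow> real" where
  "t_ratio k z = z 0 / sqrt ((\<Sum>i=1..k. (z i)\<^sup>2) / real k)"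

lemma student_t_eq: "student_t k = distr (std_normals {0..k}) borel (t_ratio k)"
  by (simp add: student_t_def t_ratio_def[abs_def])

lemma sum_sq_measurable: "(\<lambda>z. \<Sum>i=1..k. (z i :: real)\<^sup>2) \<in> borel_measurable (std_normals {0..k})"
  unfolding measurable_cong_sets[OF sets_std_normals refl]
  by (intro borel_measurable_sum borel_measurable_power measurable_component_singleton) auto

lemma component_0_measurable: "(\<lambda>z. z 0 :: real) \<in> borel_measurable (std_normals {0..k})"
  unfolding measurable_cong_sets[OF sets_std_normals refl]
  by (intro measurable_component_singleton) auto

lemma t_ratio_measurable [measurable]: "t_ratio k \<in> borel_measurable (std_normals {0..k})"
  unfolding t_ratio_def using sum_sq_measurable component_0_measurable by measurable

lemma real_distribution_student_t: "real_distribution (student_t k)"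
  unfolding student_t_eq by (rule prob_space.real_distribution_distr[OF prob_space_std_normals]) simp

text \<open>Excludes the event on which the denominator of \<open>t_ratio\<close> vanishes and the
  quotient is 0 by convention. The first square alone is almost surely positive.\<close>

lemma AE_std_normals_sum_sq_pos:
  assumes "k > 0"
  shows "AE z in std_normals {0..k}. (\<Sum>i=1..k. (z i)\<^sup>2) > 0"
proof (rule AE_I)
  show "emeasure (std_normals {0..k}) {z\<in>space (std_normals {0..k}). z 1 = (\<lambda>_. 0) z} = 0"
    using assms by (intro emeasure_std_normals_graph) auto
  show "{z\<in>space (std_normals {0..k}). z 1 = (\<lambda>_. 0) z} \<in> sets (std_normals {0..k})"
  proof -
    have "(\<lambda>z. z 1 :: real) \<in> borel_measurable (std_normals {0..k})"
      unfolding measurable_cong_sets[OF sets_std_normals refl]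
      using assms by (intro measurable_component_singleton) auto
    then show ?thesis by measurable
  qed
  have "(\<Sum>i=1..k. (z i)\<^sup>2) > 0" if "z 1 \<noteq> 0" for z :: "nat \<Rightarrow> real"
    using assms that by (intro sum_pos2[where i=1]) auto
  then show "{z \<in> space (std_normals {0..k}). \<not> 0 < (\<Sum>i = 1..k. (z i)\<^sup>2)} \<subseteq> {z\<in>space (std_normals {0..k}). z 1 = (\<lambda>_. 0) z}"
    by blast
qed

text \<open>After clearing the almost surely positive denominator, the event is the graph of a
  function of the coordinates other than 0.\<close>

lemma measure_student_t_singleton:
  assumes k: "k > 0"
  shows "measure (student_t k) {c} = 0"
proof -
  let ?h = "\<lambda>z. c * sqrt ((\<Sum>i=1..k. (z i)\<^sup>2) / real k)"
  have "emeasure (std_normals {0..k}) {z\<in>space (std_normals {0..k}). z 0 = ?h z} = 0"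
  proof (rule emeasure_std_normals_graph)
    show "?h \<in> borel_measurable (PiM {0..k} (\<lambda>_. borel))"
      using sum_sq_measurable[of k] unfolding measurable_cong_sets[OF sets_std_normals refl] by measurable
    show "?h (z(0 := y)) = ?h z" for z y
      by (intro arg_cong[where f="\<lambda>s. c * sqrt (s / real k)"] sum.cong) auto
  qed auto
  moreover have "{z\<in>space (std_normals {0..k}). z 0 = ?h z} \<in> sets (std_normals {0..k})"
    using sum_sq_measurable[of k] component_0_measurable[of k] by measurable
  ultimately have "AE z in std_normals {0..k}. z 0 \<noteq> ?h z"
    using AE_iff_measurable[of "{z\<in>space (std_normals {0..k}). z 0 = ?h z}" _ "\<lambda>z. z 0 \<noteq> ?h z"] by simp
  with AE_std_normals_sum_sq_pos[OF k]
  have "AE z in std_normals {0..k}. t_ratio k z \<noteq> c"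
  proof eventually_elim
    case (elim z)
    then have "sqrt ((\<Sum>i=1..k. (z i)\<^sup>2) / real k) > 0" using k by simp
    then have "t_ratio k z = c \<longleftrightarrow> z 0 = ?h z"
      unfolding t_ratio_def by (simp only: divide_eq_eq) auto
    then show ?case using elim by blast
  qed
  then have "emeasure (std_normals {0..k}) {z\<in>space (std_normals {0..k}). t_ratio k z = c} = 0"
  proof -
    have "{z\<in>space (std_normals {0..k}). t_ratio k z = c} \<in> sets (std_normals {0..k})" by measurable
    then show ?thesis
      using \<open>AE z in std_normals {0..k}. t_ratio k z \<noteq> c\<close>
        AE_iff_measurable[of "{z\<in>space (std_normals {0..k}). t_ratio k z = c}" _ "\<lambda>z. t_ratio k z \<noteq> c"] by simp
  qed
  moreover have "t_ratio k -` {c} \<inter> space (std_normals {0..k}) = {z\<in>space (std_normals {0..k}). t_ratio k z = c}"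
    by auto
  ultimately show ?thesis
    unfolding student_t_eq by (subst measure_distr) (simp_all add: measure_def)
qed

text \<open>The denominator does not involve coordinate 0, and the law of that coordinate is
  symmetric.\<close>

lemma distr_student_t_uminus: "distr (student_t k) borel uminus = student_t k"
proof (rule measure_eqI)
  fix A assume "A \<in> sets (distr (student_t k) borel uminus)"
  then have A [measurable]: "A \<in> sets borel" by simp
  interpret product_sigma_finite "\<lambda>_::nat. centered_normal 1"
    by (rule product_sigma_finite_std_normal)
  have ins: "insert 0 {1..k} = {0..k}" by auto
  define s where "s z = sqrt ((\<Sum>i=1..k. (z i)\<^sup>2) / real k)" for z :: "nat \<Rightarrow> real"
  have s0: "s (z(0 := y)) = s z" for z y
    unfolding s_def by (intro arg_cong[where f="\<lambda>s. sqrt (s / real k)"] sum.cong) auto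
  have *: "(\<integral>\<^sup>+z. indicator A (c * t_ratio k z) \<partial>std_normals {0..k}) =
     (\<integral>\<^sup>+z. \<integral>\<^sup>+y. indicator A (c * (y / s z)) \<partial>centered_normal 1 \<partial>std_normals {1..k})" for c
  proof -
    have "(\<integral>\<^sup>+z. indicator A (c * t_ratio k z) \<partial>std_normals (insert 0 {1..k})) =
     (\<integral>\<^sup>+z. \<integral>\<^sup>+y. indicator A (c * t_ratio k (z(0 := y))) \<partial>centered_normal 1 \<partial>std_normals {1..k})"
    proof (rule product_nn_integral_insert)
      show "(\<lambda>z. indicator A (c * t_ratio k z)) \<in> borel_measurable (std_normals (insert 0 {1..k}))"
        unfolding ins by measurable
    qed auto
    then show ?thesis unfolding ins t_ratio_def s_def[symmetric] s0 by simp
  qed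
  have "emeasure (distr (student_t k) borel uminus) A = (\<integral>\<^sup>+x. indicator A x \<partial>distr (student_t k) borel uminus)"
    by simp
  also have "\<dots> = (\<integral>\<^sup>+z. indicator A ((-1) * t_ratio k z) \<partial>std_normals {0..k})"
    unfolding student_t_eq by (subst nn_integral_distr; (subst nn_integral_distr)?; simp)
  also have "\<dots> = (\<integral>\<^sup>+z. \<integral>\<^sup>+y. indicator A ((-1) * (y / s z)) \<partial>centered_normal 1 \<partial>std_normals {1..k})"
    by (rule *)
  also have "\<dots> = (\<integral>\<^sup>+z. \<integral>\<^sup>+y. indicator A (1 * (y / s z)) \<partial>centered_normal 1 \<partial>std_normals {1..k})"
  proof (rule nn_integral_cong)
    fix z
    show "(\<integral>\<^sup>+y. indicator A ((-1) * (y / s z)) \<partial>centered_normal 1) = (\<integral>\<^sup>+y. indicator A (1 * (y / s z)) \<partial>centered_normal 1)"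
      using nn_integral_centered_normal_uminus[of "\<lambda>y. indicator A (y / s z)" 1] by simp
  qed
  also have "\<dots> = (\<integral>\<^sup>+z. indicator A (1 * t_ratio k z) \<partial>std_normals {0..k})"
    by (rule *[symmetric])
  also have "\<dots> = (\<integral>\<^sup>+x. indicator A x \<partial>student_t k)"
    unfolding student_t_eq by (subst nn_integral_distr) auto
  also have "\<dots> = emeasure (student_t k) A"
    by (rule nn_integral_indicator) (simp add: student_t_def)
  finally show "emeasure (distr (student_t k) borel uminus) A = emeasure (student_t k) A" .
qed (simp add: student_t_def)

text \<open>Without atoms the cdf is continuous, so the infimum defining the quantile is attained
  and the cdf equals \<open>p\<close> there. By symmetry the mass left of the negative quantile is
  \<open>1 - p\<close>, and \<open>p > 1/2\<close> puts the quantile to the right of the centre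
  0.\<close>

lemma quantile_symmetric_distribution:
  assumes D: "real_distribution D" and atoms: "\<And>x. measure D {x} = 0"
    and sym: "distr D borel uminus = D" and p: "1/2 < p" "p < 1"
  shows "quantile D p > 0" "measure D {- quantile D p..quantile D p} = 2 * p - 1"
proof -
  interpret D: real_distribution D by fact
  have cont: "isCont (cdf D) x" for x using atoms by (simp add: D.isCont_cdf)
  have refl: "cdf D (- x) = 1 - cdf D x" for x
  proof -
    have "cdf D (- x) = measure (distr D borel uminus) {..- x}" by (simp add: sym cdf_def)
    also have "\<dots> = measure D {x..}"
    proof -
      have "uminus -` {..- x} = {x..}" by auto
      then show ?thesis by (subst measure_distr) auto
    qed
    also have "\<dots> = measure D ({x} \<union> {x<..})" by (intro arg_cong[where f="measure D"]) auto
    also have "\<dots> = measure D {x<..}" using atoms by (subst D.finite_measure_Union) auto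
    also have "{x<..} = space D - {..x}" by auto
    also have "measure D \<dots> = 1 - cdf D x" by (subst D.prob_compl) (auto simp: cdf_def)
    finally show ?thesis .
  qed
  let ?S = "{x. p \<le> cdf D x}"
  have "\<forall>\<^sub>F x in at_top. cdf D x > p"
    using D.cdf_lim_at_top_prob p(2) by (rule order_tendstoD)
  then obtain x1 where "p \<le> cdf D x1" by (auto simp: eventually_at_top_linorder intro: less_imp_le)
  then have ne: "?S \<noteq> {}" by auto
  have half: "cdf D 0 = 1/2" using refl[of 0] by simp
  have pos: "x > 0" if "x \<in> ?S" for x
  proof (rule ccontr)
    assume "\<not> x > 0"
    then have "cdf D x \<le> cdf D 0" by (intro D.cdf_nondecreasing) simp
    then show False using that half p by auto
  qed
  then have bdd: "bdd_below ?S" by (intro bdd_belowI[of _ 0]) (auto intro: less_imp_le)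
  have "closed ?S" using cont
    by (intro closed_Collect_le continuous_at_imp_continuous_on continuous_on_const) auto
  then have mem: "quantile D p \<in> ?S"
    unfolding quantile_def by (intro closed_contains_Inf ne bdd)
  show q: "quantile D p > 0" by (rule pos[OF mem])
  have "cdf D (quantile D p) \<le> p"
  proof (rule tendsto_upperbound)
    show "(cdf D \<longlongrightarrow> cdf D (quantile D p)) (at_left (quantile D p))"
      using cont[of "quantile D p"] by (auto simp: isCont_def filterlim_at_split)
    have "cdf D x \<le> p" if "x < quantile D p" for x
      using that cInf_lower[OF _ bdd, of x] unfolding quantile_def by (fastforce simp: not_le[symmetric])
    then show "\<forall>\<^sub>F x in at_left (quantile D p). cdf D x \<le> p"
      by (auto simp: eventually_at_filter)
  qed simp
  with mem have c: "cdf D (quantile D p) = p" by auto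
  have "{- quantile D p..quantile D p} = {- quantile D p} \<union> {- quantile D p<..quantile D p}" using q by auto
  then have "measure D {- quantile D p..quantile D p} = measure D {- quantile D p<..quantile D p}"
    using atoms D.finite_measure_Union[of "{- quantile D p}" "{- quantile D p<..quantile D p}"] by simp
  also have "\<dots> = cdf D (quantile D p) - cdf D (- quantile D p)"
    using q by (intro D.cdf_diff_eq[symmetric]) simp
  finally show "measure D {- quantile D p..quantile D p} = 2 * p - 1"
    by (simp add: refl c)
qed

text \<open>Helmert's identity turns squared deviations of \<open>n\<close> points into
  \<open>n - 1\<close> independent squares, hence the loss of one degree of freedom. Ties are null
  by the graph lemma, so the two strict inequalities exhaust the mass, which is what the portmanteau
  argument asks of its two open sets.\<close>

lemma measure_std_normals_student_t:
  assumes n: "n \<ge> 2" and c: "c \<ge> 0"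
  defines "G \<equiv> std_normals {0..n}" and "sd \<equiv> \<lambda>z. sqrt (sum_sq_dev n z / (real n - 1))"
  shows "measure G {z\<in>space G. \<bar>z 0\<bar> < c * sd z} = measure (student_t (n - 1)) {-c..c}"
    and "measure G {z\<in>space G. \<bar>z 0\<bar> > c * sd z} = 1 - measure (student_t (n - 1)) {-c..c}"
proof -
  interpret G: prob_space G unfolding G_def by (rule prob_space_std_normals)
  let ?H = "std_normals {0..n-1}"
  have ss: "sum_sq_dev n \<in> borel_measurable (PiM {0..n} (\<lambda>_. borel))"
    by (rule sum_sq_dev_measurable) auto
  have sdm': "sd \<in> borel_measurable (PiM {0..n} (\<lambda>_. borel))" using ss unfolding sd_def by measurable
  have sdm [measurable]: "sd \<in> borel_measurable G" and z0m [measurable]: "(\<lambda>z. z 0) \<in> borel_measurable G"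
    using sdm' component_0_measurable[of n]
    by (simp_all add: G_def measurable_cong_sets[OF sets_std_normals refl])
  have sd0: "sd (z(0 := y)) = sd z" for z y
  proof -
    have "(\<Sum>i=1..n. (z(0 := y)) i) = (\<Sum>i=1..n. z i)" by (intro sum.cong) auto
    then have "sum_sq_dev n (z(0 := y)) = sum_sq_dev n z"
      unfolding sum_sq_dev_def by (intro sum.cong) auto
    then show ?thesis by (simp add: sd_def)
  qed
  have ne: "AE z in G. z 0 \<noteq> d * sd z" for d
  proof -
    have "emeasure G {z\<in>space G. z 0 = d * sd z} = 0"
      unfolding G_def using sdm' by (intro emeasure_std_normals_graph) (auto simp: sd0)
    then show ?thesis by (simp add: AE_iff_measurable[where N="{z\<in>space G. z 0 = d * sd z}"])
  qed
  have nn: "AE z in G. \<bar>z 0\<bar> \<noteq> c * sd z"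
    using ne[of c] ne[of "-c"] by eventually_elim auto
  have "emeasure G {z\<in>space G. \<bar>z 0\<bar> \<le> c * sd z} = (\<integral>\<^sup>+z. indicator {z\<in>space G. \<bar>z 0\<bar> \<le> c * sd z} z \<partial>G)"
    by simp
  also have "\<dots> = (\<integral>\<^sup>+z. indicator {p. \<bar>fst p\<bar> \<le> c * sqrt (snd p / (real n - 1))} (z 0, sum_sq_dev n z) \<partial>G)"
    by (intro nn_integral_cong) (auto simp: indicator_def sd_def)
  also have "\<dots> = (\<integral>\<^sup>+z. indicator {p. \<bar>fst p\<bar> \<le> c * sqrt (snd p / (real n - 1))} (z 0, \<Sum>i=1..n-1. (z i)\<^sup>2) \<partial>?H)"
    unfolding G_def
  proof (rule nn_integral_std_normals_sum_sq_dev)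
    show "indicator {p. \<bar>fst p\<bar> \<le> c * sqrt (snd p / (real n - 1))} \<in> borel_measurable (borel \<Otimes>\<^sub>M borel)"
    proof (rule borel_measurable_indicator)
      have "{p \<in> space (borel \<Otimes>\<^sub>M borel). \<bar>fst p\<bar> \<le> c * sqrt (snd p / (real n - 1))} \<in> sets (borel \<Otimes>\<^sub>M borel)"
        by measurable
      then show "{p. \<bar>fst p\<bar> \<le> c * sqrt (snd p / (real n - 1))} \<in> sets (borel \<Otimes>\<^sub>M borel)"
        by (simp add: space_pair_measure)
    qed
  qed (use n in auto)
  \<comment> \<open>Where all the squares vanish, the convention for division by 0 would put the
    ratio inside the interval. The two indicators thus agree only almost everywhere.\<close>
  also have "\<dots> = (\<integral>\<^sup>+z. indicator {-c..c} (t_ratio (n-1) z) \<partial>?H)"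
  proof (rule nn_integral_cong_AE)
    have "AE z in ?H. (\<Sum>i=1..n-1. (z i)\<^sup>2) > 0"
      using n by (intro AE_std_normals_sum_sq_pos) auto
    then show "AE z in ?H. indicator {p. \<bar>fst p\<bar> \<le> c * sqrt (snd p / (real n - 1))} (z 0, \<Sum>i=1..n-1. (z i)\<^sup>2) =
       (indicator {-c..c} (t_ratio (n-1) z) :: ennreal)"
    proof eventually_elim
      case (elim z)
      define s where "s = sqrt ((\<Sum>i=1..n-1. (z i)\<^sup>2) / (real n - 1))"
      have s: "s > 0" using elim n by (simp add: s_def)
      have t: "t_ratio (n-1) z = z 0 / s" using n by (simp add: t_ratio_def s_def of_nat_diff)
      have "\<bar>z 0\<bar> \<le> c * s \<longleftrightarrow> z 0 / s \<in> {-c..c}"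
        using s by (auto simp: abs_le_iff field_simps)
      then show ?case unfolding t s_def[symmetric] by (auto simp: indicator_def s_def)
    qed
  qed
  also have "\<dots> = emeasure (student_t (n - 1)) {-c..c}"
  proof -
    have "emeasure (student_t (n - 1)) {-c..c} = (\<integral>\<^sup>+x. indicator {-c..c} x \<partial>student_t (n - 1))"
      by (rule nn_integral_indicator[symmetric]) (simp add: student_t_def)
    then show ?thesis unfolding student_t_eq by (subst (asm) nn_integral_distr) auto
  qed
  finally have le: "measure G {z\<in>space G. \<bar>z 0\<bar> \<le> c * sd z} = measure (student_t (n - 1)) {-c..c}"
    by (simp add: measure_def)
  have "measure G {z\<in>space G. \<bar>z 0\<bar> < c * sd z} = measure G {z\<in>space G. \<bar>z 0\<bar> \<le> c * sd z}"
    using nn by (intro G.finite_measure_eq_AE) auto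
  then show "measure G {z\<in>space G. \<bar>z 0\<bar> < c * sd z} = measure (student_t (n - 1)) {-c..c}"
    using le by simp
  have "{z\<in>space G. \<bar>z 0\<bar> > c * sd z} = space G - {z\<in>space G. \<bar>z 0\<bar> \<le> c * sd z}" by auto
  then show "measure G {z\<in>space G. \<bar>z 0\<bar> > c * sd z} = 1 - measure (student_t (n - 1)) {-c..c}"
    using le by (simp, subst G.prob_compl) auto
qed

section \<open>Convergence of characteristic functions in probability\<close>

text \<open>A compactness form of Levy's continuity theorem. Convergence in probability of a random
  cdf controls only finitely many points at a time, so closeness of characteristic functions at
  \<open>t\<close> has to follow from finitely many points and one tolerance, uniformly in the
  approximating law.\<close>

lemma char_close_of_cdf_close:
  assumes \<nu>: "real_distribution \<nu>" and atoms: "\<And>x. measure \<nu> {x} = 0" and \<epsilon>: "\<epsilon> > 0"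
  shows "\<exists>S \<delta>. finite S \<and> \<delta> > 0 \<and> (\<forall>\<mu>. real_distribution \<mu> \<longrightarrow> (\<forall>x\<in>S. \<bar>cdf \<mu> x - cdf \<nu> x\<bar> < \<delta>) \<longrightarrow> cmod (char \<mu> t - char \<nu> t) < \<epsilon>)"
proof (rule ccontr)
  assume neg: "\<not> ?thesis"
  have no: "\<exists>\<mu>. real_distribution \<mu> \<and> (\<forall>x\<in>S. \<bar>cdf \<mu> x - cdf \<nu> x\<bar> < \<delta>) \<and> \<not> cmod (char \<mu> t - char \<nu> t) < \<epsilon>"
    if "finite S" "\<delta> > 0" for S \<delta>
    using neg that by blast
  interpret \<nu>: real_distribution \<nu> by fact
  define r where "r = from_nat_into (\<rat> :: real set)"
  have r: "range r = \<rat>" unfolding r_def by (rule range_from_nat_into) (auto simp: countable_rat Rats_0 intro: exI[of _ 0])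
  \<comment> \<open>Counterexamples for the first \<open>m + 1\<close> rationals and tolerance
    \<open>1 / (m + 1)\<close> form a sequence whose cdfs converge at every rational.\<close>
  have "\<forall>m. \<exists>\<mu>. real_distribution \<mu> \<and> (\<forall>x\<in>r ` {..m}. \<bar>cdf \<mu> x - cdf \<nu> x\<bar> < 1 / real (Suc m)) \<and> \<not> cmod (char \<mu> t - char \<nu> t) < \<epsilon>"
  proof
    fix m
    show "\<exists>\<mu>. real_distribution \<mu> \<and> (\<forall>x\<in>r ` {..m}. \<bar>cdf \<mu> x - cdf \<nu> x\<bar> < 1 / real (Suc m)) \<and> \<not> cmod (char \<mu> t - char \<nu> t) < \<epsilon>"
      by (rule no) auto
  qed
  then obtain \<mu> where "\<forall>m. real_distribution (\<mu> m) \<and> (\<forall>x\<in>r ` {..m}. \<bar>cdf (\<mu> m) x - cdf \<nu> x\<bar> < 1 / real (Suc m)) \<and> \<not> cmod (char (\<mu> m) t - char \<nu> t) < \<epsilon>"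
    by (rule choice[THEN exE])
  then have \<mu>: "\<And>m. real_distribution (\<mu> m)" and cl: "\<And>m k. k \<le> m \<Longrightarrow> \<bar>cdf (\<mu> m) (r k) - cdf \<nu> (r k)\<bar> < 1 / real (Suc m)"
    and far: "\<And>m. \<not> cmod (char (\<mu> m) t - char \<nu> t) < \<epsilon>" by auto
  have mono: "x \<le> y \<Longrightarrow> cdf (\<mu> m) x \<le> cdf (\<mu> m) y" for m x y
    using \<mu>[of m] by (simp add: real_distribution.finite_borel_measure_M finite_borel_measure.cdf_nondecreasing)
  have Q: "(\<lambda>m. cdf (\<mu> m) q) \<longlonglongrightarrow> cdf \<nu> q" if "q \<in> \<rat>" for q
  proof -
    obtain k where k: "q = r k" using r \<open>q \<in> \<rat>\<close> by blast
    have "(\<lambda>m. cdf (\<mu> m) q - cdf \<nu> q) \<longlonglongrightarrow> 0"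
    proof (rule Lim_null_comparison)
      show "\<forall>\<^sub>F m in sequentially. norm (cdf (\<mu> m) q - cdf \<nu> q) \<le> 1 / real (Suc m)"
        using eventually_ge_at_top[of k] unfolding k by eventually_elim (auto dest: cl)
      show "(\<lambda>m. 1 / real (Suc m)) \<longlonglongrightarrow> 0" using LIMSEQ_inverse_real_of_nat by (simp add: inverse_eq_divide)
    qed
    then show ?thesis by (simp add: LIM_zero_iff)
  qed
  have "(\<lambda>m. cdf (\<mu> m) x) \<longlonglongrightarrow> cdf \<nu> x" for x
  proof (rule tendstoI)
    fix e :: real assume e: "e > 0"
    have "isCont (cdf \<nu>) x" using atoms by (simp add: \<nu>.isCont_cdf)
    then obtain d where d: "d > 0" "\<And>y. \<bar>y - x\<bar> < d \<Longrightarrow> \<bar>cdf \<nu> y - cdf \<nu> x\<bar> < e / 2"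
      using e unfolding continuous_at_eps_delta dist_real_def by (meson half_gt_zero)
    \<comment> \<open>The monotone cdfs at \<open>x\<close> are squeezed between their values at
      rationals on both sides of \<open>x\<close>, where the continuous limit is nearly
      constant.\<close>
    obtain p where p: "p \<in> \<rat>" "x - d < p" "p < x" using Rats_dense_in_real[of "x - d" x] d(1) by auto
    obtain q where q: "q \<in> \<rat>" "x < q" "q < x + d" using Rats_dense_in_real[of x "x + d"] d(1) by auto
    have "\<forall>\<^sub>F m in sequentially. dist (cdf (\<mu> m) p) (cdf \<nu> p) < e / 2"
      using Q[OF p(1)] e by (intro tendstoD) auto
    moreover have "\<forall>\<^sub>F m in sequentially. dist (cdf (\<mu> m) q) (cdf \<nu> q) < e / 2"
      using Q[OF q(1)] e by (intro tendstoD) auto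
    ultimately show "\<forall>\<^sub>F m in sequentially. dist (cdf (\<mu> m) x) (cdf \<nu> x) < e"
    proof eventually_elim
      case (elim m)
      have "cdf (\<mu> m) p \<le> cdf (\<mu> m) x" "cdf (\<mu> m) x \<le> cdf (\<mu> m) q" using p q by (auto intro: mono)
      moreover have "\<bar>cdf \<nu> p - cdf \<nu> x\<bar> < e / 2" "\<bar>cdf \<nu> q - cdf \<nu> x\<bar> < e / 2" 
        using d(2)[of p] d(2)[of q] p q by auto
      ultimately show ?case using elim unfolding dist_real_def by linarith
    qed
  qed
  then have "weak_conv_m \<mu> \<nu>" by (simp add: weak_conv_m_def weak_conv_def)
  from levy_continuity1[OF \<mu> \<nu> this, of t]
  have "\<forall>\<^sub>F m in sequentially. cmod (char (\<mu> m) t - char \<nu> t) < \<epsilon>"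
    using \<epsilon> by (auto dest: tendstoD simp: dist_norm)
  then show False using far by (auto simp: eventually_sequentially)
qed

section \<open>Quantitative bounds for characteristic functions of averaged runs\<close>

lemma one_minus_exp_bound:
  fixes x :: real
  assumes "x \<ge> 0"
  shows "\<bar>exp (- x) - (1 - x)\<bar> \<le> x\<^sup>2 / 2"
proof -
  have "1 \<le> (1 - x + x\<^sup>2 / 2) * (1 + x + x\<^sup>2 / 2)"
  proof -
    have "(1 - x + x\<^sup>2 / 2) * (1 + x + x\<^sup>2 / 2) = 1 + (x\<^sup>2)\<^sup>2 / 4"
      by (simp add: power2_eq_square algebra_simps)
    then show ?thesis by simp
  qed
  also have "\<dots> \<le> (1 - x + x\<^sup>2 / 2) * exp x"
  proof (rule mult_left_mono)
    show "1 + x + x\<^sup>2 / 2 \<le> exp x" by (rule exp_lower_Taylor_quadratic[OF assms])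
    have eq: "1 - x + x\<^sup>2 / 2 = ((x - 1)\<^sup>2 + 1) / 2" by (simp add: power2_eq_square field_simps)
    show "0 \<le> 1 - x + x\<^sup>2 / 2" unfolding eq by simp
  qed
  finally have "exp (- x) \<le> 1 - x + x\<^sup>2 / 2" by (simp add: exp_minus field_simps)
  moreover have "1 - x \<le> exp (- x)" using exp_ge_add_one_self[of "- x"] by simp
  ultimately show ?thesis by simp
qed

text \<open>The term with \<open>K / 6\<close> is the third-order Taylor remainder of the centred
  characteristic function around \<open>1 - s^2 * V / 2\<close>; the other term is the error of
  replacing this polynomial by its exponential.\<close>

lemma centered_char_bound:
  assumes \<mu>: "real_distribution \<mu>" and m: "integrable \<mu> (\<lambda>y. y)" "(\<integral>y. y \<partial>\<mu>) = m"
    and V: "(\<integral>\<^sup>+y. ennreal ((y - m)\<^sup>2) \<partial>\<mu>) = ennreal V" "V \<ge> 0"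
    and K: "(\<integral>\<^sup>+y. ennreal (\<bar>y - m\<bar> ^ 3) \<partial>\<mu>) = ennreal K" "K \<ge> 0"
  shows "cmod (iexp (- s * m) * char \<mu> s - complex_of_real (exp (- (s\<^sup>2 * V / 2)))) \<le> \<bar>s\<bar> ^ 3 * K / 6 + s ^ 4 * V\<^sup>2 / 8"
proof -
  interpret real_distribution \<mu> by fact
  have i2: "integrable \<mu> (\<lambda>y. (y - m)\<^sup>2)"
    using V by (intro integrableI_nonneg) auto
  have v2: "(\<integral>y. (y - m)\<^sup>2 \<partial>\<mu>) = V"
    using V by (subst integral_eq_nn_integral) auto
  have i3: "integrable \<mu> (\<lambda>y. \<bar>y - m\<bar> ^ 3)"
    using K by (intro integrableI_nonneg) auto
  have k3: "(\<integral>y. \<bar>y - m\<bar> ^ 3 \<partial>\<mu>) = K"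
    using K by (subst integral_eq_nn_integral) auto
  have m1: "integrable \<mu> (\<lambda>y. y - m)" and m0: "expectation (\<lambda>y. y - m) = 0"
    using m by (auto simp: prob_space simp del: space_eq_univ)
  have c: "char (distr \<mu> borel (\<lambda>y. y - m)) s = iexp (- s * m) * char \<mu> s"
  proof -
    have "char (distr \<mu> borel (\<lambda>y. y - m)) s = (\<integral>y. iexp (s * (y - m)) \<partial>\<mu>)"
      unfolding char_def by (rule integral_distr) auto
    also have "\<dots> = (\<integral>y. iexp (- s * m) * iexp (s * y) \<partial>\<mu>)"
      by (intro Bochner_Integration.integral_cong) (auto simp: exp_add[symmetric] algebra_simps)
    finally show ?thesis by (simp add: char_def)
  qed
  have "cmod (char (distr \<mu> borel (\<lambda>y. y - m)) s - (1 - s\<^sup>2 * V / 2)) \<le>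
     s\<^sup>2 / 6 * expectation (\<lambda>y. min (6 * (y - m)\<^sup>2) (\<bar>s\<bar> * \<bar>y - m\<bar> ^ 3))"
    by (rule char_approx3'[OF _ m1 i2 m0 _ refl]) (simp_all add: m0 v2)
  also have "\<dots> \<le> s\<^sup>2 / 6 * expectation (\<lambda>y. \<bar>s\<bar> * \<bar>y - m\<bar> ^ 3)"
    using i2 i3 by (intro mult_left_mono integral_mono integrable_min) auto
  also have "\<dots> = s\<^sup>2 / 6 * (\<bar>s\<bar> * K)" using k3 by simp
  also have "\<dots> = \<bar>s\<bar> ^ 3 * K / 6" by (simp add: power2_eq_square power3_eq_cube flip: abs_mult)
  finally have 1: "cmod (iexp (- s * m) * char \<mu> s - complex_of_real (1 - s\<^sup>2 * V / 2)) \<le> \<bar>s\<bar> ^ 3 * K / 6"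
    unfolding c by simp
  have "cmod (complex_of_real (1 - s\<^sup>2 * V / 2) - complex_of_real (exp (- (s\<^sup>2 * V / 2)))) = \<bar>exp (- (s\<^sup>2 * V / 2)) - (1 - s\<^sup>2 * V / 2)\<bar>"
    by (subst of_real_diff[symmetric], subst norm_of_real) auto
  also have "\<dots> \<le> (s\<^sup>2 * V / 2)\<^sup>2 / 2" using V by (intro one_minus_exp_bound) auto
  also have "\<dots> = s ^ 4 * V\<^sup>2 / 8" by (simp add: power_mult_distrib power_divide flip: power_mult)
  finally have 2: "cmod (complex_of_real (1 - s\<^sup>2 * V / 2) - complex_of_real (exp (- (s\<^sup>2 * V / 2)))) \<le> s ^ 4 * V\<^sup>2 / 8" .
  show ?thesis
    using norm_triangle_mono[OF 1 2] by simp
qed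

text \<open>Numbers in the unit disc satisfy |z^R - w^R| \<le> R |z - w|, so the error for one run
  is multiplied by the number of runs.\<close>

lemma averaged_char_bound:
  assumes \<mu>: "real_distribution \<mu>" and m: "integrable \<mu> (\<lambda>y. y)" "(\<integral>y. y \<partial>\<mu>) = m"
    and V: "(\<integral>\<^sup>+y. ennreal ((y - m)\<^sup>2) \<partial>\<mu>) = ennreal V" "V \<ge> 0"
    and K: "(\<integral>\<^sup>+y. ennreal (\<bar>y - m\<bar> ^ 3) \<partial>\<mu>) = ennreal K" "K \<ge> 0"
  shows "cmod ((iexp (- s * m) * char \<mu> s) ^ R - complex_of_real (exp (- (real R * s\<^sup>2 * V / 2)))) \<le>
    real R * \<bar>s\<bar> ^ 3 * K / 6 + real R * s ^ 4 * V\<^sup>2 / 8"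
proof -
  interpret real_distribution \<mu> by fact
  have "complex_of_real (exp (- (real R * s\<^sup>2 * V / 2))) = complex_of_real (exp (- (s\<^sup>2 * V / 2))) ^ R"
    unfolding of_real_power[symmetric] by (subst exp_of_nat_mult[symmetric]) (simp add: algebra_simps)
  then have "cmod ((iexp (- s * m) * char \<mu> s) ^ R - complex_of_real (exp (- (real R * s\<^sup>2 * V / 2)))) \<le>
     real R * cmod (iexp (- s * m) * char \<mu> s - complex_of_real (exp (- (s\<^sup>2 * V / 2))))"
    using cmod_char_le_1[of s] V(2) by (simp only:) (intro norm_power_diff, auto simp: norm_mult)
  also have "\<dots> \<le> real R * (\<bar>s\<bar> ^ 3 * K / 6 + s ^ 4 * V\<^sup>2 / 8)"
    by (intro mult_left_mono centered_char_bound assms) auto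
  finally show ?thesis by (simp add: algebra_simps)
qed

text \<open>With \<open>s\<close> of order \<open>1 / sqrt n\<close>, the cubic and quartic terms
  are of order \<open>1 / sqrt n\<close> and \<open>1 / n\<close>, while \<open>R * s^2\<close>
  tends to \<open>t^2 / p\<close>. The threshold for \<open>n\<close> must not depend on
  \<open>V\<close> and \<open>K\<close>, because these will be the random moments at the driving
  distributions.\<close>

lemma averaged_char_bound_tendsto:
  fixes R :: "nat \<Rightarrow> nat" and p t v \<kappa> \<epsilon> :: real
  assumes R: "(\<lambda>n. real (R n) / real n) \<longlonglongrightarrow> p" and p: "p > 0" and v: "v \<ge> 0" and \<kappa>: "\<kappa> \<ge> 0" and \<epsilon>: "\<epsilon> > 0"
  defines "s \<equiv> \<lambda>n. t * sqrt (real n) / real (R n)"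
  obtains \<delta> where "\<delta> > 0"
    "\<forall>\<^sub>F n in sequentially. \<forall>V K. 0 \<le> V \<longrightarrow> \<bar>V - v\<bar> < \<delta> \<longrightarrow> 0 \<le> K \<longrightarrow> K < \<kappa> + 1 \<longrightarrow>
       real (R n) * \<bar>s n\<bar> ^ 3 * K / 6 + real (R n) * s n ^ 4 * V\<^sup>2 / 8
         + \<bar>exp (- (real (R n) * (s n)\<^sup>2 * V / 2)) - exp (- (t\<^sup>2 * v / (2 * p)))\<bar> < \<epsilon>"
proof -
  let ?b = "\<lambda>n V K. real (R n) * \<bar>s n\<bar> ^ 3 * K / 6 + real (R n) * s n ^ 4 * V\<^sup>2 / 8
         + \<bar>exp (- (real (R n) * (s n)\<^sup>2 * V / 2)) - exp (- (t\<^sup>2 * v / (2 * p)))\<bar>"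
  \<comment> \<open>The bound 1 keeps \<open>V\<close> below \<open>v + 1\<close>. The other bound,
    together with \<open>n / R < 2 / p\<close>, makes the contribution of \<open>V - v\<close> at
    most \<open>\<epsilon> / 2\<close>; the summand 1 in the denominator covers
    \<open>t = 0\<close>.\<close>
  define \<delta> where "\<delta> = min 1 (\<epsilon> * p / (2 * (t\<^sup>2 + 1)))"
  have t1: "t\<^sup>2 + 1 > 0" by (rule add_nonneg_pos) auto
  have \<delta>: "\<delta> > 0" using \<epsilon> p t1 by (simp add: \<delta>_def)
  have "\<forall>\<^sub>F n in sequentially. real (R n) / real n > 0" by (rule order_tendstoD(1)[OF R p])
  then have pos: "\<forall>\<^sub>F n in sequentially. n > 0 \<and> R n > 0"
    by eventually_elim (auto simp: zero_less_divide_iff)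
  have q: "(\<lambda>n. real n / real (R n)) \<longlonglongrightarrow> 1 / p"
    using tendsto_inverse[OF R] p by (simp add: inverse_eq_divide)
  define a where "a n = \<bar>t\<bar> ^ 3 * (real n / real (R n)) ^ 2 * (1 / sqrt (real n))" for n
  define b where "b n = t ^ 4 * (real n / real (R n)) ^ 3 * (1 / real n)" for n
  have s1: "(\<lambda>n. 1 / sqrt (real n)) \<longlonglongrightarrow> 0"
    by (intro tendsto_divide_0[OF tendsto_const] filterlim_at_top_imp_at_infinity filterlim_compose[OF sqrt_at_top filterlim_real_sequentially])
  have n1: "(\<lambda>n. 1 / real n) \<longlonglongrightarrow> 0" by (rule lim_1_over_n)
  have "a \<longlonglongrightarrow> \<bar>t\<bar> ^ 3 * (1 / p) ^ 2 * 0" unfolding a_def by (intro tendsto_intros q s1)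
  then have a: "a \<longlonglongrightarrow> 0" by simp
  have "b \<longlonglongrightarrow> t ^ 4 * (1 / p) ^ 3 * 0" unfolding b_def by (intro tendsto_intros q n1)
  then have b: "b \<longlonglongrightarrow> 0" by simp
  have "(\<lambda>n. a n * (\<kappa> + 1) / 6 + b n * (v + 1)\<^sup>2 / 8 + t\<^sup>2 / 2 * v * \<bar>real n / real (R n) - 1 / p\<bar>) \<longlonglongrightarrow>
     0 * (\<kappa> + 1) / 6 + 0 * (v + 1)\<^sup>2 / 8 + t\<^sup>2 / 2 * v * \<bar>1 / p - 1 / p\<bar>"
    by (intro tendsto_intros a b q) auto
  then have "\<forall>\<^sub>F n in sequentially. a n * (\<kappa> + 1) / 6 + b n * (v + 1)\<^sup>2 / 8 + t\<^sup>2 / 2 * v * \<bar>real n / real (R n) - 1 / p\<bar> < \<epsilon> / 2"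
    using \<epsilon> by (intro order_tendstoD(2)) auto
  moreover have "\<forall>\<^sub>F n in sequentially. real n / real (R n) < 2 / p"
    using p by (intro order_tendstoD(2)[OF q]) (simp add: divide_strict_right_mono)
  ultimately have "\<forall>\<^sub>F n in sequentially. \<forall>V K. 0 \<le> V \<longrightarrow> \<bar>V - v\<bar> < \<delta> \<longrightarrow> 0 \<le> K \<longrightarrow> K < \<kappa> + 1 \<longrightarrow>
       ?b n V K < \<epsilon>"
    using pos
  proof eventually_elim
    case (elim n)
    show ?case
    proof (intro allI impI)
      fix V K assume V: "0 \<le> V" "\<bar>V - v\<bar> < \<delta>" and K: "0 \<le> K" "K < \<kappa> + 1"
      define w where "w = sqrt (real n)"
      have w: "w > 0" "real n = w\<^sup>2" using elim by (auto simp: w_def)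
      have r: "real (R n) > 0" using elim by simp
      have sa: "real (R n) * \<bar>s n\<bar> ^ 3 = a n"
        using w r unfolding s_def a_def w_def[symmetric] w(2)
        by (simp add: abs_mult power_divide power_mult_distrib divide_simps) (simp add: power2_eq_square power3_eq_cube power4_eq_xxxx mult.assoc)
      have sb: "real (R n) * s n ^ 4 = b n"
      proof -
        have 4: "x ^ 4 = (x\<^sup>2)\<^sup>2" for x :: real by (simp flip: power_mult)
        have s2: "(s n)\<^sup>2 = t\<^sup>2 * real n / (real (R n))\<^sup>2"
          by (simp add: s_def power_divide power_mult_distrib)
        show ?thesis
          using r w unfolding b_def 4 s2 by (simp add: field_simps power2_eq_square power3_eq_cube)
      qed
      have sc: "real (R n) * (s n)\<^sup>2 = t\<^sup>2 * (real n / real (R n))"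
        using w r unfolding s_def w_def[symmetric] w(2)
        by (simp add: power_divide power_mult_distrib divide_simps) (simp add: power2_eq_square)
      have a0: "a n \<ge> 0" by (simp add: a_def)
      have b0: "b n \<ge> 0" by (simp add: b_def)
      have 1: "a n * K / 6 \<le> a n * (\<kappa> + 1) / 6" using a0 K by (intro divide_right_mono mult_left_mono) auto
      have "\<delta> \<le> 1" by (simp add: \<delta>_def)
      then have "V \<le> v + 1" using V by linarith
      then have 2: "b n * V\<^sup>2 / 8 \<le> b n * (v + 1)\<^sup>2 / 8"
        using b0 V by (intro divide_right_mono mult_left_mono power_mono) auto
      have lip: "\<bar>exp (- x) - exp (- y)\<bar> \<le> \<bar>x - y\<bar>" if "0 \<le> x" "0 \<le> y" for x y :: real
      proof -
        have *: "exp (- x) - exp (- y) \<le> y - x" if "0 \<le> x" "x \<le> y" for x y :: real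
        proof -
          have "exp (- x) - exp (- y) = exp (- x) * (1 - exp (- (y - x)))"
            by (simp add: right_diff_distrib flip: exp_add)
          also have "\<dots> \<le> 1 * (1 - exp (- (y - x)))"
            using that by (intro mult_right_mono) auto
          also have "\<dots> \<le> y - x"
          proof -
            define z where "z = exp (- (y - x))"
            have "1 + - (y - x) \<le> z" unfolding z_def by (rule exp_ge_add_one_self)
            then show ?thesis unfolding z_def[symmetric] by (simp only: mult_1)
          qed
          finally show ?thesis .
        qed
        show ?thesis using *[of x y] *[of y x] that by (cases "x \<le> y") (auto simp: abs_if)
      qed
      have "\<bar>exp (- (real (R n) * (s n)\<^sup>2 * V / 2)) - exp (- (t\<^sup>2 * v / (2 * p)))\<bar> \<le>
          \<bar>real (R n) * (s n)\<^sup>2 * V / 2 - t\<^sup>2 * v / (2 * p)\<bar>"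
        using V v p by (intro lip) auto
      also have "real (R n) * (s n)\<^sup>2 * V / 2 - t\<^sup>2 * v / (2 * p) =
          t\<^sup>2 / 2 * (real n / real (R n) * (V - v)) + t\<^sup>2 / 2 * v * (real n / real (R n) - 1 / p)"
      proof -
        have "t\<^sup>2 * x * V / 2 - t\<^sup>2 * v / (2 * p) = t\<^sup>2 / 2 * (x * (V - v)) + t\<^sup>2 / 2 * v * (x - 1 / p)" for x
          using p by (simp add: field_simps)
        then show ?thesis unfolding sc .
      qed
      also have "\<bar>\<dots>\<bar> \<le> \<bar>t\<^sup>2 / 2 * (real n / real (R n) * (V - v))\<bar> + \<bar>t\<^sup>2 / 2 * v * (real n / real (R n) - 1 / p)\<bar>"
        by (rule abs_triangle_ineq)
      also have "\<bar>t\<^sup>2 / 2 * v * (real n / real (R n) - 1 / p)\<bar> = t\<^sup>2 / 2 * v * \<bar>real n / real (R n) - 1 / p\<bar>"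
        using v by (simp add: abs_mult)
      also have "\<bar>t\<^sup>2 / 2 * (real n / real (R n) * (V - v))\<bar> = t\<^sup>2 / 2 * (real n / real (R n) * \<bar>V - v\<bar>)"
        by (simp add: abs_mult)
      also have "\<dots> \<le> t\<^sup>2 / 2 * (2 / p * \<delta>)"
        using elim V p by (intro mult_left_mono mult_mono) auto
      also have "\<dots> \<le> \<epsilon> / 2"
      proof -
        have "t\<^sup>2 * \<delta> \<le> (t\<^sup>2 + 1) * (\<epsilon> * p / (2 * (t\<^sup>2 + 1)))"
          using \<delta> by (intro mult_mono) (auto simp: \<delta>_def)
        also have "\<dots> = \<epsilon> * p / 2" using t1 by (simp add: divide_simps)
        finally show ?thesis using p by (simp add: field_simps)
      qed
      finally show "?b n V K < \<epsilon>"
        unfolding sa sb using 1 2 elim(1) by linarith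
    qed
  qed
  then show ?thesis using that \<delta> by blast
qed

text \<open>For bounded variables convergence in probability is convergence in mean: the difference
  is small off the exceptional event and at most 2 on it. The hypotheses on \<open>Z\<close> are
  only eventual because an empty sample has no empirical probability distribution.\<close>

lemma (in prob_space) expectation_norm_diff_tendsto_0:
  fixes Z :: "nat \<Rightarrow> 'a \<Rightarrow> complex"
  assumes Z: "\<forall>\<^sub>F n in sequentially. Z n \<in> borel_measurable M \<and> (\<forall>\<omega>\<in>space M. norm (Z n \<omega>) \<le> 1)" and c: "norm c \<le> 1"
    and lim: "\<And>\<epsilon>. \<epsilon> > 0 \<Longrightarrow> (\<lambda>n. measure M {\<omega>\<in>space M. norm (Z n \<omega> - c) \<ge> \<epsilon>}) \<longlonglongrightarrow> 0"
  shows "(\<lambda>n. \<integral>\<omega>. norm (Z n \<omega> - c) \<partial>M) \<longlonglongrightarrow> 0"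
proof (rule tendstoI)
  fix e :: real assume e: "e > 0"
  have "\<forall>\<^sub>F n in sequentially. measure M {\<omega>\<in>space M. norm (Z n \<omega> - c) \<ge> e / 2} < e / 4"
    using lim[of "e / 2"] e by (intro order_tendstoD(2)) auto
  with Z show "\<forall>\<^sub>F n in sequentially. dist (\<integral>\<omega>. norm (Z n \<omega> - c) \<partial>M) 0 < e"
  proof eventually_elim
    case (elim n)
    then have [measurable]: "Z n \<in> borel_measurable M" by auto
    let ?A = "{\<omega>\<in>space M. norm (Z n \<omega> - c) \<ge> e / 2}"
    have le2: "norm (Z n \<omega> - c) \<le> 2" if "\<omega> \<in> space M" for \<omega>
      using elim that c norm_triangle_ineq4[of "Z n \<omega>" c] by fastforce
    have A: "?A \<in> sets M" by measurable
    have "(\<integral>\<omega>. norm (Z n \<omega> - c) \<partial>M) \<le> (\<integral>\<omega>. e / 2 + 2 * indicator ?A \<omega> \<partial>M)"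
    proof (rule integral_mono)
      show "integrable M (\<lambda>\<omega>. norm (Z n \<omega> - c))"
        using le2 by (intro integrable_const_bound[where B=2]) auto
      show "integrable M (\<lambda>\<omega>. e / 2 + 2 * indicator ?A \<omega>)"
        using A e by (intro integrable_const_bound[where B="e / 2 + 2"]) (auto simp: indicator_def)
      show "norm (Z n \<omega> - c) \<le> e / 2 + 2 * indicator ?A \<omega>" if "\<omega> \<in> space M" for \<omega>
        using le2[OF that] that e by (auto simp: indicator_def)
    qed
    also have "\<dots> = e / 2 + 2 * measure M ?A"
      using A by (subst Bochner_Integration.integral_add) (auto simp: prob_space less_top[symmetric])
    also have "\<dots> < e" using elim by simp
    finally show ?case by (simp add: dist_real_def)
  qed
qed

text \<open>A Slutsky argument in which \<open>W\<close> itself need not converge, only its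
  expectation. All factors lie in the unit disc, so replacing each \<open>Z n k\<close> by
  \<open>c k\<close> changes the expectation by at most the sum of the mean errors. It serves both
  for the resamples and for the runs.\<close>

lemma (in prob_space) expectation_mult_prod_tendsto:
  fixes W :: "nat \<Rightarrow> 'a \<Rightarrow> complex" and Z :: "nat \<Rightarrow> 'k \<Rightarrow> 'a \<Rightarrow> complex"
  assumes I: "finite I"
    and W: "\<forall>\<^sub>F n in sequentially. W n \<in> borel_measurable M \<and> (\<forall>\<omega>\<in>space M. norm (W n \<omega>) \<le> 1)"
    and Z: "\<And>k. k \<in> I \<Longrightarrow> \<forall>\<^sub>F n in sequentially. Z n k \<in> borel_measurable M \<and> (\<forall>\<omega>\<in>space M. norm (Z n k \<omega>) \<le> 1)"
    and c: "\<And>k. k \<in> I \<Longrightarrow> norm (c k) \<le> 1"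
    and lim: "\<And>k \<epsilon>. k \<in> I \<Longrightarrow> \<epsilon> > 0 \<Longrightarrow> (\<lambda>n. measure M {\<omega>\<in>space M. norm (Z n k \<omega> - c k) \<ge> \<epsilon>}) \<longlonglongrightarrow> 0"
    and limW: "(\<lambda>n. \<integral>\<omega>. W n \<omega> \<partial>M) \<longlonglongrightarrow> w"
  shows "(\<lambda>n. \<integral>\<omega>. W n \<omega> * (\<Prod>k\<in>I. Z n k \<omega>) \<partial>M) \<longlonglongrightarrow> w * (\<Prod>k\<in>I. c k)"
proof -
  have "\<forall>\<^sub>F n in sequentially. \<forall>k\<in>I. Z n k \<in> borel_measurable M \<and> (\<forall>\<omega>\<in>space M. norm (Z n k \<omega>) \<le> 1)"
    using I Z by (intro eventually_ball_finite) auto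
  with W have "\<forall>\<^sub>F n in sequentially. norm ((\<integral>\<omega>. W n \<omega> * (\<Prod>k\<in>I. Z n k \<omega>) \<partial>M) - (\<integral>\<omega>. W n \<omega> \<partial>M) * (\<Prod>k\<in>I. c k)) \<le>
     (\<Sum>k\<in>I. \<integral>\<omega>. norm (Z n k \<omega> - c k) \<partial>M)"
  proof eventually_elim
    case (elim n)
    then have [measurable]: "W n \<in> borel_measurable M" and Zm: "\<And>k. k \<in> I \<Longrightarrow> Z n k \<in> borel_measurable M"
      and W1: "\<And>\<omega>. \<omega> \<in> space M \<Longrightarrow> norm (W n \<omega>) \<le> 1" and Z1: "\<And>k \<omega>. k \<in> I \<Longrightarrow> \<omega> \<in> space M \<Longrightarrow> norm (Z n k \<omega>) \<le> 1"
      by auto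
    have iZ: "integrable M (\<lambda>\<omega>. norm (Z n k \<omega> - c k))" if "k \<in> I" for k
    proof (rule integrable_const_bound[where B=2])
      have "norm (Z n k \<omega> - c k) \<le> 2" if "\<omega> \<in> space M" for \<omega>
        using norm_triangle_ineq4[of "Z n k \<omega>" "c k"] Z1[OF \<open>k \<in> I\<close> that] c[OF \<open>k \<in> I\<close>] by linarith
      then show "AE \<omega> in M. norm (norm (Z n k \<omega> - c k)) \<le> 2" by auto
      show "(\<lambda>\<omega>. norm (Z n k \<omega> - c k)) \<in> borel_measurable M" using Zm[OF that] by measurable
    qed
    have iW: "integrable M (W n)" by (rule bounded_complex_integral(1)[where C=1]) (use W1 in auto)
    have iWZ: "integrable M (\<lambda>\<omega>. W n \<omega> * (\<Prod>k\<in>I. Z n k \<omega>))"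
    proof (rule bounded_complex_integral(1)[where C=1])
      show "norm (W n \<omega> * (\<Prod>k\<in>I. Z n k \<omega>)) \<le> 1" if "\<omega> \<in> space M" for \<omega>
        using W1 Z1 that by (auto simp: norm_mult prod_norm[symmetric] intro!: mult_le_one prod_le_1 prod_nonneg)
      show "(\<lambda>\<omega>. W n \<omega> * (\<Prod>k\<in>I. Z n k \<omega>)) \<in> borel_measurable M"
        using Zm by (intro borel_measurable_times borel_measurable_prod) auto
    qed
    have "(\<integral>\<omega>. W n \<omega> * (\<Prod>k\<in>I. Z n k \<omega>) \<partial>M) - (\<integral>\<omega>. W n \<omega> \<partial>M) * (\<Prod>k\<in>I. c k) =
        (\<integral>\<omega>. W n \<omega> * (\<Prod>k\<in>I. Z n k \<omega>) - W n \<omega> * (\<Prod>k\<in>I. c k) \<partial>M)"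
      using iW iWZ by simp
    also have "norm \<dots> \<le> (\<integral>\<omega>. norm (W n \<omega> * (\<Prod>k\<in>I. Z n k \<omega>) - W n \<omega> * (\<Prod>k\<in>I. c k)) \<partial>M)"
      by (rule integral_norm_bound)
    also have "\<dots> \<le> (\<integral>\<omega>. (\<Sum>k\<in>I. norm (Z n k \<omega> - c k)) \<partial>M)"
    proof (rule integral_mono)
      show "integrable M (\<lambda>\<omega>. norm (W n \<omega> * (\<Prod>k\<in>I. Z n k \<omega>) - W n \<omega> * (\<Prod>k\<in>I. c k)))"
        using iW iWZ by (intro integrable_norm Bochner_Integration.integrable_diff integrable_mult_left) auto
      show "integrable M (\<lambda>\<omega>. \<Sum>k\<in>I. norm (Z n k \<omega> - c k))" using iZ by (intro Bochner_Integration.integrable_sum)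
      fix \<omega> assume \<omega>: "\<omega> \<in> space M"
      have "norm (W n \<omega> * (\<Prod>k\<in>I. Z n k \<omega>) - W n \<omega> * (\<Prod>k\<in>I. c k)) = norm (W n \<omega>) * norm ((\<Prod>k\<in>I. Z n k \<omega>) - (\<Prod>k\<in>I. c k))"
        by (simp add: norm_mult[symmetric] right_diff_distrib)
      also have "\<dots> \<le> 1 * norm ((\<Prod>k\<in>I. Z n k \<omega>) - (\<Prod>k\<in>I. c k))"
        using W1[OF \<omega>] by (intro mult_right_mono) auto
      also have "\<dots> \<le> (\<Sum>k\<in>I. norm (Z n k \<omega> - c k))"
        using Z1 \<omega> c by (simp, intro norm_prod_diff) auto
      finally show "norm (W n \<omega> * (\<Prod>k\<in>I. Z n k \<omega>) - W n \<omega> * (\<Prod>k\<in>I. c k)) \<le> (\<Sum>k\<in>I. norm (Z n k \<omega> - c k))" .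
    qed
    also have "\<dots> = (\<Sum>k\<in>I. \<integral>\<omega>. norm (Z n k \<omega> - c k) \<partial>M)" using iZ by (rule Bochner_Integration.integral_sum)
    finally show ?case .
  qed
  moreover have "(\<lambda>n. \<Sum>k\<in>I. \<integral>\<omega>. norm (Z n k \<omega> - c k) \<partial>M) \<longlonglongrightarrow> 0"
    using Z c lim by (intro tendsto_null_sum expectation_norm_diff_tendsto_0) auto
  ultimately have "(\<lambda>n. (\<integral>\<omega>. W n \<omega> * (\<Prod>k\<in>I. Z n k \<omega>) \<partial>M) - (\<integral>\<omega>. W n \<omega> \<partial>M) * (\<Prod>k\<in>I. c k)) \<longlonglongrightarrow> 0"
    by (rule Lim_null_comparison)
  from tendsto_add[OF this tendsto_mult[OF limW tendsto_const[of "\<Prod>k\<in>I. c k"]]] show ?thesis by simp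
qed

section \<open>Resamples and runs\<close>

lemma integral_PiM_prod:
  fixes f :: "'i \<Rightarrow> 'a \<Rightarrow> complex"
  assumes I: "finite I" and K: "\<And>i. i \<in> I \<Longrightarrow> prob_space (K i)" and f: "\<And>i. i \<in> I \<Longrightarrow> integrable (K i) (f i)"
  shows "(\<integral>x. (\<Prod>i\<in>I. f i (x i)) \<partial>PiM I K) = (\<Prod>i\<in>I. integral\<^sup>L (K i) (f i))"
proof -
  \<comment> \<open>Outside \<open>I\<close> the family is completed by point masses, since
    sigma-finiteness is required at every index.\<close>
  define K' where "K' i = (if i \<in> I then K i else return (count_space UNIV) undefined)" for i
  interpret product_sigma_finite K'
    using K by (auto simp: product_sigma_finite_def K'_def intro!: prob_space_imp_sigma_finite prob_space_return)
  have "PiM I K = PiM I K'" by (intro PiM_cong) (auto simp: K'_def)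
  then have "(\<integral>x. (\<Prod>i\<in>I. f i (x i)) \<partial>PiM I K) = (\<Prod>i\<in>I. integral\<^sup>L (K' i) (f i))"
    using f I by (simp, intro product_integral_prod) (auto simp: K'_def)
  then show ?thesis by (simp add: K'_def)
qed

lemma distr_PiM_block:
  assumes K: "prob_space K" and b: "b \<in> A"
  shows "distr (PiM (A \<times> J) (\<lambda>_. K)) (PiM J (\<lambda>_. K)) (\<lambda>v. \<lambda>j\<in>J. v (b, j)) = PiM J (\<lambda>_. K)"
  using assms by (intro distr_PiM_reindex) (auto simp: inj_on_def)

lemma block_measurable: "b \<in> A \<Longrightarrow> (\<lambda>v. \<lambda>j\<in>J. v (b, j)) \<in> PiM (A \<times> J) (\<lambda>_. S) \<rightarrow>\<^sub>M PiM J (\<lambda>_. S)"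
  by (intro measurable_restrict measurable_component_singleton) auto

text \<open>The rows of an i.i.d. array are independent, and each has the law of a single i.i.d.
  sample. In the application a row is one resample.\<close>

lemma integral_PiM_blocks:
  fixes G :: "'b \<Rightarrow> ('j \<Rightarrow> 'a) \<Rightarrow> complex"
  assumes A: "finite A" and J: "J \<noteq> {}" and K: "prob_space K"
    and G: "\<And>b. b \<in> A \<Longrightarrow> G b \<in> borel_measurable (PiM J (\<lambda>_. K))" and G1: "\<And>b v. b \<in> A \<Longrightarrow> norm (G b v) \<le> 1"
  shows "(\<integral>v. (\<Prod>b\<in>A. G b (\<lambda>j\<in>J. v (b, j))) \<partial>PiM (A \<times> J) (\<lambda>_. K)) = (\<Prod>b\<in>A. integral\<^sup>L (PiM J (\<lambda>_. K)) (G b))"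
proof (cases "A = {}")
  case True
  then show ?thesis
    using prob_space_PiM[of "{} :: ('b \<times> 'j) set" "\<lambda>_. K"] by (simp add: prob_space.prob_space)
next
  case False
  with J have False: "A \<times> J \<noteq> {}" by auto
  let ?T = "PiM (A \<times> J) (\<lambda>_. K)"
  interpret T: prob_space ?T by (rule prob_space_PiM) (rule K)
  have "T.indep_vars (\<lambda>_. K) (\<lambda>i v. v i) (A \<times> J)"
  proof (subst T.indep_vars_iff_distr_eq_PiM'[OF False])
    have "distr ?T (PiM (A \<times> J) (\<lambda>_. K)) (\<lambda>v. \<lambda>i\<in>A \<times> J. v i) = distr ?T ?T (\<lambda>v. v)"
      by (intro distr_cong) (auto simp: space_PiM PiE_def extensional_restrict)
    also have "\<dots> = ?T" by (rule distr_id)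
    also have "?T = PiM (A \<times> J) (\<lambda>i. distr ?T K (\<lambda>v. v i))"
      using K by (intro PiM_cong refl distr_PiM_component[symmetric])
    finally show "distr ?T (PiM (A \<times> J) (\<lambda>_. K)) (\<lambda>v. \<lambda>i\<in>A \<times> J. v i) = PiM (A \<times> J) (\<lambda>i. distr ?T K (\<lambda>v. v i))" .
  qed auto
  then have "T.indep_vars (\<lambda>b. PiM ({b} \<times> J) (\<lambda>_. K)) (\<lambda>b v. restrict (\<lambda>i. v i) ({b} \<times> J)) A"
    by (rule T.indep_vars_restrict) (auto simp: disjoint_family_on_def)
  then have "T.indep_vars (\<lambda>_. borel) (\<lambda>b v. (\<lambda>w. G b (\<lambda>j\<in>J. w (b, j))) (restrict (\<lambda>i. v i) ({b} \<times> J))) A"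
  proof (rule T.indep_vars_compose2)
    fix b assume b: "b \<in> A"
    show "(\<lambda>w. G b (\<lambda>j\<in>J. w (b, j))) \<in> PiM ({b} \<times> J) (\<lambda>_. K) \<rightarrow>\<^sub>M borel"
      by (rule measurable_compose[OF _ G[OF b]]) (rule block_measurable, simp)
  qed
  moreover have "(\<lambda>w. G b (\<lambda>j\<in>J. w (b, j))) (restrict (\<lambda>i. v i) ({b} \<times> J)) = G b (\<lambda>j\<in>J. v (b, j))" for b v
    by (auto intro!: arg_cong[where f="G b"])
  ultimately have ind: "T.indep_vars (\<lambda>_. borel) (\<lambda>b v. G b (\<lambda>j\<in>J. v (b, j))) A" by simp
  have m: "(\<lambda>v. G b (\<lambda>j\<in>J. v (b, j))) \<in> borel_measurable ?T" if "b \<in> A" for b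
    by (rule measurable_compose[OF block_measurable[OF that] G[OF that]])
  have "(\<integral>v. (\<Prod>b\<in>A. G b (\<lambda>j\<in>J. v (b, j))) \<partial>?T) = (\<Prod>b\<in>A. \<integral>v. G b (\<lambda>j\<in>J. v (b, j)) \<partial>?T)"
    using m G1 by (intro T.indep_vars_lebesgue_integral A ind T.integrable_const_bound[where B=1]) auto
  also have "\<dots> = (\<Prod>b\<in>A. integral\<^sup>L (PiM J (\<lambda>_. K)) (G b))"
  proof (rule prod.cong[OF refl])
    fix b assume b: "b \<in> A"
    have "(\<integral>v. G b (\<lambda>j\<in>J. v (b, j)) \<partial>?T) = integral\<^sup>L (distr ?T (PiM J (\<lambda>_. K)) (\<lambda>v. \<lambda>j\<in>J. v (b, j))) (G b)"
      by (rule integral_distr[symmetric, OF block_measurable[OF b] G[OF b]])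
    then show "(\<integral>v. G b (\<lambda>j\<in>J. v (b, j)) \<partial>?T) = integral\<^sup>L (PiM J (\<lambda>_. K)) (G b)"
      by (simp add: distr_PiM_block[OF K b])
  qed
  finally show ?thesis .
qed

text \<open>The empirical distribution of a fixed sample instead of random variables: a map on the
  sample space, which can be integrated against a product measure.\<close>

definition emp :: "'a measure \<Rightarrow> nat \<Rightarrow> (nat \<Rightarrow> 'a) \<Rightarrow> 'a measure" where
  "emp P n v = distr (uniform_count_measure {..<n}) P v"

lemma empirical_eq_emp: "empirical P n V \<omega> = emp P n (\<lambda>i. V i \<omega>)"
  by (simp add: empirical_def emp_def)

lemma emp_restrict: "emp P n (restrict v {..<n}) = emp P n v"
  unfolding emp_def by (intro distr_cong) (auto simp: space_uniform_count_measure)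

text \<open>The mass given to a set is an average of \<open>n\<close> indicators. For
  \<open>n = 0\<close> there would be no probability measure.\<close>

lemma emp_measurable:
  assumes n: "n > 0"
  shows "emp P n \<in> PiM {..<n} (\<lambda>_. P) \<rightarrow>\<^sub>M prob_algebra P"
proof -
  have m: "v \<in> uniform_count_measure {..<n} \<rightarrow>\<^sub>M P" if "v \<in> space (PiM {..<n} (\<lambda>_. P))" for v
    using that by (auto simp: space_PiM PiE_iff measurable_def space_uniform_count_measure sets_uniform_count_measure)
  interpret U: prob_space "uniform_count_measure {..<n}"
    using n by (intro prob_space_uniform_count_measure) auto
  show ?thesis
  proof (rule measurable_prob_algebra_generated[where G="sets P" and \<Omega>="space P"])
    show "sets P = sigma_sets (space P) (sets P)" by (simp add: sets.sigma_sets_eq)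
    show "prob_space (emp P n v)" if "v \<in> space (PiM {..<n} (\<lambda>_. P))" for v
      unfolding emp_def by (rule U.prob_space_distr[OF m[OF that]])
    fix A assume A: "A \<in> sets P"
    have "emeasure (emp P n v) A = ennreal ((\<Sum>i<n. indicator A (v i)) / real n)" if "v \<in> space (PiM {..<n} (\<lambda>_. P))" for v
    proof -
      have "emeasure (emp P n v) A = emeasure (uniform_count_measure {..<n}) (v -` A \<inter> {..<n})"
        unfolding emp_def by (subst emeasure_distr[OF m[OF that] A]) (simp add: space_uniform_count_measure)
      also have "\<dots> = ennreal (real (card (v -` A \<inter> {..<n})) / real n)"
        by (subst emeasure_uniform_count_measure) auto
      also have "real (card (v -` A \<inter> {..<n})) = (\<Sum>i<n. indicator A (v i))"
        by (simp add: indicator_def sum.If_cases vimage_def Int_commute)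
      finally show ?thesis .
    qed
    moreover have "(\<lambda>v. ennreal ((\<Sum>i<n. indicator A (v i)) / real n)) \<in> borel_measurable (PiM {..<n} (\<lambda>_. P))"
      using A by measurable
    ultimately show "(\<lambda>v. emeasure (emp P n v) A) \<in> borel_measurable (PiM {..<n} (\<lambda>_. P))"
      by (subst measurable_cong)
  qed (auto simp: emp_def sets.Int_stable sets.space_closed)
qed

lemma empirical_measurable:
  assumes "n > 0" "\<And>i. i < n \<Longrightarrow> V i \<in> M \<rightarrow>\<^sub>M P"
  shows "empirical P n V \<in> M \<rightarrow>\<^sub>M prob_algebra P"
proof -
  have "(\<lambda>\<omega>. \<lambda>i\<in>{..<n}. V i \<omega>) \<in> M \<rightarrow>\<^sub>M PiM {..<n} (\<lambda>_. P)"
    using assms by (intro measurable_restrict) auto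
  from measurable_compose[OF this emp_measurable[OF assms(1)]]
  show ?thesis by (simp add: emp_restrict empirical_eq_emp[abs_def])
qed

text \<open>The law of the scaled bootstrap error when \<open>n\<close> points are drawn from
  \<open>Q\<close>. Evaluated at the empirical distribution it is a concrete version of the
  conditional law of that error.\<close>

definition boot_law :: "'a measure \<Rightarrow> ('a measure \<Rightarrow> real) \<Rightarrow> nat \<Rightarrow> 'a measure \<Rightarrow> real measure" where
  "boot_law P \<psi> n Q = distr (PiM {..<n} (\<lambda>_. Q)) borel (\<lambda>v. sqrt (real n) * (\<psi> (emp P n v) - \<psi> Q))"

context nested_sampling
begin

lemma X_measurable: "X i \<in> M \<rightarrow>\<^sub>M P"
  using data_indep by (auto simp: indep_vars_def)

lemma Xs_measurable: "b \<in> {1..B} \<Longrightarrow> j < n \<Longrightarrow> Xs n b j \<in> M \<rightarrow>\<^sub>M P"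
  using resampling[of n] by (cases "n = 0") (auto simp: cond_indep_with_laws_def)

lemma driving_measurable:
  assumes "n > 0" "k \<in> {0..B}"
  shows "driving P X Xs n k \<in> M \<rightarrow>\<^sub>M prob_algebra P"
  using assms Xs_measurable X_measurable
  by (auto simp: driving_def intro!: empirical_measurable)

abbreviation (input) runs_number :: "nat \<Rightarrow> nat \<Rightarrow> nat" where
  "runs_number n k \<equiv> if k = 0 then R0 n else R n"

lemma Y_measurable: "n > 0 \<Longrightarrow> k \<in> {0..B} \<Longrightarrow> r < runs_number n k \<Longrightarrow> Y n k r \<in> borel_measurable M"
  using runs[of n] by (auto simp: cond_indep_with_laws_def split: if_splits)

text \<open>\<open>\<zeta>\<close> collects the noise-free factors. As a function of the driving
  distributions it is fixed under the conditioning, and each independent run contributes one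
  characteristic function of \<open>N\<close>.\<close>

lemma integral_runs:
  fixes \<zeta> :: "(nat \<Rightarrow> 'a measure) \<Rightarrow> complex"
  assumes n: "n > 0" and \<zeta>: "\<zeta> \<in> borel_measurable (PiM {0..B} (\<lambda>_. prob_algebra P))" and \<zeta>1: "\<And>d. norm (\<zeta> d) \<le> 1"
  shows "(\<integral>\<omega>. \<zeta> (\<lambda>k\<in>{0..B}. driving P X Xs n k \<omega>) * (\<Prod>k\<in>{0..B}. \<Prod>r<runs_number n k. iexp (s k * Y n k r \<omega>)) \<partial>M) =
    (\<integral>\<omega>. \<zeta> (\<lambda>k\<in>{0..B}. driving P X Xs n k \<omega>) * (\<Prod>k\<in>{0..B}. char (N (driving P X Xs n k \<omega>)) (s k) ^ runs_number n k) \<partial>M)"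
proof -
  let ?I = "SIGMA k:{0..B}. {..<runs_number n k}"
  let ?D = "\<lambda>\<omega>. \<lambda>k\<in>{0..B}. driving P X Xs n k \<omega>"
  let ?F = "vimage_algebra (space M) ?D (PiM {0..B} (\<lambda>_. prob_algebra P))"
  let ?f = "\<lambda>(\<omega>, v). \<zeta> (?D \<omega>) * (\<Prod>i\<in>?I. iexp (s (fst i) * v i))"
  have DM: "?D \<in> M \<rightarrow>\<^sub>M PiM {0..B} (\<lambda>_. prob_algebra P)"
    using driving_measurable[OF n] by (intro measurable_restrict) auto
  then have DF: "?D \<in> ?F \<rightarrow>\<^sub>M PiM {0..B} (\<lambda>_. prob_algebra P)"
    by (intro measurable_vimage_algebra1) (auto dest: measurable_space)
  have sub: "subalgebra M ?F"
    unfolding subalgebra_def using DM by (auto simp: sets_vimage_algebra2[OF measurable_space[OF DM, THEN Pi_I]] )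
  have L: "(\<lambda>(k, r) \<omega>. N (driving P X Xs n k \<omega>)) i \<in> ?F \<rightarrow>\<^sub>M prob_algebra borel" if i: "i \<in> ?I" for i
  proof -
    obtain k r where k: "i = (k, r)" "k \<in> {0..B}" using i by auto
    have "(\<lambda>\<omega>. ?D \<omega> k) \<in> ?F \<rightarrow>\<^sub>M prob_algebra P"
      by (rule measurable_compose[OF DF]) (rule measurable_component_singleton[OF k(2)])
    then have "driving P X Xs n k \<in> ?F \<rightarrow>\<^sub>M prob_algebra P" using k(2) by simp
    from measurable_compose[OF this noise_kernel] show ?thesis by (simp add: k(1))
  qed
  have fm: "?f \<in> borel_measurable (?F \<Otimes>\<^sub>M PiM ?I (\<lambda>_. borel))"
  proof -
    have "(\<lambda>x. \<zeta> (?D (fst x))) \<in> borel_measurable (?F \<Otimes>\<^sub>M PiM ?I (\<lambda>_. borel))"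
      by (rule measurable_compose[OF measurable_fst measurable_compose[OF DF \<zeta>]])
    moreover have "(\<lambda>x. iexp (s (fst i) * snd x i)) \<in> borel_measurable (?F \<Otimes>\<^sub>M PiM ?I (\<lambda>_. borel))" if "i \<in> ?I" for i
    proof -
      have "(\<lambda>x. snd x i) \<in> borel_measurable (?F \<Otimes>\<^sub>M PiM ?I (\<lambda>_. borel :: real measure))"
        by (rule measurable_compose[OF measurable_snd]) (rule measurable_component_singleton[OF that])
      then show ?thesis by measurable
    qed
    ultimately show ?thesis
      unfolding case_prod_beta by (intro borel_measurable_times borel_measurable_prod) auto
  qed
  have f1: "norm (?f x) \<le> 1" for x
    using \<zeta>1 by (cases x) (simp add: norm_mult prod_norm[symmetric])
  have main: "(\<integral>\<omega>. ?f (\<omega>, \<lambda>i\<in>?I. (\<lambda>(k, r). Y n k r) i \<omega>) \<partial>M) = (\<integral>\<omega>. (\<integral>v. ?f (\<omega>, v) \<partial>PiM ?I (\<lambda>i. (\<lambda>(k, r) \<omega>. N (driving P X Xs n k \<omega>)) i \<omega>)) \<partial>M)"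
    by (rule cond_indep_with_laws_integral[OF prob_space_axioms sub _ runs[OF n] L fm f1]) auto
  have lhs: "?f (\<omega>, \<lambda>i\<in>?I. (\<lambda>(k, r). Y n k r) i \<omega>) = \<zeta> (?D \<omega>) * (\<Prod>k\<in>{0..B}. \<Prod>r<runs_number n k. iexp (s k * Y n k r \<omega>))" for \<omega>
  proof -
    have "(\<Prod>i\<in>?I. iexp (s (fst i) * (\<lambda>i\<in>?I. (\<lambda>(k, r). Y n k r) i \<omega>) i)) = (\<Prod>(k, r)\<in>?I. iexp (s k * Y n k r \<omega>))"
      by (intro prod.cong) auto
    also have "\<dots> = (\<Prod>k\<in>{0..B}. \<Prod>r<runs_number n k. iexp (s k * Y n k r \<omega>))"
      by (rule prod.Sigma[symmetric]) auto
    finally show ?thesis by simp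
  qed
  have rhs: "(\<integral>v. ?f (\<omega>, v) \<partial>PiM ?I (\<lambda>i. (\<lambda>(k, r) \<omega>. N (driving P X Xs n k \<omega>)) i \<omega>)) =
     \<zeta> (?D \<omega>) * (\<Prod>k\<in>{0..B}. char (N (driving P X Xs n k \<omega>)) (s k) ^ runs_number n k)" if \<omega>: "\<omega> \<in> space M" for \<omega>
  proof -
    let ?L = "\<lambda>i. (\<lambda>(k, r) \<omega>. N (driving P X Xs n k \<omega>)) i \<omega>"
    have Lp: "real_distribution (?L i)" if i: "i \<in> ?I" for i
    proof -
      have "?L i \<in> space (prob_algebra borel)" using measurable_space[OF L[OF i]] \<omega> by simp
      then show ?thesis by (auto simp: space_prob_algebra real_distribution_def real_distribution_axioms_def)
    qed
    have "(\<integral>v. (\<Prod>i\<in>?I. iexp (s (fst i) * v i)) \<partial>PiM ?I ?L) = (\<Prod>i\<in>?I. \<integral>y. iexp (s (fst i) * y) \<partial>?L i)"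
    proof (rule integral_PiM_prod)
      fix i assume i: "i \<in> ?I"
      interpret Li: real_distribution "?L i" by (rule Lp[OF i])
      show "integrable (?L i) (\<lambda>y. iexp (s (fst i) * y))"
        by (intro Li.integrable_const_bound[where B=1]) auto
      show "prob_space (?L i)" by (rule Li.prob_space_axioms)
    qed auto
    also have "\<dots> = (\<Prod>(k, r)\<in>?I. char (N (driving P X Xs n k \<omega>)) (s k))"
      by (intro prod.cong) (auto simp: char_def)
    also have "\<dots> = (\<Prod>k\<in>{0..B}. \<Prod>r<runs_number n k. char (N (driving P X Xs n k \<omega>)) (s k))"
      by (rule prod.Sigma[symmetric]) auto
    also have "\<dots> = (\<Prod>k\<in>{0..B}. char (N (driving P X Xs n k \<omega>)) (s k) ^ runs_number n k)"
      by (intro prod.cong) simp_all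
    finally show ?thesis by simp
  qed
  show ?thesis
    using main unfolding lhs by (simp only: rhs cong: Bochner_Integration.integral_cong)
qed

end

section \<open>Integrating out the resamples given the data\<close>

context nested_sampling
begin

abbreviation (input) data_algebra :: "nat \<Rightarrow> 'w measure" where
  "data_algebra n \<equiv> vimage_algebra (space M) (\<lambda>\<omega>. \<lambda>i\<in>{..<n}. X i \<omega>) (PiM {..<n} (\<lambda>_. P))"

lemma subalgebra_vimage_algebra:
  assumes "f \<in> M \<rightarrow>\<^sub>M T" shows "subalgebra M (vimage_algebra (space M) f T)"
  unfolding subalgebra_def using assms by (auto simp: sets_vimage_algebra2[OF measurable_space[OF assms, THEN Pi_I]])

lemma data_measurable: "(\<lambda>\<omega>. \<lambda>i\<in>{..<n}. X i \<omega>) \<in> M \<rightarrow>\<^sub>M PiM {..<n} (\<lambda>_. P)"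
  by (intro measurable_restrict X_measurable)

lemma empirical_data_measurable:
  assumes n: "n > 0"
  shows "empirical P n X \<in> data_algebra n \<rightarrow>\<^sub>M prob_algebra P"
proof -
  have "(\<lambda>\<omega>. \<lambda>i\<in>{..<n}. X i \<omega>) \<in> data_algebra n \<rightarrow>\<^sub>M PiM {..<n} (\<lambda>_. P)"
    by (intro measurable_vimage_algebra1 Pi_I measurable_space[OF data_measurable])
  from measurable_compose[OF this emp_measurable[OF n]]
  show ?thesis by (simp add: emp_restrict empirical_eq_emp[abs_def])
qed

lemma empirical_X_measurable: "n > 0 \<Longrightarrow> empirical P n X \<in> M \<rightarrow>\<^sub>M prob_algebra P"
  by (intro empirical_measurable X_measurable)

lemma empirical_Xs_measurable: "n > 0 \<Longrightarrow> b \<in> {1..B} \<Longrightarrow> empirical P n (Xs n b) \<in> M \<rightarrow>\<^sub>M prob_algebra P"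
  by (intro empirical_measurable Xs_measurable)

lemma integral_resamples:
  fixes f :: "'w \<times> (nat \<times> nat \<Rightarrow> 'a) \<Rightarrow> complex"
  assumes n: "n > 0" and f: "f \<in> borel_measurable (data_algebra n \<Otimes>\<^sub>M PiM ({1..B} \<times> {..<n}) (\<lambda>_. P))"
    and C: "\<And>x. norm (f x) \<le> C"
  shows "(\<integral>\<omega>. f (\<omega>, \<lambda>(b, j)\<in>{1..B} \<times> {..<n}. Xs n b j \<omega>) \<partial>M) =
     (\<integral>\<omega>. (\<integral>v. f (\<omega>, v) \<partial>PiM ({1..B} \<times> {..<n}) (\<lambda>_. empirical P n X \<omega>)) \<partial>M)"
proof -
  have "(\<integral>\<omega>. f (\<omega>, \<lambda>i\<in>{1..B} \<times> {..<n}. (\<lambda>(b, j). Xs n b j) i \<omega>) \<partial>M) =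
     (\<integral>\<omega>. (\<integral>v. f (\<omega>, v) \<partial>PiM ({1..B} \<times> {..<n}) (\<lambda>_. empirical P n X \<omega>)) \<partial>M)"
    by (rule cond_indep_with_laws_integral[OF prob_space_axioms subalgebra_vimage_algebra[OF data_measurable] _ resampling[OF n] empirical_data_measurable[OF n] f C]) auto
  moreover have "(\<lambda>i\<in>{1..B} \<times> {..<n}. (\<lambda>(b, j). Xs n b j) i \<omega>) = (\<lambda>(b, j)\<in>{1..B} \<times> {..<n}. Xs n b j \<omega>)" for \<omega>
    by (auto simp: restrict_def fun_eq_iff)
  ultimately show ?thesis by simp
qed

lemma psi_emp_measurable: "n > 0 \<Longrightarrow> (\<lambda>v. \<psi> (emp P n v)) \<in> borel_measurable (PiM {..<n} (\<lambda>_. P))"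
  by (rule measurable_compose[OF emp_measurable measurable_functional])

lemma space_prob_algebra_empirical:
  assumes "n > 0" "\<omega> \<in> space M" shows "empirical P n X \<omega> \<in> space (prob_algebra P)"
  using measurable_space[OF empirical_X_measurable] assms by auto

lemma boot_law_measurable:
  assumes n: "n > 0"
  shows "boot_law P \<psi> n \<in> prob_algebra P \<rightarrow>\<^sub>M prob_algebra borel"
  unfolding boot_law_def
proof (rule measurable_distr_prob_space2)
  show "(\<lambda>Q. PiM {..<n} (\<lambda>_. Q)) \<in> prob_algebra P \<rightarrow>\<^sub>M prob_algebra (PiM {..<n} (\<lambda>_. P))"
    by (rule measurable_PiM_prob_algebra) auto
  note [measurable] = psi_emp_measurable[OF n] measurable_functional
  show "(\<lambda>(Q, v). sqrt (real n) * (\<psi> (emp P n v) - \<psi> Q)) \<in> prob_algebra P \<Otimes>\<^sub>M PiM {..<n} (\<lambda>_. P) \<rightarrow>\<^sub>M borel"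
    by measurable
qed

lemma real_distribution_boot_law:
  assumes "n > 0" "Q \<in> space (prob_algebra P)"
  shows "real_distribution (boot_law P \<psi> n Q)"
  using measurable_space[OF boot_law_measurable[OF assms(1)] assms(2)]
  by (auto simp: space_prob_algebra real_distribution_def real_distribution_axioms_def)

lemma boot_law_integral:
  fixes g :: "real \<Rightarrow> complex"
  assumes n: "n > 0" and Q: "Q \<in> space (prob_algebra P)" and g: "g \<in> borel_measurable borel"
  shows "integral\<^sup>L (boot_law P \<psi> n Q) g = (\<integral>v. g (sqrt (real n) * (\<psi> (emp P n v) - \<psi> Q)) \<partial>PiM {..<n} (\<lambda>_. Q))"
proof -
  have "sets (PiM {..<n} (\<lambda>_. Q)) = sets (PiM {..<n} (\<lambda>_. P))"
    using Q by (intro sets_PiM_cong) (auto simp: space_prob_algebra)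
  then have "(\<lambda>v. sqrt (real n) * (\<psi> (emp P n v) - \<psi> Q)) \<in> borel_measurable (PiM {..<n} (\<lambda>_. Q))"
    using psi_emp_measurable[OF n] by (simp cong: measurable_cong_sets)
  then show ?thesis unfolding boot_law_def by (rule integral_distr[OF _ g])
qed

text \<open>Given the data the resamples are i.i.d. rows drawn from the empirical distribution. The
  functions \<open>g b\<close> are left general: exponentials yield characteristic functions of the
  bootstrap law, indicators its cdf.\<close>

lemma integral_boot_product:
  fixes \<zeta> :: "'w \<Rightarrow> complex" and g :: "nat \<Rightarrow> real \<Rightarrow> complex"
  assumes n: "n > 0" and \<zeta>: "\<zeta> \<in> borel_measurable (data_algebra n)" "\<And>\<omega>. norm (\<zeta> \<omega>) \<le> 1"
    and g: "\<And>b. g b \<in> borel_measurable borel" "\<And>b y. norm (g b y) \<le> 1"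
  shows "(\<integral>\<omega>. \<zeta> \<omega> * (\<Prod>b\<in>{1..B}. g b (sqrt (real n) * (\<psi> (empirical P n (Xs n b) \<omega>) - \<psi> (empirical P n X \<omega>)))) \<partial>M) =
    (\<integral>\<omega>. \<zeta> \<omega> * (\<Prod>b\<in>{1..B}. integral\<^sup>L (boot_law P \<psi> n (empirical P n X \<omega>)) (g b)) \<partial>M)"
proof -
  let ?E = "empirical P n X" and ?I = "{1..B} \<times> {..<n}"
  let ?G = "\<lambda>\<omega> b v. g b (sqrt (real n) * (\<psi> (emp P n v) - \<psi> (?E \<omega>)))"
  let ?f = "\<lambda>(\<omega>, v). \<zeta> \<omega> * (\<Prod>b\<in>{1..B}. ?G \<omega> b (\<lambda>j\<in>{..<n}. v (b, j)))"
  let ?T = "data_algebra n \<Otimes>\<^sub>M PiM ?I (\<lambda>_. P)"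
  note [measurable] = g(1)
  have [measurable]: "(\<lambda>x. \<psi> (?E (fst x))) \<in> borel_measurable ?T"
    by (rule measurable_compose[OF measurable_fst measurable_compose[OF empirical_data_measurable[OF n] measurable_functional]])
  have [measurable]: "(\<lambda>x. \<zeta> (fst x)) \<in> borel_measurable ?T"
    by (rule measurable_compose[OF measurable_fst \<zeta>(1)])
  have fm: "?f \<in> borel_measurable ?T"
    unfolding case_prod_beta
  proof (intro borel_measurable_times borel_measurable_prod)
    fix b assume b: "b \<in> {1..B}"
    have [measurable]: "(\<lambda>x. \<psi> (emp P n (\<lambda>j\<in>{..<n}. snd x (b, j)))) \<in> borel_measurable ?T"
      by (rule measurable_compose[OF measurable_compose[OF measurable_snd block_measurable[OF b]] psi_emp_measurable[OF n]])
    show "(\<lambda>x. ?G (fst x) b (\<lambda>j\<in>{..<n}. snd x (b, j))) \<in> borel_measurable ?T" by measurable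
  qed measurable
  have main: "(\<integral>\<omega>. ?f (\<omega>, \<lambda>(b, j)\<in>?I. Xs n b j \<omega>) \<partial>M) = (\<integral>\<omega>. (\<integral>v. ?f (\<omega>, v) \<partial>PiM ?I (\<lambda>_. ?E \<omega>)) \<partial>M)"
  proof (rule integral_resamples[OF n fm])
    show "norm (?f x) \<le> 1" for x
      using \<zeta>(2) g(2)
      by (cases x) (auto simp: norm_mult prod_norm[symmetric] intro!: mult_le_one prod_le_1 prod_nonneg)
  qed
  have lhs: "?f (\<omega>, \<lambda>(b, j)\<in>?I. Xs n b j \<omega>) = \<zeta> \<omega> *
      (\<Prod>b\<in>{1..B}. g b (sqrt (real n) * (\<psi> (empirical P n (Xs n b) \<omega>) - \<psi> (?E \<omega>))))" for \<omega>
  proof -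
    have "emp P n (\<lambda>j\<in>{..<n}. (\<lambda>(b, j)\<in>?I. Xs n b j \<omega>) (b, j)) = empirical P n (Xs n b) \<omega>" if "b \<in> {1..B}" for b
    proof -
      have "(\<lambda>j\<in>{..<n}. (\<lambda>(b, j)\<in>?I. Xs n b j \<omega>) (b, j)) = (\<lambda>j\<in>{..<n}. Xs n b j \<omega>)"
        using that by (auto simp: restrict_def fun_eq_iff)
      then show ?thesis by (simp add: emp_restrict empirical_eq_emp)
    qed
    then show ?thesis by (auto intro!: prod.cong)
  qed
  have rhs: "(\<integral>v. ?f (\<omega>, v) \<partial>PiM ?I (\<lambda>_. ?E \<omega>)) = \<zeta> \<omega> * (\<Prod>b\<in>{1..B}. integral\<^sup>L (boot_law P \<psi> n (?E \<omega>)) (g b))"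
    if \<omega>: "\<omega> \<in> space M" for \<omega>
  proof -
    have Q: "?E \<omega> \<in> space (prob_algebra P)" by (rule space_prob_algebra_empirical[OF n \<omega>])
    have sQ: "sets (PiM {..<n} (\<lambda>_. ?E \<omega>)) = sets (PiM {..<n} (\<lambda>_. P))"
      using Q by (intro sets_PiM_cong) (auto simp: space_prob_algebra)
    have "(\<integral>v. (\<Prod>b\<in>{1..B}. ?G \<omega> b (\<lambda>j\<in>{..<n}. v (b, j))) \<partial>PiM ?I (\<lambda>_. ?E \<omega>)) =
       (\<Prod>b\<in>{1..B}. integral\<^sup>L (PiM {..<n} (\<lambda>_. ?E \<omega>)) (?G \<omega> b))"
    proof (rule integral_PiM_blocks)
      show "prob_space (?E \<omega>)" using Q by (simp add: space_prob_algebra)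
      note [measurable] = psi_emp_measurable[OF n]
      show "?G \<omega> b \<in> borel_measurable (PiM {..<n} (\<lambda>_. ?E \<omega>))" for b
        unfolding measurable_cong_sets[OF sQ refl] by measurable
    qed (use g(2) n in auto)
    also have "\<dots> = (\<Prod>b\<in>{1..B}. integral\<^sup>L (boot_law P \<psi> n (?E \<omega>)) (g b))"
      by (intro prod.cong refl boot_law_integral[OF n Q g(1), symmetric])
    finally show ?thesis by simp
  qed
  show ?thesis
    using main unfolding lhs by (simp only: rhs cong: Bochner_Integration.integral_cong)
qed

text \<open>Resampling is specified given the data points, whereas the conditional probability here
  is given the empirical distribution alone. The bootstrap law depends on the data only through the
  empirical distribution, so it is the answer for the coarser condition as well.\<close>

lemma cond_prob_resample:
  assumes n: "n > 0" and b: "b \<in> {1..B}"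
  shows "AE \<omega> in M. cond_prob_given M (vimage_algebra (space M) (empirical P n X) (prob_algebra P))
      (\<lambda>\<omega>. sqrt (real n) * (\<psi> (empirical P n (Xs n b) \<omega>) - \<psi> (empirical P n X \<omega>)) \<le> x) \<omega> =
    cdf (boot_law P \<psi> n (empirical P n X \<omega>)) x"
proof -
  let ?E = "empirical P n X" and ?I = "{1..B} \<times> {..<n}"
  let ?G = "vimage_algebra (space M) ?E (prob_algebra P)"
  let ?U = "\<lambda>\<omega>. sqrt (real n) * (\<psi> (empirical P n (Xs n b) \<omega>) - \<psi> (?E \<omega>))"
  let ?c = "\<lambda>\<omega>. cdf (boot_law P \<psi> n (?E \<omega>)) x"
  note EM = empirical_X_measurable[OF n]
  interpret G: finite_measure_subalgebra M ?G
    by unfold_locales (rule subalgebra_vimage_algebra[OF EM])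
  have EG: "?E \<in> ?G \<rightarrow>\<^sub>M prob_algebra P"
    by (intro measurable_vimage_algebra1 Pi_I measurable_space[OF EM])
  have cQ: "(\<lambda>Q. cdf (boot_law P \<psi> n Q) x) \<in> borel_measurable (prob_algebra P)"
    unfolding cdf_def by (rule measurable_compose[OF boot_law_measurable[OF n] measurable_measure_prob_algebra]) simp
  have cG: "?c \<in> borel_measurable ?G" by (rule measurable_compose[OF EG cQ])
  have cM: "?c \<in> borel_measurable M" by (rule measurable_compose[OF EM cQ])
  note [measurable] = measurable_compose[OF EM measurable_functional]
    measurable_compose[OF empirical_Xs_measurable[OF n b] measurable_functional]
  have Um: "{\<omega>\<in>space M. ?U \<omega> \<le> x} \<in> sets M" by measurable
  have c01: "\<bar>?c \<omega>\<bar> \<le> 1" if "\<omega> \<in> space M" for \<omega>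
    using real_distribution_boot_law[OF n space_prob_algebra_empirical[OF n that]]
    by (auto simp: cdf_def real_distribution_def prob_space.prob_le_1)
  show ?thesis
    unfolding cond_prob_given_def
  proof (rule G.real_cond_exp_charact)
    show iU: "integrable M (indicator {\<omega>\<in>space M. ?U \<omega> \<le> x} :: _ \<Rightarrow> real)"
      using Um by (intro integrable_const_bound[where B=1]) (auto simp: indicator_def)
    show ic: "integrable M ?c"
      using c01 cM by (intro integrable_const_bound[where B=1]) auto
    show "?c \<in> borel_measurable ?G" by (rule cG)
    fix A assume A: "A \<in> sets ?G"
    then have AM: "A \<in> sets M" using G.subalg by (auto simp: subalgebra_def)
    \<comment> \<open>Events determined by the empirical distribution are determined by the data, so
      they may be used as test events in \<open>integral_boot_product\<close>.\<close>
    have AD: "A \<in> sets (data_algebra n)"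
    proof -
      obtain T where "T \<in> sets (prob_algebra P)" "A = ?E -` T \<inter> space M"
        using A by (auto simp: sets_vimage_algebra2[OF measurable_space[OF EM, THEN Pi_I]])
      then show ?thesis using measurable_sets[OF empirical_data_measurable[OF n], of T] by simp
    qed
    \<comment> \<open>The factors of the other resamples are constantly 1, which reduces the product
      to resample \<open>b\<close>.\<close>
    let ?g = "\<lambda>b' y. if b' = b then complex_of_real (indicator {..x} y) else 1"
    have int_g: "integral\<^sup>L (boot_law P \<psi> n (?E \<omega>)) (?g b') = (if b' = b then complex_of_real (?c \<omega>) else 1)"
      if "\<omega> \<in> space M" for b' \<omega>
    proof -
      interpret L: real_distribution "boot_law P \<psi> n (?E \<omega>)"
        by (rule real_distribution_boot_law[OF n space_prob_algebra_empirical[OF n that]])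
      show ?thesis
        using L.prob_space by (simp add: cdf_def integral_complex_of_real del: L.space_eq_univ)
    qed
    have one: "(\<Prod>b'\<in>{1..B}. if b' = b then u else 1) = u" for u :: complex
      using b by simp
    have prod_eq: "(\<integral>\<omega>. complex_of_real (indicator A \<omega>) * (\<Prod>b'\<in>{1..B}. ?g b' (sqrt (real n) * (\<psi> (empirical P n (Xs n b') \<omega>) - \<psi> (?E \<omega>)))) \<partial>M) =
      (\<integral>\<omega>. complex_of_real (indicator A \<omega>) * (\<Prod>b'\<in>{1..B}. integral\<^sup>L (boot_law P \<psi> n (?E \<omega>)) (?g b')) \<partial>M)"
    proof (rule integral_boot_product[OF n])
      show "(\<lambda>\<omega>. complex_of_real (indicator A \<omega>)) \<in> borel_measurable (data_algebra n)"
        using AD by measurable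
    qed (auto simp: indicator_def)
    have ind: "(\<Prod>b'\<in>{1..B}. ?g b' (sqrt (real n) * (\<psi> (empirical P n (Xs n b') \<omega>) - \<psi> (?E \<omega>)))) =
        complex_of_real (indicator {\<omega>\<in>space M. ?U \<omega> \<le> x} \<omega>)" if "\<omega> \<in> space M" for \<omega>
    proof -
      have "(\<Prod>b'\<in>{1..B}. ?g b' (sqrt (real n) * (\<psi> (empirical P n (Xs n b') \<omega>) - \<psi> (?E \<omega>)))) =
          (\<Prod>b'\<in>{1..B}. if b' = b then complex_of_real (indicator {..x} (?U \<omega>)) else 1)"
        by (intro prod.cong) auto
      then show ?thesis unfolding one using that by (simp add: indicator_def)
    qed
    have main: "(\<integral>\<omega>. complex_of_real (indicator A \<omega> * indicator {\<omega>\<in>space M. ?U \<omega> \<le> x} \<omega>) \<partial>M) =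
        (\<integral>\<omega>. complex_of_real (indicator A \<omega> * ?c \<omega>) \<partial>M)"
      using prod_eq by (simp only: ind int_g one of_real_mult cong: Bochner_Integration.integral_cong)
    have "complex_of_real (\<integral>\<omega>. indicator A \<omega> * indicator {\<omega>\<in>space M. ?U \<omega> \<le> x} \<omega> \<partial>M) = complex_of_real (\<integral>\<omega>. indicator A \<omega> * ?c \<omega> \<partial>M)"
      using main by (simp only: integral_complex_of_real)
    then show "(\<integral>\<omega>\<in>A. indicator {\<omega>\<in>space M. ?U \<omega> \<le> x} \<omega> \<partial>M) = (\<integral>\<omega>\<in>A. ?c \<omega> \<partial>M)"
      by (simp add: set_lebesgue_integral_def)
  qed
qed

end

section \<open>Characteristic functions in the limit\<close>

context nested_sampling
begin

lemma real_distribution_N: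
  assumes "Q \<in> space (prob_algebra P)"
  shows "real_distribution (N Q)"
  using measurable_space[OF noise_kernel assms]
  by (auto simp: space_prob_algebra real_distribution_def real_distribution_axioms_def)

lemma run_var_measurable: "run_var N \<in> borel_measurable (prob_algebra P)"
proof -
  have [measurable]: "(\<lambda>Q. \<integral>z. z \<partial>N Q) \<in> borel_measurable (prob_algebra P)"
    by (rule measurable_compose[OF measurable_prob_algebraD[OF noise_kernel] integral_measurable_subprob_algebra]) simp
  show ?thesis
    unfolding run_var_def
    by (rule nn_integral_measurable_subprob_algebra2[OF _ measurable_prob_algebraD[OF noise_kernel]]) measurable
qed

lemma run_third_moment_measurable: "run_third_moment \<psi> N \<in> borel_measurable (prob_algebra P)"
proof -
  note [measurable] = measurable_functional
  show ?thesis
    unfolding run_third_moment_def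
    by (rule nn_integral_measurable_subprob_algebra2[OF _ measurable_prob_algebraD[OF noise_kernel]]) measurable
qed

text \<open>A deviation of the characteristic function at \<open>t\<close> forces a deviation of the
  cdf at one of finitely many fixed points. A union bound over these points then reduces the claim
  to the hypothesis \<open>clt\<close>.\<close>

lemma boot_char_tendsto:
  assumes b: "b \<in> {1..B}" and \<sigma>: "\<sigma> > 0" and \<epsilon>: "\<epsilon> > 0"
    and clt: "\<And>x. conv_in_prob M
           (\<lambda>n. cond_prob_given M
              (vimage_algebra (space M) (empirical P n X) (prob_algebra P))
              (\<lambda>\<omega>. sqrt (real n) * (\<psi> (empirical P n (Xs n b) \<omega>) - \<psi> (empirical P n X \<omega>)) \<le> x))
           (cdf (centered_normal \<sigma>) x)"
  shows "(\<lambda>n. measure M {\<omega>\<in>space M. cmod (char (boot_law P \<psi> n (empirical P n X \<omega>)) t - char (centered_normal \<sigma>) t) \<ge> \<epsilon>}) \<longlonglongrightarrow> 0"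
proof -
  let ?c = "\<lambda>n x. cond_prob_given M (vimage_algebra (space M) (empirical P n X) (prob_algebra P))
      (\<lambda>\<omega>. sqrt (real n) * (\<psi> (empirical P n (Xs n b) \<omega>) - \<psi> (empirical P n X \<omega>)) \<le> x)"
  let ?L = "\<lambda>n \<omega>. boot_law P \<psi> n (empirical P n X \<omega>)"
  let ?\<nu> = "centered_normal \<sigma>"
  let ?F = "\<lambda>n. {\<omega>\<in>space M. cmod (char (?L n \<omega>) t - char ?\<nu> t) \<ge> \<epsilon>}"
  obtain S \<delta> where S: "finite S" "\<delta> > 0" and close: "\<And>\<mu>. real_distribution \<mu> \<Longrightarrow> (\<forall>x\<in>S. \<bar>cdf \<mu> x - cdf ?\<nu> x\<bar> < \<delta>) \<Longrightarrow> cmod (char \<mu> t - char ?\<nu> t) < \<epsilon>"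
    using char_close_of_cdf_close[OF real_distribution_centered_normal[OF \<sigma>] measure_centered_normal_singleton \<epsilon>] by blast
  define a where "a n x = measure M {\<omega>\<in>space M. ?c n x \<omega> \<notin> ball (cdf ?\<nu> x) \<delta>}" for n x
  have "(\<lambda>n. a n x) \<longlonglongrightarrow> 0" for x
    using clt[of x] S(2) unfolding conv_in_prob_def a_def by (auto dest!: spec[of _ "ball (cdf ?\<nu> x) \<delta>"])
  then have lim: "(\<lambda>n. \<Sum>x\<in>S. a n x) \<longlonglongrightarrow> 0" by (intro tendsto_null_sum) auto
  show ?thesis
  proof (rule tendsto_sandwich[OF _ _ tendsto_const lim])
    show "\<forall>\<^sub>F n in sequentially. measure M (?F n) \<le> (\<Sum>x\<in>S. a n x)"
      using eventually_gt_at_top[of 0]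
    proof eventually_elim
      case (elim n)
      have cm: "(\<lambda>\<omega>. cdf (?L n \<omega>) x) \<in> borel_measurable M" for x
        unfolding cdf_def
        by (rule measurable_compose[OF empirical_X_measurable[OF elim] measurable_compose[OF boot_law_measurable[OF elim] measurable_measure_prob_algebra]]) simp
      define C where "C x = {\<omega>\<in>space M. cdf (?L n \<omega>) x \<notin> ball (cdf ?\<nu> x) \<delta>}" for x
      have CM: "C x \<in> sets M" for x
      proof -
        have "C x = {\<omega>\<in>space M. \<delta> \<le> \<bar>cdf ?\<nu> x - cdf (?L n \<omega>) x\<bar>}"
          by (auto simp: C_def dist_real_def)
        then show ?thesis using cm[of x] by simp
      qed
      have "?F n \<subseteq> (\<Union>x\<in>S. C x)"
      proof safe
        fix \<omega> assume \<omega>: "\<omega> \<in> space M" and far: "\<epsilon> \<le> cmod (char (?L n \<omega>) t - char ?\<nu> t)"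
        have "real_distribution (?L n \<omega>)"
          by (rule real_distribution_boot_law[OF elim space_prob_algebra_empirical[OF elim \<omega>]])
        then have "\<not> (\<forall>x\<in>S. \<bar>cdf (?L n \<omega>) x - cdf ?\<nu> x\<bar> < \<delta>)"
          using close far by (meson not_le)
        then show "\<omega> \<in> (\<Union>x\<in>S. C x)" using \<omega> by (auto simp: C_def dist_real_def abs_minus_commute not_less)
      qed
      then have "measure M (?F n) \<le> measure M (\<Union>x\<in>S. C x)"
        using CM S(1) by (intro finite_measure_mono) auto
      also have "\<dots> \<le> (\<Sum>x\<in>S. measure M (C x))"
        using CM S(1) by (intro measure_UNION_le) auto
      \<comment> \<open>The conditional probability in the hypothesis is determined only almost
        surely; at each of the finitely many points it is exchanged for the cdf of the bootstrap
        law.\<close>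
      also have "\<dots> = (\<Sum>x\<in>S. a n x)"
      proof (rule sum.cong[OF refl])
        fix x
        have [measurable]: "?c n x \<in> borel_measurable M" unfolding cond_prob_given_def by simp
        have "{\<omega>\<in>space M. ?c n x \<omega> \<notin> ball (cdf ?\<nu> x) \<delta>} = {\<omega>\<in>space M. \<delta> \<le> \<bar>cdf ?\<nu> x - ?c n x \<omega>\<bar>}"
          by (auto simp: dist_real_def)
        then have AM: "{\<omega>\<in>space M. ?c n x \<omega> \<notin> ball (cdf ?\<nu> x) \<delta>} \<in> sets M" by simp
        show "measure M (C x) = a n x"
          unfolding a_def
        proof (rule finite_measure_eq_AE[OF _ CM AM])
          show "AE \<omega> in M. (\<omega> \<in> C x) = (\<omega> \<in> {\<omega>\<in>space M. ?c n x \<omega> \<notin> ball (cdf ?\<nu> x) \<delta>})"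
            using cond_prob_resample[OF elim b, of x] by eventually_elim (simp add: C_def)
        qed
      qed
      finally show ?case .
    qed
  qed simp
qed

text \<open>When variance and third moment at the driving distribution are close to those at
  \<open>P\<close>, the deterministic bound makes the deviation smaller than \<epsilon>. A deviation
  thus lies in one of two exceptional events whose probabilities vanish.\<close>

lemma noise_char_tendsto:
  fixes D :: "nat \<Rightarrow> 'w \<Rightarrow> 'a measure" and m :: "nat \<Rightarrow> nat" and t :: real
  assumes D: "\<And>n. n > 0 \<Longrightarrow> D n \<in> M \<rightarrow>\<^sub>M prob_algebra P"
    and var: "conv_in_prob M (\<lambda>n \<omega>. run_var N (D n \<omega>)) (run_var N P)"
    and third: "conv_in_prob M (\<lambda>n \<omega>. run_third_moment \<psi> N (D n \<omega>)) (run_third_moment \<psi> N P)"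
    and v: "0 < run_var N P" "run_var N P < \<infinity>" and \<kappa>: "run_third_moment \<psi> N P < \<infinity>"
    and ratio: "(\<lambda>n. real (m n) / real n) \<longlonglongrightarrow> p" and p: "p > 0" and \<epsilon>: "\<epsilon> > 0"
  defines "s \<equiv> \<lambda>n. t * sqrt (real n) / real (m n)"
  shows "(\<lambda>n. measure M {\<omega>\<in>space M. cmod ((iexp (- s n * \<psi> (D n \<omega>)) * char (N (D n \<omega>)) (s n)) ^ m n
      - complex_of_real (exp (- (t\<^sup>2 * enn2real (run_var N P) / (2 * p))))) \<ge> \<epsilon>}) \<longlonglongrightarrow> 0"
proof -
  let ?F = "\<lambda>n. {\<omega>\<in>space M. cmod ((iexp (- s n * \<psi> (D n \<omega>)) * char (N (D n \<omega>)) (s n)) ^ m n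
    - complex_of_real (exp (- (t\<^sup>2 * enn2real (run_var N P) / (2 * p))))) \<ge> \<epsilon>}"
  define V where "V = enn2real (run_var N P)"
  define K where "K = enn2real (run_third_moment \<psi> N P)"
  have V: "run_var N P = ennreal V" "V > 0" using v by (auto simp: V_def enn2real_positive_iff)
  have K: "run_third_moment \<psi> N P = ennreal K" "K \<ge> 0" using \<kappa> by (auto simp: K_def)
  obtain \<delta> where \<delta>: "\<delta> > 0" and ev: "\<forall>\<^sub>F n in sequentially. \<forall>V' K'. 0 \<le> V' \<longrightarrow> \<bar>V' - V\<bar> < \<delta> \<longrightarrow> 0 \<le> K' \<longrightarrow> K' < K + 1 \<longrightarrow>
       real (m n) * \<bar>s n\<bar> ^ 3 * K' / 6 + real (m n) * s n ^ 4 * V'\<^sup>2 / 8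
         + \<bar>exp (- (real (m n) * (s n)\<^sup>2 * V' / 2)) - exp (- (t\<^sup>2 * V / (2 * p)))\<bar> < \<epsilon>"
    unfolding s_def by (rule averaged_char_bound_tendsto[OF ratio p less_imp_le[OF V(2)] K(2) \<epsilon>, of t])
  \<comment> \<open>Membership in these neighbourhoods also makes the random moments finite. If
    \<delta> exceeds \<open>V\<close>, the left end of \<open>U1\<close> is 0, and \<open>V\<close>
    still lies inside because it is positive.\<close>
  define U1 where "U1 = {ennreal (V - \<delta>)<..<ennreal (V + \<delta>)}"
  define U2 where "U2 = {..<ennreal (K + 1)}"
  let ?B1 = "\<lambda>n. {\<omega>\<in>space M. run_var N (D n \<omega>) \<notin> U1}"
  let ?B2 = "\<lambda>n. {\<omega>\<in>space M. run_third_moment \<psi> N (D n \<omega>) \<notin> U2}"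
  have "open U1" "open U2" by (auto simp: U1_def U2_def)
  moreover have "ennreal V \<in> U1" "ennreal K \<in> U2"
    using V K \<delta> by (auto simp: U1_def U2_def ennreal_less_iff intro!: ennreal_lessI)
  ultimately have "(\<lambda>n. measure M (?B1 n)) \<longlonglongrightarrow> 0" "(\<lambda>n. measure M (?B2 n)) \<longlonglongrightarrow> 0"
    using var third unfolding conv_in_prob_def V(1) K(1) by auto
  from tendsto_add[OF this] have lim: "(\<lambda>n. measure M (?B1 n) + measure M (?B2 n)) \<longlonglongrightarrow> 0" by simp
  show ?thesis
  proof (rule tendsto_sandwich[OF _ _ tendsto_const lim])
    show "\<forall>\<^sub>F n in sequentially. measure M (?F n) \<le> measure M (?B1 n) + measure M (?B2 n)"
      using ev eventually_gt_at_top[of 0]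
    proof eventually_elim
      case (elim n)
      have [measurable]: "(\<lambda>\<omega>. run_var N (D n \<omega>)) \<in> borel_measurable M"
        by (rule measurable_compose[OF D[OF elim(2)] run_var_measurable])
      have [measurable]: "(\<lambda>\<omega>. run_third_moment \<psi> N (D n \<omega>)) \<in> borel_measurable M"
        by (rule measurable_compose[OF D[OF elim(2)] run_third_moment_measurable])
      have [measurable]: "U1 \<in> sets borel" "U2 \<in> sets borel" by (auto simp: U1_def U2_def)
      have BM: "?B1 n \<in> sets M" "?B2 n \<in> sets M" by measurable
      have "?F n \<subseteq> ?B1 n \<union> ?B2 n"
      proof (rule subsetI, rule ccontr)
        fix \<omega> assume bad: "\<omega> \<in> ?F n"
          and "\<omega> \<notin> ?B1 n \<union> ?B2 n"
        then have \<omega>: "\<omega> \<in> space M" and u: "run_var N (D n \<omega>) \<in> U1" "run_third_moment \<psi> N (D n \<omega>) \<in> U2" by auto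
        let ?Q = "D n \<omega>"
        have Q: "?Q \<in> space (prob_algebra P)" using measurable_space[OF D[OF elim(2)] \<omega>] .
        obtain V' where V': "run_var N ?Q = ennreal V'" "V' \<ge> 0"
          using u(1) by (cases "run_var N ?Q") (auto simp: U1_def)
        obtain K' where K': "run_third_moment \<psi> N ?Q = ennreal K'" "K' \<ge> 0"
          using u(2) by (cases "run_third_moment \<psi> N ?Q") (auto simp: U2_def)
        have less: "a < b" if "ennreal a < ennreal b" for a b
          using that by (meson ennreal_leI not_le)
        have "ennreal V' < ennreal (V + \<delta>)" "ennreal (V - \<delta>) < ennreal V'"
          using u(1) unfolding V'(1) U1_def by auto
        then have Vd: "\<bar>V' - V\<bar> < \<delta>" using less[of V' "V + \<delta>"] less[of "V - \<delta>" V'] by linarith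
        have "ennreal K' < ennreal (K + 1)"
          using u(2) unfolding K'(1) U2_def by auto
        then have Kd: "K' < K + 1" by (rule less)
        have un: "integrable (N ?Q) (\<lambda>y. y)" "(\<integral>y. y \<partial>N ?Q) = \<psi> ?Q" using unbiased[OF Q] by auto
        have b1: "cmod ((iexp (- s n * \<psi> ?Q) * char (N ?Q) (s n)) ^ m n - complex_of_real (exp (- (real (m n) * (s n)\<^sup>2 * V' / 2)))) \<le>
           real (m n) * \<bar>s n\<bar> ^ 3 * K' / 6 + real (m n) * s n ^ 4 * V'\<^sup>2 / 8"
        proof (rule averaged_char_bound[OF real_distribution_N[OF Q] un])
          show "(\<integral>\<^sup>+y. ennreal ((y - \<psi> ?Q)\<^sup>2) \<partial>N ?Q) = ennreal V'"
            using V'(1) by (simp add: run_var_def un(2))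
          show "(\<integral>\<^sup>+y. ennreal (\<bar>y - \<psi> ?Q\<bar> ^ 3) \<partial>N ?Q) = ennreal K'"
            using K'(1) by (simp add: run_third_moment_def)
        qed (use V' K' in auto)
        have b2: "cmod (complex_of_real (exp (- (real (m n) * (s n)\<^sup>2 * V' / 2))) - complex_of_real (exp (- (t\<^sup>2 * V / (2 * p))))) =
           \<bar>exp (- (real (m n) * (s n)\<^sup>2 * V' / 2)) - exp (- (t\<^sup>2 * V / (2 * p)))\<bar>"
          by (subst of_real_diff[symmetric], subst norm_of_real) simp
        have "cmod ((iexp (- s n * \<psi> ?Q) * char (N ?Q) (s n)) ^ m n - complex_of_real (exp (- (t\<^sup>2 * V / (2 * p))))) \<le>
          real (m n) * \<bar>s n\<bar> ^ 3 * K' / 6 + real (m n) * s n ^ 4 * V'\<^sup>2 / 8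
           + \<bar>exp (- (real (m n) * (s n)\<^sup>2 * V' / 2)) - exp (- (t\<^sup>2 * V / (2 * p)))\<bar>"
          by (rule norm_diff_triangle_le[OF b1 eq_refl[OF b2]])
        also have "\<dots> < \<epsilon>" using elim(1) V'(2) Vd K'(2) Kd by blast
        finally show False using bad by (simp add: V_def)
      qed
      then have "measure M (?F n) \<le> measure M (?B1 n \<union> ?B2 n)"
        using BM by (intro finite_measure_mono) auto
      also have "\<dots> \<le> measure M (?B1 n) + measure M (?B2 n)" using BM by (rule measure_Un_le)
      finally show ?case .
    qed
  qed simp
qed

end

section \<open>The joint characteristic function of the scaled errors\<close>

context nested_sampling
begin

definition root_n_error :: "nat \<Rightarrow> nat \<Rightarrow> 'w \<Rightarrow> real" where
  "root_n_error n k \<omega> = sqrt (real n) *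
     (run_mean (runs_number n k) (Y n k) \<omega> - (if k = 0 then \<psi> P else \<psi> (empirical P n X \<omega>)))"

lemma run_mean_measurable:
  assumes "n > 0" "k \<in> {0..B}"
  shows "run_mean (runs_number n k) (Y n k) \<in> borel_measurable M"
  unfolding run_mean_def using Y_measurable[OF assms]
  by (intro borel_measurable_divide borel_measurable_sum) auto

lemma root_n_error_measurable:
  assumes k: "k \<in> {0..B}"
  shows "root_n_error n k \<in> borel_measurable M"
proof (cases "n = 0")
  case True
  then show ?thesis by (simp add: root_n_error_def[abs_def])
next
  case False
  then have n: "n > 0" by simp
  note [measurable] = run_mean_measurable[OF n k] measurable_compose[OF empirical_X_measurable[OF n] measurable_functional]
  show ?thesis unfolding root_n_error_def by measurable
qed

lemma iexp_sum: "finite I \<Longrightarrow> iexp (\<Sum>k\<in>I. f k) = (\<Prod>k\<in>I. iexp (f k))"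
  by (simp add: sum_distrib_left exp_sum)

lemma iexp_power: "iexp x ^ n = iexp (real n * x)"
  by (simp add: exp_of_nat_mult[symmetric] mult_ac)

text \<open>Each error is split at the noise-free value of \<psi> at its driving distribution, into
  the averaging error of the runs and the sampling error. The identity is exact for every admissible
  \<open>n\<close>.\<close>

lemma char_root_n_error:
  fixes t :: "nat \<Rightarrow> real"
  assumes n: "n > 0" and R: "R0 n > 0" "R n > 0"
  defines "s \<equiv> \<lambda>k. t k * sqrt (real n) / real (runs_number n k)"
  shows "(\<integral>\<omega>. iexp (\<Sum>k\<in>{0..B}. t k * root_n_error n k \<omega>) \<partial>M) =
    (\<integral>\<omega>. (iexp (t 0 * sqrt (real n) * (\<psi> (empirical P n X \<omega>) - \<psi> P)) *
        (\<Prod>b\<in>{1..B}. iexp (t b * (sqrt (real n) * (\<psi> (empirical P n (Xs n b) \<omega>) - \<psi> (empirical P n X \<omega>)))))) *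
      (\<Prod>k\<in>{0..B}. (iexp (- s k * \<psi> (driving P X Xs n k \<omega>)) * char (N (driving P X Xs n k \<omega>)) (s k)) ^ runs_number n k) \<partial>M)"
proof -
  let ?W = "\<lambda>\<omega>. iexp (t 0 * sqrt (real n) * (\<psi> (empirical P n X \<omega>) - \<psi> P)) *
        (\<Prod>b\<in>{1..B}. iexp (t b * (sqrt (real n) * (\<psi> (empirical P n (Xs n b) \<omega>) - \<psi> (empirical P n X \<omega>)))))"
  let ?D = "\<lambda>\<omega>. \<lambda>k\<in>{0..B}. driving P X Xs n k \<omega>"
  let ?c = "\<lambda>k Q. if k = 0 then \<psi> P else \<psi> Q"
  \<comment> \<open>The factor produced by the centres. It depends on the driving distributions only
    through index 0, the empirical distribution of the data.\<close>
  define \<zeta> where "\<zeta> d = iexp (- (\<Sum>k\<in>{0..B}. t k * sqrt (real n) * ?c k (d 0)))" for d :: "nat \<Rightarrow> 'a measure"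
  have rn: "real (runs_number n k) > 0" for k using R by simp
  have ins: "{0..B} = insert 0 {1..B}" by auto
  have \<zeta>m: "\<zeta> \<in> borel_measurable (PiM {0..B} (\<lambda>_. prob_algebra P))"
  proof -
    have [measurable]: "(\<lambda>d. \<psi> (d 0)) \<in> borel_measurable (PiM {0..B} (\<lambda>_. prob_algebra P))"
      by (rule measurable_compose[OF _ measurable_functional]) (rule measurable_component_singleton, simp)
    have "(\<lambda>d. ?c k (d 0)) \<in> borel_measurable (PiM {0..B} (\<lambda>_. prob_algebra P))" for k
      by (cases "k = 0") auto
    then have [measurable]: "(\<lambda>d. \<Sum>k\<in>{0..B}. t k * sqrt (real n) * ?c k (d 0)) \<in> borel_measurable (PiM {0..B} (\<lambda>_. prob_algebra P))"
      by (intro borel_measurable_sum borel_measurable_times borel_measurable_const)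
    show ?thesis unfolding \<zeta>_def by measurable
  qed
  have \<zeta>1: "norm (\<zeta> d) \<le> 1" for d by (simp add: \<zeta>_def)
  have D0: "?D \<omega> 0 = empirical P n X \<omega>" for \<omega> by (simp add: driving_def)
  have lhs: "iexp (\<Sum>k\<in>{0..B}. t k * root_n_error n k \<omega>) =
      \<zeta> (?D \<omega>) * (\<Prod>k\<in>{0..B}. \<Prod>r<runs_number n k. iexp (s k * Y n k r \<omega>))" for \<omega>
  proof -
    have "t k * root_n_error n k \<omega> = (\<Sum>r<runs_number n k. s k * Y n k r \<omega>) - t k * sqrt (real n) * ?c k (?D \<omega> 0)" for k
      unfolding root_n_error_def run_mean_def D0 sum_distrib_left[symmetric]
      by (simp add: s_def right_diff_distrib)
    then have "(\<Sum>k\<in>{0..B}. t k * root_n_error n k \<omega>) =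
       - (\<Sum>k\<in>{0..B}. t k * sqrt (real n) * ?c k (?D \<omega> 0)) + (\<Sum>k\<in>{0..B}. \<Sum>r<runs_number n k. s k * Y n k r \<omega>)"
      by (simp add: sum_subtractf)
    then have "iexp (\<Sum>k\<in>{0..B}. t k * root_n_error n k \<omega>) = \<zeta> (?D \<omega>) * iexp (\<Sum>k\<in>{0..B}. \<Sum>r<runs_number n k. s k * Y n k r \<omega>)"
      unfolding \<zeta>_def by (simp only: of_real_add distrib_left exp_add)
    then show ?thesis by (simp only: iexp_sum finite_atLeastAtMost finite_lessThan)
  qed
  have rhs: "\<zeta> (?D \<omega>) * (\<Prod>k\<in>{0..B}. char (N (driving P X Xs n k \<omega>)) (s k) ^ runs_number n k) =
     (?W \<omega>) *
      (\<Prod>k\<in>{0..B}. (iexp (- s k * \<psi> (driving P X Xs n k \<omega>)) * char (N (driving P X Xs n k \<omega>)) (s k)) ^ runs_number n k)" for \<omega>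
  proof -
    let ?d = "\<lambda>k. \<psi> (driving P X Xs n k \<omega>)"
    have p: "iexp (- s k * ?d k) ^ runs_number n k = iexp (- (t k * sqrt (real n) * ?d k))" for k
    proof -
      have "real (runs_number n k) * (- s k * ?d k) = - (t k * sqrt (real n) * ?d k)"
        unfolding s_def using rn[of k] by (simp add: field_simps)
      then show ?thesis unfolding iexp_power by (simp only:)
    qed
    \<comment> \<open>\<open>e k\<close> is the part of the exponent that carries the sampling
      error. The noise-free values subtracted from the centres here are restored by the powers of
      the centring exponentials in the noise factor.\<close>
    define e where "e k = (if k = 0 then t 0 * sqrt (real n) * (?d 0 - \<psi> P) else t k * (sqrt (real n) * (?d k - ?d 0)))" for k
    have W: "?W \<omega> = (\<Prod>k\<in>{0..B}. iexp (e k))"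
    proof -
      have "(\<Prod>k\<in>{0..B}. iexp (e k)) = iexp (e 0) * (\<Prod>k\<in>{1..B}. iexp (e k))"
        unfolding ins by (rule prod.insert) auto
      moreover have "(\<Prod>k\<in>{1..B}. iexp (e k)) = (\<Prod>b\<in>{1..B}. iexp (t b * (sqrt (real n) * (\<psi> (empirical P n (Xs n b) \<omega>) - \<psi> (empirical P n X \<omega>)))))"
        by (intro prod.cong refl) (auto simp: e_def driving_def)
      ultimately show ?thesis by (simp add: e_def driving_def)
    qed
    have "\<zeta> (?D \<omega>) = (\<Prod>k\<in>{0..B}. iexp (e k) * iexp (- (t k * sqrt (real n) * ?d k)))"
    proof -
      have "\<zeta> (?D \<omega>) = iexp (\<Sum>k\<in>{0..B}. e k + - (t k * sqrt (real n) * ?d k))"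
        unfolding \<zeta>_def sum_negf[symmetric]
        by (intro arg_cong[where f=iexp] sum.cong) (auto simp: e_def algebra_simps driving_def)
      then show ?thesis by (simp only: iexp_sum finite_atLeastAtMost of_real_add distrib_left exp_add)
    qed
    then show ?thesis
      unfolding W power_mult_distrib p by (simp only: prod.distrib mult_ac)
  qed
  show ?thesis
    unfolding lhs integral_runs[OF n \<zeta>m \<zeta>1] rhs ..
qed

lemma char_root_n_error_tendsto:
  fixes \<sigma> p0 p :: real and t :: "nat \<Rightarrow> real"
  assumes \<sigma>: "\<sigma> > 0"
    and clt_data:
      "weak_conv_m
         (\<lambda>n. distr M borel (\<lambda>\<omega>. sqrt (real n) * (\<psi> (empirical P n X \<omega>) - \<psi> P)))
         (centered_normal \<sigma>)"
    and clt_resample: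
      "\<And>b x. b \<in> {1..B} \<Longrightarrow>
         conv_in_prob M
           (\<lambda>n. cond_prob_given M
              (vimage_algebra (space M) (empirical P n X) (prob_algebra P))
              (\<lambda>\<omega>. sqrt (real n) * (\<psi> (empirical P n (Xs n b) \<omega>) - \<psi> (empirical P n X \<omega>)) \<le> x))
           (cdf (centered_normal \<sigma>) x)"
    and var: "\<And>k. k \<in> {0..B} \<Longrightarrow> conv_in_prob M (\<lambda>n \<omega>. run_var N (driving P X Xs n k \<omega>)) (run_var N P)"
    and third: "\<And>k. k \<in> {0..B} \<Longrightarrow>
       conv_in_prob M (\<lambda>n \<omega>. run_third_moment \<psi> N (driving P X Xs n k \<omega>)) (run_third_moment \<psi> N P)"
    and var_P: "0 < run_var N P" "run_var N P < \<infinity>"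
    and third_P: "run_third_moment \<psi> N P < \<infinity>"
    and top: "filterlim R0 at_top sequentially" "filterlim R at_top sequentially"
    and ratio: "(\<lambda>n. real (R0 n) / real n) \<longlonglongrightarrow> p0" "(\<lambda>n. real (R n) / real n) \<longlonglongrightarrow> p"
    and p: "0 < p0" "0 < p"
  defines "v \<equiv> \<lambda>k. \<sigma>\<^sup>2 + enn2real (run_var N P) / (if k = 0 then p0 else p)"
  shows "(\<lambda>n. \<integral>\<omega>. iexp (\<Sum>k\<in>{0..B}. t k * root_n_error n k \<omega>) \<partial>M) \<longlonglongrightarrow>
     (\<Prod>k\<in>{0..B}. complex_of_real (exp (- (v k * (t k)\<^sup>2 / 2))))"
proof -
  let ?E = "\<lambda>n. empirical P n X"
  let ?\<tau> = "enn2real (run_var N P)"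
  define W0 where "W0 n \<omega> = iexp (t 0 * sqrt (real n) * (\<psi> (?E n \<omega>) - \<psi> P))" for n \<omega>
  define W where "W n \<omega> = W0 n \<omega> * (\<Prod>b\<in>{1..B}. iexp (t b * (sqrt (real n) * (\<psi> (empirical P n (Xs n b) \<omega>) - \<psi> (?E n \<omega>)))))" for n \<omega>
  define s where "s n k = t k * sqrt (real n) / real (runs_number n k)" for n k
  define Z where "Z n k \<omega> = (iexp (- s n k * \<psi> (driving P X Xs n k \<omega>)) * char (N (driving P X Xs n k \<omega>)) (s n k)) ^ runs_number n k" for n k \<omega>
  define pk where "pk k = (if k = 0 then p0 else p)" for k :: nat
  define c where "c k = complex_of_real (exp (- ((t k)\<^sup>2 * ?\<tau> / (2 * pk k))))" for k
  have pos: "\<forall>\<^sub>F n in sequentially. n > 0" by (rule eventually_gt_at_top)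
  have top_pos: "\<forall>\<^sub>F n in sequentially. R0 n > 0" "\<forall>\<^sub>F n in sequentially. R n > 0"
    using top[unfolded filterlim_at_top, THEN spec[of _ 1]] by (simp_all add: Suc_le_eq)
  have EM: "(\<lambda>\<omega>. \<psi> (?E n \<omega>)) \<in> borel_measurable M" if "n > 0" for n
    by (rule measurable_compose[OF empirical_X_measurable[OF that] measurable_functional])
  have W0: "W0 n \<in> borel_measurable M" "norm (W0 n \<omega>) \<le> 1" if "n > 0" for n \<omega>
  proof -
    note [measurable] = EM[OF that]
    show "W0 n \<in> borel_measurable M" unfolding W0_def by measurable
    show "norm (W0 n \<omega>) \<le> 1" by (simp add: W0_def)
  qed
  have chB: "(\<lambda>\<omega>. char (boot_law P \<psi> n (?E n \<omega>)) (t b)) \<in> borel_measurable M" if "n > 0" for n b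
    unfolding char_def
    by (rule measurable_compose[OF measurable_prob_algebraD[OF measurable_compose[OF empirical_X_measurable[OF that] boot_law_measurable[OF that]]] integral_measurable_subprob_algebra]) simp
  have chB1: "norm (char (boot_law P \<psi> n (?E n \<omega>)) u) \<le> 1" if "n > 0" "\<omega> \<in> space M" for n \<omega> u
    by (rule real_distribution.cmod_char_le_1[OF real_distribution_boot_law[OF that(1) space_prob_algebra_empirical[OF that]]])
  have W0_lim: "(\<lambda>n. \<integral>\<omega>. W0 n \<omega> \<partial>M) \<longlonglongrightarrow> char (centered_normal \<sigma>) (t 0)"
  proof -
    have m: "(\<lambda>\<omega>. sqrt (real n) * (\<psi> (?E n \<omega>) - \<psi> P)) \<in> borel_measurable M" for n
    proof (cases "n = 0")
      case False
      then have [measurable]: "(\<lambda>\<omega>. \<psi> (?E n \<omega>)) \<in> borel_measurable M" using EM by simp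
      show ?thesis by measurable
    qed simp
    have "(\<lambda>n. char (distr M borel (\<lambda>\<omega>. sqrt (real n) * (\<psi> (?E n \<omega>) - \<psi> P))) (t 0)) \<longlonglongrightarrow> char (centered_normal \<sigma>) (t 0)"
      by (rule levy_continuity1[OF real_distribution_distr[OF m] real_distribution_centered_normal[OF \<sigma>] clt_data])
    moreover have "char (distr M borel (\<lambda>\<omega>. sqrt (real n) * (\<psi> (?E n \<omega>) - \<psi> P))) (t 0) = (\<integral>\<omega>. W0 n \<omega> \<partial>M)" for n
      unfolding char_def W0_def by (subst integral_distr[OF m]) (simp_all add: mult.assoc)
    ultimately show ?thesis by simp
  qed
  have W: "W n \<in> borel_measurable M" "norm (W n \<omega>) \<le> 1" if n: "n > 0" for n \<omega>
  proof -
    have "(\<lambda>\<omega>. iexp (t b * (sqrt (real n) * (\<psi> (empirical P n (Xs n b) \<omega>) - \<psi> (?E n \<omega>))))) \<in> borel_measurable M" if "b \<in> {1..B}" for b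
    proof -
      note [measurable] = EM[OF n] measurable_compose[OF empirical_Xs_measurable[OF n that] measurable_functional]
      show ?thesis by measurable
    qed
    then show "W n \<in> borel_measurable M"
      unfolding W_def using W0(1)[OF n] by (intro borel_measurable_times borel_measurable_prod) auto
    show "norm (W n \<omega>) \<le> 1"
      unfolding W_def using W0(2)[OF n] by (simp add: norm_mult prod_norm[symmetric])
  qed
  have boot_eq: "(\<integral>\<omega>. W n \<omega> \<partial>M) = (\<integral>\<omega>. W0 n \<omega> * (\<Prod>b\<in>{1..B}. char (boot_law P \<psi> n (?E n \<omega>)) (t b)) \<partial>M)" if n: "n > 0" for n
    unfolding W_def char_def
  proof (rule integral_boot_product[OF n _ W0(2)[OF n]])
    note [measurable] = measurable_compose[OF empirical_data_measurable[OF n] measurable_functional]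
    show "W0 n \<in> borel_measurable (data_algebra n)" unfolding W0_def by measurable
  qed auto
  \<comment> \<open>The bootstrap factors are replaced first. This supplies the limit of the
    expectation of \<open>W\<close>, which is all that the later replacement of the noise factors
    asks of \<open>W\<close>.\<close>
  have "(\<lambda>n. \<integral>\<omega>. W0 n \<omega> * (\<Prod>b\<in>{1..B}. char (boot_law P \<psi> n (?E n \<omega>)) (t b)) \<partial>M) \<longlonglongrightarrow>
      char (centered_normal \<sigma>) (t 0) * (\<Prod>b\<in>{1..B}. char (centered_normal \<sigma>) (t b))"
  proof (rule expectation_mult_prod_tendsto[OF _ _ _ _ _ W0_lim])
    show "\<forall>\<^sub>F n in sequentially. W0 n \<in> borel_measurable M \<and> (\<forall>\<omega>\<in>space M. norm (W0 n \<omega>) \<le> 1)"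
      using pos by eventually_elim (use W0 in auto)
    show "\<forall>\<^sub>F n in sequentially. (\<lambda>\<omega>. char (boot_law P \<psi> n (?E n \<omega>)) (t b)) \<in> borel_measurable M \<and>
        (\<forall>\<omega>\<in>space M. norm (char (boot_law P \<psi> n (?E n \<omega>)) (t b)) \<le> 1)" for b
      using pos by eventually_elim (use chB chB1 in auto)
    show "norm (char (centered_normal \<sigma>) (t b)) \<le> 1" for b
      by (rule real_distribution.cmod_char_le_1[OF real_distribution_centered_normal[OF \<sigma>]])
    show "(\<lambda>n. measure M {\<omega>\<in>space M. \<epsilon> \<le> norm (char (boot_law P \<psi> n (?E n \<omega>)) (t b) - char (centered_normal \<sigma>) (t b))}) \<longlonglongrightarrow> 0"
      if "b \<in> {1..B}" "\<epsilon> > 0" for b \<epsilon>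
      by (rule boot_char_tendsto[OF that(1) \<sigma> that(2) clt_resample[OF that(1)]])
  qed simp
  moreover have "\<forall>\<^sub>F n in sequentially. (\<integral>\<omega>. W0 n \<omega> * (\<Prod>b\<in>{1..B}. char (boot_law P \<psi> n (?E n \<omega>)) (t b)) \<partial>M) = (\<integral>\<omega>. W n \<omega> \<partial>M)"
    using pos by eventually_elim (rule boot_eq[symmetric])
  ultimately have "(\<lambda>n. \<integral>\<omega>. W n \<omega> \<partial>M) \<longlonglongrightarrow> char (centered_normal \<sigma>) (t 0) * (\<Prod>b\<in>{1..B}. char (centered_normal \<sigma>) (t b))"
    by (rule Lim_transform_eventually)
  also have "char (centered_normal \<sigma>) (t 0) * (\<Prod>b\<in>{1..B}. char (centered_normal \<sigma>) (t b)) = (\<Prod>k\<in>{0..B}. char (centered_normal \<sigma>) (t k))"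
  proof -
    have "{0..B} = insert 0 {1..B}" by auto
    then show ?thesis by simp
  qed
  finally have W_lim: "(\<lambda>n. \<integral>\<omega>. W n \<omega> \<partial>M) \<longlonglongrightarrow> (\<Prod>k\<in>{0..B}. char (centered_normal \<sigma>) (t k))" .
  have Zm: "Z n k \<in> borel_measurable M" if n: "n > 0" and k: "k \<in> {0..B}" for n k
  proof -
    note D = driving_measurable[OF n k]
    note [measurable] = measurable_compose[OF D measurable_functional]
    have [measurable]: "(\<lambda>\<omega>. char (N (driving P X Xs n k \<omega>)) (s n k)) \<in> borel_measurable M"
      unfolding char_def
      by (rule measurable_compose[OF measurable_prob_algebraD[OF measurable_compose[OF D noise_kernel]] integral_measurable_subprob_algebra]) simp
    show ?thesis unfolding Z_def by measurable
  qed
  have Z1: "norm (Z n k \<omega>) \<le> 1" if n: "n > 0" and k: "k \<in> {0..B}" and \<omega>: "\<omega> \<in> space M" for n k \<omega>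
    using real_distribution.cmod_char_le_1[OF real_distribution_N[OF measurable_space[OF driving_measurable[OF n k] \<omega>]]]
    by (auto simp: Z_def norm_power norm_mult intro!: power_le_one)
  have "(\<lambda>n. \<integral>\<omega>. W n \<omega> * (\<Prod>k\<in>{0..B}. Z n k \<omega>) \<partial>M) \<longlonglongrightarrow> (\<Prod>k\<in>{0..B}. char (centered_normal \<sigma>) (t k)) * (\<Prod>k\<in>{0..B}. c k)"
  proof (rule expectation_mult_prod_tendsto[OF _ _ _ _ _ W_lim])
    show "\<forall>\<^sub>F n in sequentially. W n \<in> borel_measurable M \<and> (\<forall>\<omega>\<in>space M. norm (W n \<omega>) \<le> 1)"
      using pos by eventually_elim (use W in auto)
    show "\<forall>\<^sub>F n in sequentially. Z n k \<in> borel_measurable M \<and> (\<forall>\<omega>\<in>space M. norm (Z n k \<omega>) \<le> 1)" if "k \<in> {0..B}" for k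
      using pos by eventually_elim (use Zm Z1 that in blast)
    show "norm (c k) \<le> 1" for k
      using p by (simp add: c_def pk_def)
    fix k \<epsilon> assume k: "k \<in> {0..B}" and \<epsilon>: "(\<epsilon> :: real) > 0"
    have ratio_k: "(\<lambda>n. real (runs_number n k) / real n) \<longlonglongrightarrow> pk k"
      using ratio by (cases "k = 0") (auto simp: pk_def)
    have pk: "pk k > 0" using p by (simp add: pk_def)
    show "(\<lambda>n. measure M {\<omega>\<in>space M. \<epsilon> \<le> norm (Z n k \<omega> - c k)}) \<longlonglongrightarrow> 0"
      unfolding Z_def c_def s_def
      by (rule noise_char_tendsto[OF driving_measurable[OF _ k] var[OF k] third[OF k] var_P third_P ratio_k pk \<epsilon>])
  qed simp
  \<comment> \<open>The exact decomposition needs nonempty samples and at least one run at each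
    driving distribution, hence holds only eventually.\<close>
  moreover have "\<forall>\<^sub>F n in sequentially. (\<integral>\<omega>. W n \<omega> * (\<Prod>k\<in>{0..B}. Z n k \<omega>) \<partial>M) = (\<integral>\<omega>. iexp (\<Sum>k\<in>{0..B}. t k * root_n_error n k \<omega>) \<partial>M)"
    using pos top_pos
    unfolding W_def W0_def Z_def s_def
    by eventually_elim (rule char_root_n_error[symmetric])
  ultimately have "(\<lambda>n. \<integral>\<omega>. iexp (\<Sum>k\<in>{0..B}. t k * root_n_error n k \<omega>) \<partial>M) \<longlonglongrightarrow> (\<Prod>k\<in>{0..B}. char (centered_normal \<sigma>) (t k)) * (\<Prod>k\<in>{0..B}. c k)"
    by (rule Lim_transform_eventually)
  also have "(\<Prod>k\<in>{0..B}. char (centered_normal \<sigma>) (t k)) * (\<Prod>k\<in>{0..B}. c k) = (\<Prod>k\<in>{0..B}. complex_of_real (exp (- (v k * (t k)\<^sup>2 / 2))))"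
    unfolding prod.distrib[symmetric]
  proof (rule prod.cong[OF refl])
    fix k
    have "- ((\<sigma> * t k)\<^sup>2 / 2) + - ((t k)\<^sup>2 * ?\<tau> / (2 * pk k)) = - (v k * (t k)\<^sup>2 / 2)"
      using p by (simp add: v_def pk_def field_simps power_mult_distrib)
    then show "char (centered_normal \<sigma>) (t k) * c k = complex_of_real (exp (- (v k * (t k)\<^sup>2 / 2)))"
      unfolding char_centered_normal[OF \<sigma>] c_def of_real_mult[symmetric] exp_add[symmetric] by simp
  qed
  finally show ?thesis .
qed

end

section \<open>The coverage probability\<close>

text \<open>Sequential continuity in the coordinates from \<open>I\<close> makes the set where
  \<open>g\<close> is negative open in those coordinates: otherwise counterexamples at distance
  below \<open>1 / (m + 1)\<close> would converge to \<open>x\<close>.\<close>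

lemma neg_stable_under_coordinate_limits:
  fixes g :: "('k \<Rightarrow> real) \<Rightarrow> real"
  assumes cont: "\<And>y. (\<And>k. k \<in> I \<Longrightarrow> (\<lambda>m. y m k) \<longlonglongrightarrow> x k) \<Longrightarrow> (\<lambda>m. g (y m)) \<longlonglongrightarrow> g x" and neg: "g x < 0"
  shows "\<exists>\<delta>>0. \<forall>y. (\<forall>k\<in>I. \<bar>y k - x k\<bar> < \<delta>) \<longrightarrow> g y < 0"
proof (rule ccontr)
  assume no: "\<not> ?thesis"
  have "\<exists>y. (\<forall>k\<in>I. \<bar>y k - x k\<bar> < 1 / real (Suc m)) \<and> \<not> g y < 0" for m
    using no by (auto dest!: spec[of _ "1 / real (Suc m)"])
  then obtain y where y: "\<And>m k. k \<in> I \<Longrightarrow> \<bar>y m k - x k\<bar> < 1 / real (Suc m)" and ge: "\<And>m. \<not> g (y m) < 0"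
    by metis
  have "(\<lambda>m. y m k) \<longlonglongrightarrow> x k" if "k \<in> I" for k
  proof (rule LIM_zero_cancel, rule Lim_null_comparison)
    show "\<forall>\<^sub>F m in sequentially. norm (y m k - x k) \<le> 1 / real (Suc m)"
      using y[OF that] by (auto intro: always_eventually less_imp_le)
    show "(\<lambda>m. 1 / real (Suc m)) \<longlonglongrightarrow> 0"
      using LIMSEQ_inverse_real_of_nat by (simp add: inverse_eq_divide)
  qed
  from order_tendstoD(2)[OF cont[OF this] neg] show False
    using ge by (auto simp: eventually_sequentially)
qed

lemma sum_sq_dev_tendsto:
  assumes "\<And>k. k \<in> {1..n} \<Longrightarrow> (\<lambda>m. y m k) \<longlonglongrightarrow> x k"
  shows "(\<lambda>m. sum_sq_dev n (y m)) \<longlonglongrightarrow> sum_sq_dev n x"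
  unfolding sum_sq_dev_def divide_inverse
  by (intro tendsto_sum tendsto_power tendsto_diff tendsto_mult tendsto_const assms)

lemma sum_sq_dev_affine:
  assumes "n > 0"
  shows "sum_sq_dev n (\<lambda>i. a + r * z i) = r\<^sup>2 * sum_sq_dev n z"
proof -
  have "(\<Sum>i=1..n. a + r * z i) / real n = a + r * ((\<Sum>i=1..n. z i) / real n)"
    using assms by (simp add: sum.distrib sum_distrib_left[symmetric] add_divide_distrib)
  then show ?thesis
    unfolding sum_sq_dev_def
    by (simp only: sum_distrib_left power_mult_distrib[symmetric] right_diff_distrib add_diff_cancel_left)
qed

lemma sum_sq_dev_cong: "(\<And>i. i \<in> {1..n} \<Longrightarrow> z i = w i) \<Longrightarrow> sum_sq_dev n z = sum_sq_dev n w"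
  unfolding sum_sq_dev_def by (auto intro!: sum.cong arg_cong[where f="\<lambda>x. x\<^sup>2"])

lemma S_M_eq: "S_M B R Y n \<omega> = sqrt (sum_sq_dev B (\<lambda>b. resample_estimate R Y n b \<omega>) / (real B - 1))"
  by (simp add: S_M_def sum_sq_dev_def Let_def)

text \<open>Continuous mapping for one event. The two strict inequalities define open sets, and ties
  between the two sides are null for the limit law.\<close>

lemma studentized_tendsto:
  fixes Z :: "nat \<Rightarrow> nat \<Rightarrow> 'w \<Rightarrow> real"
  assumes M: "prob_space M" and B: "B \<ge> 2" and c: "c \<ge> 0"
    and Z: "\<And>n k. k \<in> {0..B} \<Longrightarrow> Z n k \<in> borel_measurable M"
    and lim: "\<And>t. (\<lambda>n. \<integral>\<omega>. iexp (\<Sum>k\<in>{0..B}. t k * Z n k \<omega>) \<partial>M) \<longlonglongrightarrow> (\<Prod>k\<in>{0..B}. char (centered_normal 1) (t k))"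
  shows "(\<lambda>n. measure M {\<omega>\<in>space M. \<bar>Z n 0 \<omega>\<bar> \<le> c * sqrt (sum_sq_dev B (\<lambda>b. Z n b \<omega>) / (real B - 1))})
    \<longlonglongrightarrow> measure (student_t (B - 1)) {-c..c}"
proof -
  interpret M: prob_space M by fact
  let ?I = "{0..B}"
  let ?N = "centered_normal 1"
  let ?sd = "\<lambda>z. sqrt (sum_sq_dev B z / (real B - 1))"
  let ?PM = "PiM ?I (\<lambda>_. borel :: real measure)"
  define Q where "Q n = distr M ?PM (\<lambda>\<omega>. \<lambda>k\<in>?I. Z n k \<omega>)" for n
  let ?\<mu> = "std_normals ?I"
  have N: "real_distribution ?N" "prob_space ?N"
    using real_distribution_centered_normal[of 1] by (auto simp: real_distribution_def)
  have ZM: "(\<lambda>\<omega>. \<lambda>k\<in>?I. Z n k \<omega>) \<in> M \<rightarrow>\<^sub>M ?PM" for n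
    using Z by (intro measurable_restrict) auto
  have spPM: "space ?PM = extensional ?I" by (simp add: space_PiM PiE_def)
  have sdm: "?sd \<in> borel_measurable ?PM"
  proof -
    have [measurable]: "sum_sq_dev B \<in> borel_measurable ?PM" by (rule sum_sq_dev_measurable) auto
    show ?thesis by measurable
  qed
  have z0: "(\<lambda>z. z 0 :: real) \<in> borel_measurable ?PM" by (intro measurable_component_singleton) auto
  \<comment> \<open>The comparison is kept in product form, without dividing by the sample standard
    deviation, so that openness also holds where the latter vanishes.\<close>
  define U where "U = {z\<in>extensional ?I. \<bar>z 0\<bar> < c * ?sd z}"
  define W where "W = {z\<in>extensional ?I. \<bar>z 0\<bar> > c * ?sd z}"
  define E where "E = {z\<in>space ?PM. \<bar>z 0\<bar> \<le> c * ?sd z}"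
  have EP: "E \<in> sets ?PM"
    unfolding E_def using sdm z0 by measurable
  have cont: "(\<lambda>m. \<bar>y m 0\<bar> - c * ?sd (y m)) \<longlonglongrightarrow> \<bar>x 0\<bar> - c * ?sd x"
    if y: "\<And>k. k \<in> ?I \<Longrightarrow> (\<lambda>m. y m k) \<longlonglongrightarrow> x k" for x :: "nat \<Rightarrow> real" and y
    using B by (intro tendsto_intros sum_sq_dev_tendsto y) auto
  have "(\<lambda>n. measure (Q n) E) \<longlonglongrightarrow> measure ?\<mu> U"
  proof (rule box_convergence_imp_measure_tendsto)
    show "finite ?I" by simp
    show "prob_space (Q n)" for n unfolding Q_def by (rule M.prob_space_distr[OF ZM])
    show "sets (Q n) = sets ?PM" for n by (simp add: Q_def)
    show "prob_space ?\<mu>" by (rule prob_space_std_normals)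
    show "sets ?\<mu> = sets ?PM" by (rule sets_std_normals)
    show "(\<lambda>n. measure (Q n) (half_open_box ?I a b)) \<longlonglongrightarrow> measure ?\<mu> (half_open_box ?I a b)"
      if ab: "\<And>k. k \<in> ?I \<Longrightarrow> a k < b k" for a b
    proof -
      have box: "half_open_box ?I a b \<in> sets ?PM"
        unfolding half_open_box_def by (intro sets_PiM_I_finite) auto
      have "measure (Q n) (half_open_box ?I a b) = measure M {\<omega>\<in>space M. \<forall>k\<in>?I. Z n k \<omega> \<in> {a k<..b k}}" for n
        unfolding Q_def
        by (subst measure_distr[OF ZM box]) (auto simp: half_open_box_def PiE_iff intro!: arg_cong[where f="measure M"])
      moreover have "measure ?\<mu> (half_open_box ?I a b) = (\<Prod>k\<in>?I. measure ?N {a k<..b k})"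
      proof -
        have "emeasure ?\<mu> (half_open_box ?I a b) = (\<Prod>k\<in>?I. emeasure ?N {a k<..b k})"
          unfolding half_open_box_def using N by (intro PiM_emeasure_PiE) auto
        also have "\<dots> = ennreal (\<Prod>k\<in>?I. measure ?N {a k<..b k})"
          using N(2)[THEN prob_space.finite_measure, THEN finite_measure.emeasure_eq_measure]
          by (simp add: prod_ennreal)
        finally show ?thesis by (simp add: measure_def prod_nonneg)
      qed
      ultimately show ?thesis
        using levy_continuity_product[of M ?I Z "\<lambda>_. ?N" a b] M Z N(1) lim ab by simp
    qed
    show "U \<subseteq> extensional ?I" "W \<subseteq> extensional ?I" by (auto simp: U_def W_def)
    show "\<exists>\<delta>>0. \<forall>y\<in>extensional ?I. (\<forall>k\<in>?I. \<bar>y k - x k\<bar> < \<delta>) \<longrightarrow> y \<in> U" if "x \<in> U" for x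
    proof -
      have "\<exists>\<delta>>0. \<forall>y. (\<forall>k\<in>?I. \<bar>y k - x k\<bar> < \<delta>) \<longrightarrow> \<bar>y 0\<bar> - c * ?sd y < 0"
        using that by (intro neg_stable_under_coordinate_limits[OF cont]) (auto simp: U_def)
      then show ?thesis by (fastforce simp: U_def)
    qed
    show "\<exists>\<delta>>0. \<forall>y\<in>extensional ?I. (\<forall>k\<in>?I. \<bar>y k - x k\<bar> < \<delta>) \<longrightarrow> y \<in> W" if "x \<in> W" for x
    proof -
      have "\<exists>\<delta>>0. \<forall>y. (\<forall>k\<in>?I. \<bar>y k - x k\<bar> < \<delta>) \<longrightarrow> - (\<bar>y 0\<bar> - c * ?sd y) < 0"
        using that by (intro neg_stable_under_coordinate_limits[OF tendsto_minus[OF cont]]) (auto simp: W_def)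
      then show ?thesis by (fastforce simp: W_def)
    qed
    show "measure ?\<mu> U + measure ?\<mu> W = 1"
      using measure_std_normals_student_t[OF B c] by (simp add: U_def W_def space_std_normals)
    show "E \<in> sets ?PM" by (rule EP)
    show "U \<subseteq> E" "E \<inter> W = {}" by (auto simp: U_def W_def E_def spPM)
  qed
  moreover have "measure ?\<mu> U = measure (student_t (B - 1)) {-c..c}"
    using measure_std_normals_student_t(1)[OF B c] by (simp add: U_def space_std_normals)
  moreover have "measure (Q n) E = measure M {\<omega>\<in>space M. \<bar>Z n 0 \<omega>\<bar> \<le> c * ?sd (\<lambda>b. Z n b \<omega>)}" for n
  proof -
    have "sum_sq_dev B (\<lambda>k\<in>?I. Z n k \<omega>) = sum_sq_dev B (\<lambda>k. Z n k \<omega>)" for \<omega>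
      by (rule sum_sq_dev_cong) auto
    then show ?thesis
      unfolding Q_def by (subst measure_distr[OF ZM EP])
        (auto simp: E_def spPM intro!: arg_cong[where f="measure M"])
  qed
  ultimately show ?thesis by simp
qed

section \<open>The interval expressed through the scaled errors\<close>

context nested_sampling
begin

lemma root_n_error_0: "root_n_error n 0 \<omega> = sqrt (real n) * (orig_estimate R0 Y n \<omega> - \<psi> P)"
  by (simp add: root_n_error_def orig_estimate_def)

text \<open>The noise-free centre is random but common to all resamples, so it drops out. Hence the
  computable \<open>S_M\<close> may be analysed through errors with an unobserved centre.\<close>

lemma sum_sq_dev_root_n_error:
  assumes n: "n > 0" and B: "B > 0"
  shows "sum_sq_dev B (\<lambda>k. root_n_error n k \<omega>) = real n * sum_sq_dev B (\<lambda>b. resample_estimate R Y n b \<omega>)"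
proof -
  have "sum_sq_dev B (\<lambda>k. root_n_error n k \<omega>) =
     sum_sq_dev B (\<lambda>b. - sqrt (real n) * \<psi> (empirical P n X \<omega>) + sqrt (real n) * resample_estimate R Y n b \<omega>)"
    by (rule sum_sq_dev_cong) (simp add: root_n_error_def resample_estimate_def right_diff_distrib)
  also have "\<dots> = (sqrt (real n))\<^sup>2 * sum_sq_dev B (\<lambda>b. resample_estimate R Y n b \<omega>)"
    by (rule sum_sq_dev_affine[OF B])
  finally show ?thesis by simp
qed

text \<open>The factor \<open>sqrt n\<close> cancels from both sides. The scales \<open>sd0\<close>
  and \<open>sd1\<close> are arbitrary positive numbers here, to be chosen as the limiting standard
  deviations.\<close>

lemma mem_I_M_iff:
  assumes n: "n > 0" and B: "B > 0" and sd: "sd0 > 0" "sd1 > 0"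
  shows "\<psi> P \<in> I_M B R0 R Y \<rho> \<alpha> n \<omega> \<longleftrightarrow>
    \<bar>root_n_error n 0 \<omega> / sd0\<bar> \<le> q_M B \<rho> (1 - \<alpha> / 2) * sd1 / sd0 *
      sqrt (sum_sq_dev B (\<lambda>b. root_n_error n b \<omega> / sd1) / (real B - 1))"
proof -
  let ?q = "q_M B \<rho> (1 - \<alpha> / 2)" and ?S = "S_M B R Y n \<omega>" and ?o = "orig_estimate R0 Y n \<omega>"
  have "sum_sq_dev B (\<lambda>b. root_n_error n b \<omega> / sd1) = (1 / sd1)\<^sup>2 * sum_sq_dev B (\<lambda>b. root_n_error n b \<omega>)"
    using sum_sq_dev_affine[OF B, of 0 "1 / sd1"] by simp
  then have "sqrt (sum_sq_dev B (\<lambda>b. root_n_error n b \<omega> / sd1) / (real B - 1)) = sqrt (real n) * ?S / sd1"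
    unfolding sum_sq_dev_root_n_error[OF n B] S_M_eq using sd
    by (simp add: real_sqrt_mult real_sqrt_divide)
  moreover have "\<bar>root_n_error n 0 \<omega> / sd0\<bar> = sqrt (real n) * \<bar>?o - \<psi> P\<bar> / sd0"
    using sd by (simp add: root_n_error_0 abs_mult)
  moreover have "\<psi> P \<in> I_M B R0 R Y \<rho> \<alpha> n \<omega> \<longleftrightarrow> \<bar>?o - \<psi> P\<bar> \<le> ?q * ?S"
    by (auto simp: I_M_def abs_le_iff)
  moreover have "sqrt (real n) * \<bar>?o - \<psi> P\<bar> / sd0 \<le> ?q * sd1 / sd0 * (sqrt (real n) * ?S / sd1) \<longleftrightarrow> \<bar>?o - \<psi> P\<bar> \<le> ?q * ?S"
  proof -
    have "?q * sd1 / sd0 * (sqrt (real n) * ?S / sd1) = sqrt (real n) * (?q * ?S) / sd0"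
      using sd by simp
    then show ?thesis using n sd by (simp add: divide_le_cancel)
  qed
  ultimately show ?thesis by simp
qed

end

theorem theorem5:
  fixes M :: "'w measure"
    and P :: "'a measure"
    and \<psi> :: "'a measure \<Rightarrow> real"
    and N :: "'a measure \<Rightarrow> real measure"
    and X :: "nat \<Rightarrow> 'w \<Rightarrow> 'a"
    and Xs :: "nat \<Rightarrow> nat \<Rightarrow> nat \<Rightarrow> 'w \<Rightarrow> 'a"
    and Y :: "nat \<Rightarrow> nat \<Rightarrow> nat \<Rightarrow> 'w \<Rightarrow> real"
    and B :: nat
    and R0 R :: "nat \<Rightarrow> nat"
    and \<alpha> \<sigma> p0 p \<rho> :: real
  assumes setting: "nested_sampling M P \<psi> N X Xs Y B R0 R"
    and B: "B \<ge> 2"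
    and \<alpha>: "0 < \<alpha>" "\<alpha> < 1"
    and \<sigma>: "\<sigma> > 0"
    and clt_data:
      "weak_conv_m
         (\<lambda>n. distr M borel (\<lambda>\<omega>. sqrt (real n) * (\<psi> (empirical P n X \<omega>) - \<psi> P)))
         (centered_normal \<sigma>)"
    and clt_resample:
      "\<And>b x. b \<in> {1..B} \<Longrightarrow>
         conv_in_prob M
           (\<lambda>n. cond_prob_given M
              (vimage_algebra (space M) (empirical P n X) (prob_algebra P))
              (\<lambda>\<omega>. sqrt (real n) * (\<psi> (empirical P n (Xs n b) \<omega>) - \<psi> (empirical P n X \<omega>)) \<le> x))
           (cdf (centered_normal \<sigma>) x)"
    and var_data: "conv_in_prob M (\<lambda>n \<omega>. run_var N (empirical P n X \<omega>)) (run_var N P)"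
    and third_data:
      "conv_in_prob M (\<lambda>n \<omega>. run_third_moment \<psi> N (empirical P n X \<omega>)) (run_third_moment \<psi> N P)"
    and var_resample:
      "\<And>b. b \<in> {1..B} \<Longrightarrow>
         conv_in_prob M (\<lambda>n \<omega>. run_var N (empirical P n (Xs n b) \<omega>)) (run_var N P)"
    and third_resample:
      "\<And>b. b \<in> {1..B} \<Longrightarrow>
         conv_in_prob M (\<lambda>n \<omega>. run_third_moment \<psi> N (empirical P n (Xs n b) \<omega>))
           (run_third_moment \<psi> N P)"
    and var_P: "0 < run_var N P" "run_var N P < \<infinity>"
    and third_P: "run_third_moment \<psi> N P < \<infinity>"
    and R0_R_at_top: "filterlim R0 at_top sequentially" "filterlim R at_top sequentially"
    and R0_ratio: "(\<lambda>n. real (R0 n) / real n) \<longlonglongrightarrow> p0"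
    and R_ratio: "(\<lambda>n. real (R n) / real n) \<longlonglongrightarrow> p"
    and p0: "0 < p0" "p0 < 1"
    and p: "0 < p" "p < 1"
    and \<rho>: "\<rho> = sqrt (p0 / p)"
  shows "liminf (\<lambda>n. ereal (measure M {\<omega> \<in> space M. \<psi> P \<in> I_M B R0 R Y \<rho> \<alpha> n \<omega>})) \<ge> ereal (1 - \<alpha>)
    \<and> (\<rho> = 1 \<longrightarrow>
         (\<lambda>n. measure M {\<omega> \<in> space M. \<psi> P \<in> I_M B R0 R Y \<rho> \<alpha> n \<omega>}) \<longlonglongrightarrow> 1 - \<alpha>)"
proof -
  interpret nested_sampling M P \<psi> N X Xs Y B R0 R by (rule setting)
  define \<tau> where "\<tau> = enn2real (run_var N P)"
  define sd where "sd k = sqrt (\<sigma>\<^sup>2 + \<tau> / (if k = 0 then p0 else p))" for k :: nat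
  define tq where "tq = quantile (student_t (B - 1)) (1 - \<alpha> / 2)"
  define c where "c = q_M B \<rho> (1 - \<alpha> / 2) * sd 1 / sd 0"
  define Z where "Z n k \<omega> = root_n_error n k \<omega> / sd k" for n k \<omega>
  have \<tau>: "\<tau> \<ge> 0" by (simp add: \<tau>_def)
  have sd2: "\<sigma>\<^sup>2 + \<tau> / (if k = 0 then p0 else p) > 0" for k :: nat
    using \<sigma> \<tau> p0 p by (intro add_pos_nonneg) auto
  have sd: "sd k > 0" for k using sd2[of k] unfolding sd_def by (rule real_sqrt_gt_zero)
  have sd_sq: "(sd k)\<^sup>2 = \<sigma>\<^sup>2 + \<tau> / (if k = 0 then p0 else p)" for k
    unfolding sd_def using sd2[of k] by (intro real_sqrt_pow2) simp
  have k: "B - 1 > 0" using B by simp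
  note D = real_distribution_student_t[of "B - 1"] measure_student_t_singleton[OF k] distr_student_t_uminus[of "B - 1"]
  \<comment> \<open>Since \<alpha> is below 1, the level \<open>1 - \<alpha> / 2\<close> exceeds
    1/2, and the symmetric interval has mass \<open>2 * (1 - \<alpha> / 2) - 1\<close>.\<close>
  have tq: "tq > 0" and cover: "measure (student_t (B - 1)) {-tq..tq} = 1 - \<alpha>"
    using quantile_symmetric_distribution[OF D, of "1 - \<alpha> / 2"] \<alpha> unfolding tq_def by auto
  have c_eq: "c = max (inverse \<rho>) 1 * (sd 1 / sd 0) * tq" by (simp add: c_def q_M_def tq_def)
  \<comment> \<open>This is where the constant in \<open>q_M\<close> comes from: the unknown ratio
    \<open>sd 0 / sd 1\<close> is bounded in terms of \<open>p0\<close> and \<open>p\<close> alone.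
    If \<open>p \<le> p0\<close>, the original estimate is the less noisy one and the bound 1
    suffices.\<close>
  have factor: "max (inverse \<rho>) 1 * (sd 1 / sd 0) \<ge> 1"
  proof (cases "p \<le> p0")
    case True
    then have "\<tau> / p0 \<le> \<tau> / p" using \<tau> p by (intro divide_left_mono) auto
    then have "(sd 0)\<^sup>2 \<le> (sd 1)\<^sup>2" unfolding sd_sq by simp
    then have "1 \<le> sd 1 / sd 0" using sd[of 0] sd[of 1] by (simp add: power2_le_iff_abs_le)
    then show ?thesis
      using mult_mono[of 1 "max (inverse \<rho>) 1" 1 "sd 1 / sd 0"] by simp
  next
    case False
    have inv: "inverse \<rho> = sqrt (p / p0)" by (simp add: \<rho> real_sqrt_inverse[symmetric] del: real_sqrt_inverse)
    \<comment> \<open>Multiplying by \<open>p / p0\<close> turns the noise term of the resamples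
      exactly into that of the original estimate, and does not decrease the sampling variance
      because \<open>p / p0\<close> exceeds 1.\<close>
    have "(sd 0)\<^sup>2 \<le> (p / p0) * (sd 1)\<^sup>2"
    proof -
      have "1 * \<sigma>\<^sup>2 \<le> (p / p0) * \<sigma>\<^sup>2" using False p0 by (intro mult_right_mono) auto
      moreover have "(p / p0) * (\<tau> / p) = \<tau> / p0" using p by simp
      ultimately show ?thesis unfolding sd_sq by (simp add: distrib_left)
    qed
    then have "sd 0 \<le> inverse \<rho> * sd 1"
      using real_sqrt_le_mono[of "(sd 0)\<^sup>2" "(p / p0) * (sd 1)\<^sup>2"] sd[of 0] sd[of 1]
      unfolding inv by (simp only: real_sqrt_mult real_sqrt_abs abs_of_pos)
    also have "\<dots> \<le> max (inverse \<rho>) 1 * sd 1" using sd[of 1] by (intro mult_right_mono) auto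
    finally show ?thesis using sd[of 0] by (simp add: le_divide_eq)
  qed
  have c_ge: "tq \<le> c"
    unfolding c_eq using mult_right_mono[OF factor, of tq] tq by simp
  have lim: "(\<lambda>n. measure M {\<omega>\<in>space M. \<bar>Z n 0 \<omega>\<bar> \<le> c * sqrt (sum_sq_dev B (\<lambda>b. Z n b \<omega>) / (real B - 1))})
    \<longlonglongrightarrow> measure (student_t (B - 1)) {-c..c}"
  proof (rule studentized_tendsto[OF prob_space_axioms B])
    show "0 \<le> c" using c_ge tq by simp
    show "Z n k \<in> borel_measurable M" if "k \<in> {0..B}" for n k
    proof -
      note [measurable] = root_n_error_measurable[OF that]
      show ?thesis unfolding Z_def by measurable
    qed
    fix t :: "nat \<Rightarrow> real"
    \<comment> \<open>Evaluating at \<open>t k / sd k\<close> standardises the errors, so that the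
      limit becomes a product of standard normal characteristic functions.\<close>
    have "(\<lambda>n. \<integral>\<omega>. iexp (\<Sum>k\<in>{0..B}. (t k / sd k) * root_n_error n k \<omega>) \<partial>M) \<longlonglongrightarrow>
      (\<Prod>k\<in>{0..B}. complex_of_real (exp (- ((\<sigma>\<^sup>2 + enn2real (run_var N P) / (if k = 0 then p0 else p)) * (t k / sd k)\<^sup>2 / 2))))"
    proof (rule char_root_n_error_tendsto[OF \<sigma> clt_data clt_resample _ _ var_P third_P R0_R_at_top R0_ratio R_ratio p0(1) p(1)])
      show "conv_in_prob M (\<lambda>n \<omega>. run_var N (driving P X Xs n k \<omega>)) (run_var N P)" if "k \<in> {0..B}" for k
        using var_data var_resample[of k] that by (cases "k = 0") (auto simp: driving_def)
      show "conv_in_prob M (\<lambda>n \<omega>. run_third_moment \<psi> N (driving P X Xs n k \<omega>)) (run_third_moment \<psi> N P)" if "k \<in> {0..B}" for k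
        using third_data third_resample[of k] that by (cases "k = 0") (auto simp: driving_def)
    qed
    moreover have "complex_of_real (exp (- ((\<sigma>\<^sup>2 + enn2real (run_var N P) / (if k = 0 then p0 else p)) * (t k / sd k)\<^sup>2 / 2))) =
       char (centered_normal 1) (t k)" for k
    proof -
      have "(\<sigma>\<^sup>2 + enn2real (run_var N P) / (if k = 0 then p0 else p)) * (t k / sd k)\<^sup>2 = (t k)\<^sup>2"
        unfolding \<tau>_def[symmetric] sd_sq[symmetric] using sd[of k] by (simp add: power_divide)
      then show ?thesis by (simp only: char_centered_normal zero_less_one mult_1) simp
    qed
    ultimately show "(\<lambda>n. \<integral>\<omega>. iexp (\<Sum>k\<in>{0..B}. t k * Z n k \<omega>) \<partial>M) \<longlonglongrightarrow> (\<Prod>k\<in>{0..B}. char (centered_normal 1) (t k))"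
      by (simp add: Z_def)
  qed
  have "\<forall>\<^sub>F n in sequentially. measure M {\<omega>\<in>space M. \<bar>Z n 0 \<omega>\<bar> \<le> c * sqrt (sum_sq_dev B (\<lambda>b. Z n b \<omega>) / (real B - 1))} =
     measure M {\<omega> \<in> space M. \<psi> P \<in> I_M B R0 R Y \<rho> \<alpha> n \<omega>}"
    \<comment> \<open>At \<open>n = 0\<close> the scaled errors are 0 and carry no information on
      the interval.\<close>
    using eventually_gt_at_top[of 0]
  proof eventually_elim
    case (elim n)
    have "sum_sq_dev B (\<lambda>b. Z n b \<omega>) = sum_sq_dev B (\<lambda>b. root_n_error n b \<omega> / sd 1)" for \<omega>
      by (rule sum_sq_dev_cong) (simp add: Z_def sd_def)
    moreover have "Z n 0 \<omega> = root_n_error n 0 \<omega> / sd 0" for \<omega> by (simp add: Z_def)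
    moreover have "B > 0" using B by simp
    ultimately show ?case
      using mem_I_M_iff[OF elim _ sd[of 0] sd[of 1], of \<rho> \<alpha>] by (simp add: c_def)
  qed
  from Lim_transform_eventually[OF lim this]
  have main: "(\<lambda>n. measure M {\<omega> \<in> space M. \<psi> P \<in> I_M B R0 R Y \<rho> \<alpha> n \<omega>}) \<longlonglongrightarrow> measure (student_t (B - 1)) {-c..c}" .
  interpret T: real_distribution "student_t (B - 1)" by (rule D(1))
  \<comment> \<open>The limiting coverage is that of a Student interval with half-width
    \<open>c\<close>, which contains the one with half-width \<open>tq\<close>.\<close>
  have "1 - \<alpha> \<le> measure (student_t (B - 1)) {-c..c}"
    unfolding cover[symmetric] using c_ge by (intro T.finite_measure_mono) (auto simp del: One_nat_def)
  moreover have "liminf (\<lambda>n. ereal (measure M {\<omega> \<in> space M. \<psi> P \<in> I_M B R0 R Y \<rho> \<alpha> n \<omega>})) = ereal (measure (student_t (B - 1)) {-c..c})"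
    using main by (intro lim_imp_Liminf) auto
  moreover have "c = tq" if "\<rho> = 1"
  \<comment> \<open>Equal computation sizes give equal limiting variances, so the enlargement factor
    is exactly 1.\<close>
  proof -
    have "p0 = p" using that p by (simp add: \<rho>)
    then have "sd 1 = sd 0" by (simp add: sd_def)
    then show ?thesis using that sd[of 0] by (simp add: c_eq)
  qed
  ultimately show ?thesis using main cover by auto
qed

end
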